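(* $\mathrm{WPT}^-$ is partially classically compositional, and $\mathrm{WPT}^- + \mathrm{INT}$ proves the truth of induction.
   Context: Conventions. $\mathcal{L}_{\mathrm{PA}}$ is the language of Peano Arithmetic $\mathrm{PA}$ and $\mathcal{L}_T=\mathcal{L}_{\mathrm{PA}}\cup\{T\}$ with $T$ a new unary predicate. Syntax is arithmetized inside $\mathrm{PA}$ (with a standard coding), and symbols for syntactic operations on codes are suppressed. Inside arithmetic, $\phi,\psi$ range over codes of $\mathcal{L}_{\mathrm{PA}}$-sentences (or of formulae where indicated); $\phi(v)$ over codes of $\mathcal{L}_{\mathrm{PA}}$-formulae with at most one free variable; $s,t$ over codes of closed arithmetical terms; $v$ over codes of variables. $\underline{x}$ is (the code of) the standard numeral for $x$; $s^\circ$ is the value of the closed term coded by $s$. In the arithmetized language $\neg,\vee,\exists$ are primitive, and $\wedge,\forall$ are abbreviations. $\mathrm{tot}(\phi(v))$ is the formula "$\phi(v)$ is an $\mathcal{L}_{\mathrm{PA}}$-formula with at most one free variable, and $\forall x\,(T(\phi(\underline{x}))\vee T(\neg\phi(\underline{x})))$". $\mathrm{WPT}^-$ is the $\mathcal{L}_T$-theory consisting of $\mathrm{PA}$ (induction only for $\mathcal{L}_{\mathrm{PA}}$-formulae) and the axioms: (1a) $\forall s,t\,(T(s=t)\equiv s^\circ=t^\circ)$; (1b) $\forall s,t\,(T(\neg s=t)\equiv s^\circ\neq t^\circ)$; (2a) $\forall\phi,\psi\,\bigl(T(\phi\vee\psi)\equiv(\mathrm{tot}(\phi)\wedge\mathrm{tot}(\psi)\wedge(T(\phi)\vee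 T(\psi)))\bigr)$; (2b) $\forall\phi,\psi\,(T(\neg(\phi\vee\psi))\equiv T(\neg\phi)\wedge T(\neg\psi))$; (3a) $\forall v\forall\phi(v)\,(T(\exists v\phi)\equiv\mathrm{tot}(\phi(v))\wedge\exists x\,T(\phi(\underline{x})))$; (3b) $\forall v\forall\phi(v)\,(T(\neg\exists v\phi)\equiv\forall x\,T(\neg\phi(\underline{x})))$; (4) $\forall\phi\,(T(\neg\neg\phi)\equiv T(\phi))$; (5) $\forall\phi(v)\,\forall s,t\,(s^\circ=t^\circ\rightarrow(T(\phi(s))\equiv T(\phi(t))))$. $\mathrm{INT}$ is the $\mathcal{L}_T$-sentence $$\forall\phi(v)\Bigl[\forall x\,\bigl(T(\phi(\underline{x}))\rightarrow T(\phi(\underline{x+1}))\bigr)\rightarrow\bigl(T(\phi(0))\rightarrow\forall x\,T(\phi(\underline{x}))\bigr)\Bigr].$$ $\mathrm{CC}(x)$ ("$T$ behaves on $x$ compositionally in the sense of classical first-order logic") is the $\mathcal{L}_T$-formula expressing the conjunction of: - for all closed terms $s,t$: if $x=(s=t)$ then $T(x)\equiv s^\circ=t^\circ$; - for all sentences $\phi,\psi$: if $x=\phi\vee\psi$ then $T(x)\equiv T(\phi)\vee T(\psi)$; - for all sentences $\phi$: if $x=\neg\phi$ then $T(x)\equiv\neg T(\phi)$; - for all $v$ and all formulae $\phi$ with at most $v$ free: if $x=\exists v\phi$ then $T(x)\equiv\exists y\,T(\phi(\underline{y}))$; - if $x$ is a formula with at most one free variable, then for all closed terms $s,t$ with $s^\circ=t^\circ$: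 $T(x(s))\equiv T(x(t))$. An $\mathcal{L}_T$-formula $D(y)$ defines an initial segment (provably in a theory $\mathrm{Th}$) if $\mathrm{Th}$ proves $\forall y\,(D(y)\rightarrow\forall x\le y\,D(x))$ and $D(0)\wedge\forall y\,(D(y)\rightarrow D(y+1))$. Let $\mathrm{dp}(\phi)\le y$ be the arithmetical formula representing "the depth of the syntactic tree of $\phi$ is at most $y$". A truth theory $\mathrm{Th}$ (in $\mathcal{L}_T$) is partially classically compositional if there is a formula $D(y)$ which provably in $\mathrm{Th}$ defines an initial segment and such that $\mathrm{Th}\vdash\forall y\bigl(D(y)\rightarrow\forall\phi\,(\mathrm{dp}(\phi)\le y\rightarrow\mathrm{CC}(\phi))\bigr)$, where $\phi$ ranges over codes of $\mathcal{L}_{\mathrm{PA}}$-formulae. For a formula $\phi(x)$, $\mathrm{ind}(\phi(x))$ is the universal closure of $\forall x(\phi(x)\rightarrow\phi(x+1))\rightarrow(\phi(0)\rightarrow\forall x\,\phi(x))$; inside arithmetic $\mathrm{ind}(\cdot)$ denotes the corresponding function on codes of formulae with at most one free variable. $\mathrm{Th}$ proves the truth of induction if there is a formula $D(y)$ which provably in $\mathrm{Th}$ defines an initial segment and such that $\mathrm{Th}\vdash\forall\phi(v)\,\bigl(D(\phi(v))\rightarrow T(\mathrm{ind}(\phi(v)))\bigr)$, where $D(\phi(v))$ means that $D$ holds of the code of $\phi(v)$. *)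

theory Defs
  imports Main
begin

section \<open>First-order arithmetic with a truth predicate\<close>

datatype tm =
    Var nat (\<open>\<^bold>v_\<close> [1000] 1000)
  | Zero
  | Succ tm
  | Add tm tm
  | Mul tm tm

datatype fm =
    Eq tm tm (infix \<open>\<^bold>=\<close> 50)
  | Tr tm
  | Neg fm (\<open>\<^bold>\<not> _\<close> [40] 40)
  | Or fm fm (infixr \<open>\<^bold>\<or>\<close> 30)
  | Exists nat fm (\<open>(\<open>indent=2\<close>\<^bold>\<exists>_./ _)\<close> [1000, 10] 10)

abbreviation Conj :: "fm \<Rightarrow> fm \<Rightarrow> fm" (infixr \<open>\<^bold>\<and>\<close> 35)
  where "\<phi> \<^bold>\<and> \<psi> \<equiv> \<^bold>\<not> (\<^bold>\<not> \<phi> \<^bold>\<or> \<^bold>\<not> \<psi>)"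

abbreviation Imp :: "fm \<Rightarrow> fm \<Rightarrow> fm" (infixr \<open>\<^bold>\<longrightarrow>\<close> 25)
  where "\<phi> \<^bold>\<longrightarrow> \<psi> \<equiv> \<^bold>\<not> \<phi> \<^bold>\<or> \<psi>"

abbreviation Iff :: "fm \<Rightarrow> fm \<Rightarrow> fm" (infixr \<open>\<^bold>\<longleftrightarrow>\<close> 25)
  where "\<phi> \<^bold>\<longleftrightarrow> \<psi> \<equiv> (\<phi> \<^bold>\<longrightarrow> \<psi>) \<^bold>\<and> (\<psi> \<^bold>\<longrightarrow> \<phi>)"

abbreviation Forall :: "nat \<Rightarrow> fm \<Rightarrow> fm" (\<open>(\<open>indent=2\<close>\<^bold>\<forall>_./ _)\<close> [1000, 10] 10)
  where "\<^bold>\<forall>x. \<phi> \<equiv> \<^bold>\<not> (\<^bold>\<exists>x. \<^bold>\<not> \<phi>)"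

primrec tvars :: "tm \<Rightarrow> nat set" where
  "tvars (Var x) = {x}"
| "tvars Zero = {}"
| "tvars (Succ t) = tvars t"
| "tvars (Add t u) = tvars t \<union> tvars u"
| "tvars (Mul t u) = tvars t \<union> tvars u"

primrec fv :: "fm \<Rightarrow> nat set" where
  "fv (t \<^bold>= u) = tvars t \<union> tvars u"
| "fv (Tr t) = tvars t"
| "fv (\<^bold>\<not> \<phi>) = fv \<phi>"
| "fv (\<phi> \<^bold>\<or> \<psi>) = fv \<phi> \<union> fv \<psi>"
| "fv (\<^bold>\<exists>x. \<phi>) = fv \<phi> - {x}"

text \<open>The formulae without truth predicate form the language of Peano Arithmetic.\<close>

primrec arithmetical :: "fm \<Rightarrow> bool" where
  "arithmetical (t \<^bold>= u) = True"
| "arithmetical (Tr t) = False"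
| "arithmetical (\<^bold>\<not> \<phi>) = arithmetical \<phi>"
| "arithmetical (\<phi> \<^bold>\<or> \<psi>) = (arithmetical \<phi> \<and> arithmetical \<psi>)"
| "arithmetical (\<^bold>\<exists>x. \<phi>) = arithmetical \<phi>"

primrec tsubst :: "tm \<Rightarrow> (nat \<Rightarrow> tm) \<Rightarrow> tm" where
  "tsubst (Var x) \<sigma> = \<sigma> x"
| "tsubst Zero \<sigma> = Zero"
| "tsubst (Succ t) \<sigma> = Succ (tsubst t \<sigma>)"
| "tsubst (Add t u) \<sigma> = Add (tsubst t \<sigma>) (tsubst u \<sigma>)"
| "tsubst (Mul t u) \<sigma> = Mul (tsubst t \<sigma>) (tsubst u \<sigma>)"

text \<open>Simultaneous capture-avoiding substitution. A bound variable is renamed only if it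
  would otherwise capture a variable.\<close>

definition avoid :: "nat set \<Rightarrow> nat \<Rightarrow> nat" where
  "avoid A x = (if x \<in> A then Suc (Max A) else x)"

primrec subst :: "fm \<Rightarrow> (nat \<Rightarrow> tm) \<Rightarrow> fm" where
  "subst (t \<^bold>= u) \<sigma> = (tsubst t \<sigma> \<^bold>= tsubst u \<sigma>)"
| "subst (Tr t) \<sigma> = Tr (tsubst t \<sigma>)"
| "subst (\<^bold>\<not> \<phi>) \<sigma> = (\<^bold>\<not> subst \<phi> \<sigma>)"
| "subst (\<phi> \<^bold>\<or> \<psi>) \<sigma> = (subst \<phi> \<sigma> \<^bold>\<or> subst \<psi> \<sigma>)"
| "subst (\<^bold>\<exists>x. \<phi>) \<sigma> =
     (let z = avoid (\<Union>y \<in> fv \<phi> - {x}. tvars (\<sigma> y)) x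
      in \<^bold>\<exists>z. subst \<phi> (\<sigma>(x := Var z)))"

definition subst1 :: "fm \<Rightarrow> nat \<Rightarrow> tm \<Rightarrow> fm" where
  "subst1 \<phi> x t = subst \<phi> (Var(x := t))"

text \<open>\<open>inst \<phi> [t\<^sub>0, \<dots>, t\<^sub>n]\<close> replaces the free variables \<open>\<^bold>v0, \<dots>, \<^bold>vn\<close> of \<open>\<phi>\<close>. Because the
  substitution is capture-avoiding, formulae with parameters that are defined through
  \<open>inst\<close> can be applied to arbitrary terms.\<close>

definition inst :: "fm \<Rightarrow> tm list \<Rightarrow> fm" where
  "inst \<phi> ts = subst \<phi> (\<lambda>i. if i < length ts then ts ! i else Var i)"

definition universal_closure :: "fm \<Rightarrow> fm" where
  "universal_closure \<phi> = foldr Forall (sorted_list_of_set (fv \<phi>)) \<phi>"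


section \<open>Provability\<close>

text \<open>A Hilbert calculus for classical first-order logic with equality: all tautologies are
  logical axioms.\<close>

primrec prop_value :: "(fm \<Rightarrow> bool) \<Rightarrow> fm \<Rightarrow> bool" where
  "prop_value I (t \<^bold>= u) = I (t \<^bold>= u)"
| "prop_value I (Tr t) = I (Tr t)"
| "prop_value I (\<^bold>\<not> \<phi>) = (\<not> prop_value I \<phi>)"
| "prop_value I (\<phi> \<^bold>\<or> \<psi>) = (prop_value I \<phi> \<or> prop_value I \<psi>)"
| "prop_value I (\<^bold>\<exists>x. \<phi>) = I (\<^bold>\<exists>x. \<phi>)"

definition tautology :: "fm \<Rightarrow> bool" where
  "tautology \<phi> \<longleftrightarrow> (\<forall>I. prop_value I \<phi>)"

inductive proves :: "fm set \<Rightarrow> fm \<Rightarrow> bool" (infix \<open>\<turnstile>\<close> 9) for Th where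
  Axiom: "\<phi> \<in> Th \<Longrightarrow> Th \<turnstile> \<phi>"
| Taut: "tautology \<phi> \<Longrightarrow> Th \<turnstile> \<phi>"
| Ex_intro: "Th \<turnstile> subst1 \<phi> x t \<^bold>\<longrightarrow> (\<^bold>\<exists>x. \<phi>)"
| Eq_refl: "Th \<turnstile> t \<^bold>= t"
| Eq_Succ: "Th \<turnstile> t \<^bold>= t' \<^bold>\<longrightarrow> Succ t \<^bold>= Succ t'"
| Eq_Add: "Th \<turnstile> t \<^bold>= t' \<^bold>\<longrightarrow> u \<^bold>= u' \<^bold>\<longrightarrow> Add t u \<^bold>= Add t' u'"
| Eq_Mul: "Th \<turnstile> t \<^bold>= t' \<^bold>\<longrightarrow> u \<^bold>= u' \<^bold>\<longrightarrow> Mul t u \<^bold>= Mul t' u'"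
| Eq_Eq: "Th \<turnstile> t \<^bold>= t' \<^bold>\<longrightarrow> u \<^bold>= u' \<^bold>\<longrightarrow> t \<^bold>= u \<^bold>\<longrightarrow> t' \<^bold>= u'"
| Eq_Tr: "Th \<turnstile> t \<^bold>= t' \<^bold>\<longrightarrow> Tr t \<^bold>\<longrightarrow> Tr t'"
| MP: "Th \<turnstile> \<phi> \<^bold>\<longrightarrow> \<psi> \<Longrightarrow> Th \<turnstile> \<phi> \<Longrightarrow> Th \<turnstile> \<psi>"
| Ex_elim: "Th \<turnstile> \<phi> \<^bold>\<longrightarrow> \<psi> \<Longrightarrow> x \<notin> fv \<psi> \<Longrightarrow> Th \<turnstile> (\<^bold>\<exists>x. \<phi>) \<^bold>\<longrightarrow> \<psi>"


section \<open>Peano Arithmetic\<close>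

definition ind :: "fm \<Rightarrow> nat \<Rightarrow> fm" where
  "ind \<phi> x = universal_closure
     ((\<^bold>\<forall>x. \<phi> \<^bold>\<longrightarrow> subst1 \<phi> x (Succ (Var x))) \<^bold>\<longrightarrow> subst1 \<phi> x Zero \<^bold>\<longrightarrow> (\<^bold>\<forall>x. \<phi>))"

definition PA :: "fm set" where
  "PA =
     {\<^bold>\<forall>0. \<^bold>\<not> Succ \<^bold>v0 \<^bold>= Zero,
      \<^bold>\<forall>0. \<^bold>\<forall>1. Succ \<^bold>v0 \<^bold>= Succ \<^bold>v1 \<^bold>\<longrightarrow> \<^bold>v0 \<^bold>= \<^bold>v1,
      \<^bold>\<forall>0. Add \<^bold>v0 Zero \<^bold>= \<^bold>v0,
      \<^bold>\<forall>0. \<^bold>\<forall>1. Add \<^bold>v0 (Succ \<^bold>v1) \<^bold>= Succ (Add \<^bold>v0 \<^bold>v1),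
      \<^bold>\<forall>0. Mul \<^bold>v0 Zero \<^bold>= Zero,
      \<^bold>\<forall>0. \<^bold>\<forall>1. Mul \<^bold>v0 (Succ \<^bold>v1) \<^bold>= Add (Mul \<^bold>v0 \<^bold>v1) \<^bold>v0}
     \<union> {ind \<phi> x |\<phi> x. arithmetical \<phi>}"


section \<open>Coding of pairs and finite sets\<close>

definition Le :: "tm \<Rightarrow> tm \<Rightarrow> fm" where
  "Le t u = inst (\<^bold>\<exists>2. Add \<^bold>v0 \<^bold>v2 \<^bold>= \<^bold>v1) [t, u]"

definition Lt :: "tm \<Rightarrow> tm \<Rightarrow> fm" where
  "Lt t u = Le (Succ t) u"

text \<open>\<open>z\<close> is the Cantor pair \<open>\<langle>x, y\<rangle> = (x + y)(x + y + 1)/2 + x\<close>, as in \<open>prod_encode\<close>.\<close>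

definition CPair :: "tm \<Rightarrow> tm \<Rightarrow> tm \<Rightarrow> fm" where
  "CPair x y z = (Add z z \<^bold>= Add (Mul (Add x y) (Succ (Add x y))) (Add x x))"

text \<open>Every finite set is coded by some \<open>s = \<langle>k, \<langle>a, b\<rangle>\<rangle>\<close>, whose elements are the \<open>x < k\<close> such
  that \<open>1 + (x + 1) b\<close> divides \<open>a\<close> (for suitable \<open>b\<close> these moduli are pairwise coprime).\<close>

definition Elem :: "tm \<Rightarrow> tm \<Rightarrow> fm" where
  "Elem x s = inst
     (\<^bold>\<exists>2. \<^bold>\<exists>3. \<^bold>\<exists>4. \<^bold>\<exists>5. \<^bold>\<exists>6.
        CPair \<^bold>v3 \<^bold>v4 \<^bold>v5 \<^bold>\<and> CPair \<^bold>v2 \<^bold>v5 \<^bold>v1 \<^bold>\<and> Lt \<^bold>v0 \<^bold>v2 \<^bold>\<and>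
        \<^bold>v3 \<^bold>= Mul \<^bold>v6 (Succ (Mul (Succ \<^bold>v0) \<^bold>v4))) [x, s]"

definition PairElem :: "tm \<Rightarrow> tm \<Rightarrow> tm \<Rightarrow> fm" where
  "PairElem x y s = inst (\<^bold>\<exists>3. CPair \<^bold>v0 \<^bold>v1 \<^bold>v3 \<^bold>\<and> Elem \<^bold>v3 \<^bold>v2) [x, y, s]"

text \<open>The set inductively generated by a rule \<open>R\<close>, whose free variables \<open>\<^bold>v0\<close> and \<open>\<^bold>v1\<close> stand for
  an element and for a set of possible premises: \<open>x\<close> belongs to a finite set all of whose
  elements are obtained by \<open>R\<close> from elements of that set. In every rule below the premises have
  smaller (first) components than the conclusion, so such sets are well-founded derivations.\<close>

definition Gen :: "fm \<Rightarrow> tm \<Rightarrow> fm" where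
  "Gen R x = inst
     (\<^bold>\<exists>1. Elem \<^bold>v0 \<^bold>v1 \<^bold>\<and> (\<^bold>\<forall>2. Elem \<^bold>v2 \<^bold>v1 \<^bold>\<longrightarrow> inst R [\<^bold>v2, \<^bold>v1])) [x]"


section \<open>Arithmetized syntax\<close>

text \<open>The codes of the variable with index \<open>i\<close> and of \<open>0\<close>, \<open>S t\<close>, \<open>t + u\<close>, \<open>t \<cdot> u\<close>, \<open>t = u\<close>, \<open>\<not> \<phi>\<close>,
  \<open>\<phi> \<or> \<psi>\<close>, \<open>\<exists>v \<phi>\<close> are \<open>\<langle>0, i\<rangle>\<close>, \<open>\<langle>1, 0\<rangle>\<close>, \<open>\<langle>2, t\<rangle>\<close>, \<open>\<langle>3, \<langle>t, u\<rangle>\<rangle>\<close>, \<open>\<langle>4, \<langle>t, u\<rangle>\<rangle>\<close>, \<open>\<langle>5, \<langle>t, u\<rangle>\<rangle>\<close>, \<open>\<langle>6, \<phi>\<rangle>\<close>,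
  \<open>\<langle>7, \<langle>\<phi>, \<psi>\<rangle>\<rangle>\<close>, \<open>\<langle>8, \<langle>v, \<phi>\<rangle>\<rangle>\<close>, where the components are codes as well. A predicate for the graph
  of an operation takes the result as its last argument.\<close>

definition num :: "nat \<Rightarrow> tm" where
  "num n = (Succ ^^ n) Zero"

definition Triple :: "tm \<Rightarrow> tm \<Rightarrow> tm \<Rightarrow> tm \<Rightarrow> fm" where
  "Triple x y z w = inst (\<^bold>\<exists>4. CPair \<^bold>v1 \<^bold>v2 \<^bold>v4 \<^bold>\<and> CPair \<^bold>v0 \<^bold>v4 \<^bold>v3) [x, y, z, w]"

definition TripleElem :: "tm \<Rightarrow> tm \<Rightarrow> tm \<Rightarrow> tm \<Rightarrow> fm" where
  "TripleElem x y z s = inst (\<^bold>\<exists>4. Triple \<^bold>v0 \<^bold>v1 \<^bold>v2 \<^bold>v4 \<^bold>\<and> Elem \<^bold>v4 \<^bold>v3) [x, y, z, s]"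

definition CZero :: "tm \<Rightarrow> fm" where "CZero e = CPair (num 1) Zero e"
definition CSucc :: "tm \<Rightarrow> tm \<Rightarrow> fm" where "CSucc t e = CPair (num 2) t e"
definition CAdd :: "tm \<Rightarrow> tm \<Rightarrow> tm \<Rightarrow> fm" where "CAdd t u e = Triple (num 3) t u e"
definition CMul :: "tm \<Rightarrow> tm \<Rightarrow> tm \<Rightarrow> fm" where "CMul t u e = Triple (num 4) t u e"
definition CEq :: "tm \<Rightarrow> tm \<Rightarrow> tm \<Rightarrow> fm" where "CEq t u e = Triple (num 5) t u e"
definition CNeg :: "tm \<Rightarrow> tm \<Rightarrow> fm" where "CNeg p e = CPair (num 6) p e"
definition COr :: "tm \<Rightarrow> tm \<Rightarrow> tm \<Rightarrow> fm" where "COr p q e = Triple (num 7) p q e"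
definition CEx :: "tm \<Rightarrow> tm \<Rightarrow> tm \<Rightarrow> fm" where "CEx v p e = Triple (num 8) v p e"

definition CImp :: "tm \<Rightarrow> tm \<Rightarrow> tm \<Rightarrow> fm" where
  "CImp p q e = inst (\<^bold>\<exists>3. CNeg \<^bold>v0 \<^bold>v3 \<^bold>\<and> COr \<^bold>v3 \<^bold>v1 \<^bold>v2) [p, q, e]"

definition CAll :: "tm \<Rightarrow> tm \<Rightarrow> tm \<Rightarrow> fm" where
  "CAll v p e = inst
     (\<^bold>\<exists>3. \<^bold>\<exists>4. CNeg \<^bold>v1 \<^bold>v3 \<^bold>\<and> CEx \<^bold>v0 \<^bold>v3 \<^bold>v4 \<^bold>\<and> CNeg \<^bold>v4 \<^bold>v2) [v, p, e]"

definition IsVar :: "tm \<Rightarrow> fm" where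
  "IsVar e = inst (\<^bold>\<exists>1. CPair Zero \<^bold>v1 \<^bold>v0) [e]"

definition IsTerm :: "tm \<Rightarrow> fm" where
  "IsTerm = Gen
     (IsVar \<^bold>v0 \<^bold>\<or> CZero \<^bold>v0
      \<^bold>\<or> (\<^bold>\<exists>2. Elem \<^bold>v2 \<^bold>v1 \<^bold>\<and> CSucc \<^bold>v2 \<^bold>v0)
      \<^bold>\<or> (\<^bold>\<exists>2. \<^bold>\<exists>3. Elem \<^bold>v2 \<^bold>v1 \<^bold>\<and> Elem \<^bold>v3 \<^bold>v1 \<^bold>\<and> (CAdd \<^bold>v2 \<^bold>v3 \<^bold>v0 \<^bold>\<or> CMul \<^bold>v2 \<^bold>v3 \<^bold>v0)))"

definition IsFm :: "tm \<Rightarrow> fm" where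
  "IsFm = Gen
     ((\<^bold>\<exists>2. \<^bold>\<exists>3. IsTerm \<^bold>v2 \<^bold>\<and> IsTerm \<^bold>v3 \<^bold>\<and> CEq \<^bold>v2 \<^bold>v3 \<^bold>v0)
      \<^bold>\<or> (\<^bold>\<exists>2. Elem \<^bold>v2 \<^bold>v1 \<^bold>\<and> CNeg \<^bold>v2 \<^bold>v0)
      \<^bold>\<or> (\<^bold>\<exists>2. \<^bold>\<exists>3. Elem \<^bold>v2 \<^bold>v1 \<^bold>\<and> Elem \<^bold>v3 \<^bold>v1 \<^bold>\<and> COr \<^bold>v2 \<^bold>v3 \<^bold>v0)
      \<^bold>\<or> (\<^bold>\<exists>2. \<^bold>\<exists>3. IsVar \<^bold>v2 \<^bold>\<and> Elem \<^bold>v3 \<^bold>v1 \<^bold>\<and> CEx \<^bold>v2 \<^bold>v3 \<^bold>v0))"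

text \<open>The variable \<open>v\<close> occurs free in the term or formula \<open>e\<close>. In the rule, \<open>\<^bold>v0 = \<langle>e, v\<rangle>\<close> with
  \<open>e = \<^bold>v2\<close> and \<open>v = \<^bold>v3\<close>.\<close>

definition FreeIn :: "tm \<Rightarrow> tm \<Rightarrow> fm" where
  "FreeIn v e = inst (\<^bold>\<exists>2. CPair \<^bold>v1 \<^bold>v0 \<^bold>v2 \<^bold>\<and> Gen
     (\<^bold>\<exists>2. \<^bold>\<exists>3. CPair \<^bold>v2 \<^bold>v3 \<^bold>v0 \<^bold>\<and>
       ((IsVar \<^bold>v2 \<^bold>\<and> \<^bold>v2 \<^bold>= \<^bold>v3)
        \<^bold>\<or> (\<^bold>\<exists>4. PairElem \<^bold>v4 \<^bold>v3 \<^bold>v1 \<^bold>\<and> (CSucc \<^bold>v4 \<^bold>v2 \<^bold>\<or> CNeg \<^bold>v4 \<^bold>v2))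
        \<^bold>\<or> (\<^bold>\<exists>4. \<^bold>\<exists>5. (PairElem \<^bold>v4 \<^bold>v3 \<^bold>v1 \<^bold>\<or> PairElem \<^bold>v5 \<^bold>v3 \<^bold>v1) \<^bold>\<and>
             (CAdd \<^bold>v4 \<^bold>v5 \<^bold>v2 \<^bold>\<or> CMul \<^bold>v4 \<^bold>v5 \<^bold>v2 \<^bold>\<or> CEq \<^bold>v4 \<^bold>v5 \<^bold>v2 \<^bold>\<or> COr \<^bold>v4 \<^bold>v5 \<^bold>v2))
        \<^bold>\<or> (\<^bold>\<exists>4. \<^bold>\<exists>5. CEx \<^bold>v4 \<^bold>v5 \<^bold>v2 \<^bold>\<and> \<^bold>\<not> \<^bold>v4 \<^bold>= \<^bold>v3 \<^bold>\<and> PairElem \<^bold>v5 \<^bold>v3 \<^bold>v1)))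
     \<^bold>v2) [v, e]"

definition ClosedTerm :: "tm \<Rightarrow> fm" where
  "ClosedTerm t = inst (IsTerm \<^bold>v0 \<^bold>\<and> (\<^bold>\<forall>1. \<^bold>\<not> FreeIn \<^bold>v1 \<^bold>v0)) [t]"

definition Sentence :: "tm \<Rightarrow> fm" where
  "Sentence p = inst (IsFm \<^bold>v0 \<^bold>\<and> (\<^bold>\<forall>1. \<^bold>\<not> FreeIn \<^bold>v1 \<^bold>v0)) [p]"

text \<open>\<open>v\<close> is a variable and \<open>p\<close> is a formula with at most \<open>v\<close> free.\<close>

definition IsFm1 :: "tm \<Rightarrow> tm \<Rightarrow> fm" where
  "IsFm1 v p = inst
     (IsVar \<^bold>v0 \<^bold>\<and> IsFm \<^bold>v1 \<^bold>\<and> (\<^bold>\<forall>2. FreeIn \<^bold>v2 \<^bold>v1 \<^bold>\<longrightarrow> \<^bold>v2 \<^bold>= \<^bold>v0)) [v, p]"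

text \<open>\<open>e'\<close> is the result of replacing the free occurrences of the variable \<open>v\<close> in the term or
  formula \<open>e\<close> by the term \<open>r\<close>. There is no renaming: this is only used for closed \<open>r\<close> and for
  \<open>r = S v\<close>, where no variable can be captured. In the rule, \<open>\<^bold>v0 = \<langle>e, \<langle>e', \<langle>v, r\<rangle>\<rangle>\<rangle>\<close> with
  \<open>e = \<^bold>v2\<close>, \<open>e' = \<^bold>v3\<close>, \<open>\<langle>v, r\<rangle> = \<^bold>v4\<close>, \<open>v = \<^bold>v5\<close>, \<open>r = \<^bold>v6\<close>.\<close>

definition Sub :: "tm \<Rightarrow> tm \<Rightarrow> tm \<Rightarrow> tm \<Rightarrow> fm" where
  "Sub v r e e' = inst (\<^bold>\<exists>4. \<^bold>\<exists>5. CPair \<^bold>v0 \<^bold>v1 \<^bold>v4 \<^bold>\<and> Triple \<^bold>v2 \<^bold>v3 \<^bold>v4 \<^bold>v5 \<^bold>\<and> Gen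
     (\<^bold>\<exists>2. \<^bold>\<exists>3. \<^bold>\<exists>4. \<^bold>\<exists>5. \<^bold>\<exists>6. CPair \<^bold>v5 \<^bold>v6 \<^bold>v4 \<^bold>\<and> Triple \<^bold>v2 \<^bold>v3 \<^bold>v4 \<^bold>v0 \<^bold>\<and>
       ((IsVar \<^bold>v2 \<^bold>\<and> \<^bold>v2 \<^bold>= \<^bold>v5 \<^bold>\<and> \<^bold>v3 \<^bold>= \<^bold>v6)
        \<^bold>\<or> (IsVar \<^bold>v2 \<^bold>\<and> \<^bold>\<not> \<^bold>v2 \<^bold>= \<^bold>v5 \<^bold>\<and> \<^bold>v3 \<^bold>= \<^bold>v2)
        \<^bold>\<or> (CZero \<^bold>v2 \<^bold>\<and> \<^bold>v3 \<^bold>= \<^bold>v2)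
        \<^bold>\<or> (\<^bold>\<exists>7. \<^bold>\<exists>8. TripleElem \<^bold>v7 \<^bold>v8 \<^bold>v4 \<^bold>v1 \<^bold>\<and>
             ((CSucc \<^bold>v7 \<^bold>v2 \<^bold>\<and> CSucc \<^bold>v8 \<^bold>v3) \<^bold>\<or> (CNeg \<^bold>v7 \<^bold>v2 \<^bold>\<and> CNeg \<^bold>v8 \<^bold>v3)))
        \<^bold>\<or> (\<^bold>\<exists>7. \<^bold>\<exists>8. \<^bold>\<exists>9. \<^bold>\<exists>10. TripleElem \<^bold>v7 \<^bold>v8 \<^bold>v4 \<^bold>v1 \<^bold>\<and> TripleElem \<^bold>v9 \<^bold>v10 \<^bold>v4 \<^bold>v1 \<^bold>\<and>
             ((CAdd \<^bold>v7 \<^bold>v9 \<^bold>v2 \<^bold>\<and> CAdd \<^bold>v8 \<^bold>v10 \<^bold>v3)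
              \<^bold>\<or> (CMul \<^bold>v7 \<^bold>v9 \<^bold>v2 \<^bold>\<and> CMul \<^bold>v8 \<^bold>v10 \<^bold>v3)
              \<^bold>\<or> (CEq \<^bold>v7 \<^bold>v9 \<^bold>v2 \<^bold>\<and> CEq \<^bold>v8 \<^bold>v10 \<^bold>v3)
              \<^bold>\<or> (COr \<^bold>v7 \<^bold>v9 \<^bold>v2 \<^bold>\<and> COr \<^bold>v8 \<^bold>v10 \<^bold>v3)))
        \<^bold>\<or> (\<^bold>\<exists>7. CEx \<^bold>v5 \<^bold>v7 \<^bold>v2 \<^bold>\<and> \<^bold>v3 \<^bold>= \<^bold>v2)
        \<^bold>\<or> (\<^bold>\<exists>7. \<^bold>\<exists>8. \<^bold>\<exists>9. CEx \<^bold>v7 \<^bold>v8 \<^bold>v2 \<^bold>\<and> \<^bold>\<not> \<^bold>v7 \<^bold>= \<^bold>v5 \<^bold>\<and>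
             TripleElem \<^bold>v8 \<^bold>v9 \<^bold>v4 \<^bold>v1 \<^bold>\<and> CEx \<^bold>v7 \<^bold>v9 \<^bold>v3)))
     \<^bold>v5) [v, r, e, e']"

text \<open>The code of the standard numeral of \<open>x\<close> is \<open>n\<close>; \<open>\<^bold>v0 = \<langle>x, n\<rangle>\<close> in the rule.\<close>

definition Numeral :: "tm \<Rightarrow> tm \<Rightarrow> fm" where
  "Numeral x n = inst (\<^bold>\<exists>2. CPair \<^bold>v0 \<^bold>v1 \<^bold>v2 \<^bold>\<and> Gen
     (\<^bold>\<exists>2. \<^bold>\<exists>3. CPair \<^bold>v2 \<^bold>v3 \<^bold>v0 \<^bold>\<and>
       ((\<^bold>v2 \<^bold>= Zero \<^bold>\<and> CZero \<^bold>v3)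
        \<^bold>\<or> (\<^bold>\<exists>4. \<^bold>\<exists>5. PairElem \<^bold>v4 \<^bold>v5 \<^bold>v1 \<^bold>\<and> \<^bold>v2 \<^bold>= Succ \<^bold>v4 \<^bold>\<and> CSucc \<^bold>v5 \<^bold>v3)))
     \<^bold>v2) [x, n]"

text \<open>The value of the closed term \<open>t\<close> is \<open>y\<close>; \<open>\<^bold>v0 = \<langle>t, y\<rangle>\<close> in the rule.\<close>

definition Val :: "tm \<Rightarrow> tm \<Rightarrow> fm" where
  "Val t y = inst (\<^bold>\<exists>2. CPair \<^bold>v0 \<^bold>v1 \<^bold>v2 \<^bold>\<and> Gen
     (\<^bold>\<exists>2. \<^bold>\<exists>3. CPair \<^bold>v2 \<^bold>v3 \<^bold>v0 \<^bold>\<and>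
       ((CZero \<^bold>v2 \<^bold>\<and> \<^bold>v3 \<^bold>= Zero)
        \<^bold>\<or> (\<^bold>\<exists>4. \<^bold>\<exists>5. PairElem \<^bold>v4 \<^bold>v5 \<^bold>v1 \<^bold>\<and> CSucc \<^bold>v4 \<^bold>v2 \<^bold>\<and> \<^bold>v3 \<^bold>= Succ \<^bold>v5)
        \<^bold>\<or> (\<^bold>\<exists>4. \<^bold>\<exists>5. \<^bold>\<exists>6. \<^bold>\<exists>7. PairElem \<^bold>v4 \<^bold>v5 \<^bold>v1 \<^bold>\<and> PairElem \<^bold>v6 \<^bold>v7 \<^bold>v1 \<^bold>\<and>
             ((CAdd \<^bold>v4 \<^bold>v6 \<^bold>v2 \<^bold>\<and> \<^bold>v3 \<^bold>= Add \<^bold>v5 \<^bold>v7)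
              \<^bold>\<or> (CMul \<^bold>v4 \<^bold>v6 \<^bold>v2 \<^bold>\<and> \<^bold>v3 \<^bold>= Mul \<^bold>v5 \<^bold>v7)))))
     \<^bold>v2) [t, y]"

definition EqVal :: "tm \<Rightarrow> tm \<Rightarrow> fm" where
  "EqVal s t = inst (\<^bold>\<exists>2. Val \<^bold>v0 \<^bold>v2 \<^bold>\<and> Val \<^bold>v1 \<^bold>v2) [s, t]"

text \<open>The syntactic tree of the formula \<open>p\<close>, whose leaves are the atomic formulae, has
  depth \<open>n\<close>; \<open>\<^bold>v0 = \<langle>p, n\<rangle>\<close> in the rule.\<close>

definition Depth :: "tm \<Rightarrow> tm \<Rightarrow> fm" where
  "Depth p n = inst (\<^bold>\<exists>2. CPair \<^bold>v0 \<^bold>v1 \<^bold>v2 \<^bold>\<and> Gen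
     (\<^bold>\<exists>2. \<^bold>\<exists>3. CPair \<^bold>v2 \<^bold>v3 \<^bold>v0 \<^bold>\<and>
       (((\<^bold>\<exists>4. \<^bold>\<exists>5. CEq \<^bold>v4 \<^bold>v5 \<^bold>v2) \<^bold>\<and> \<^bold>v3 \<^bold>= Zero)
        \<^bold>\<or> (\<^bold>\<exists>4. \<^bold>\<exists>5. PairElem \<^bold>v4 \<^bold>v5 \<^bold>v1 \<^bold>\<and> CNeg \<^bold>v4 \<^bold>v2 \<^bold>\<and> \<^bold>v3 \<^bold>= Succ \<^bold>v5)
        \<^bold>\<or> (\<^bold>\<exists>4. \<^bold>\<exists>5. \<^bold>\<exists>6. \<^bold>\<exists>7. PairElem \<^bold>v4 \<^bold>v5 \<^bold>v1 \<^bold>\<and> PairElem \<^bold>v6 \<^bold>v7 \<^bold>v1 \<^bold>\<and> COr \<^bold>v4 \<^bold>v6 \<^bold>v2 \<^bold>\<and>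
             ((Le \<^bold>v5 \<^bold>v7 \<^bold>\<and> \<^bold>v3 \<^bold>= Succ \<^bold>v7) \<^bold>\<or> (Le \<^bold>v7 \<^bold>v5 \<^bold>\<and> \<^bold>v3 \<^bold>= Succ \<^bold>v5)))
        \<^bold>\<or> (\<^bold>\<exists>4. \<^bold>\<exists>5. \<^bold>\<exists>6. PairElem \<^bold>v4 \<^bold>v5 \<^bold>v1 \<^bold>\<and> CEx \<^bold>v6 \<^bold>v4 \<^bold>v2 \<^bold>\<and> \<^bold>v3 \<^bold>= Succ \<^bold>v5)))
     \<^bold>v2) [p, n]"

definition DepthLe :: "tm \<Rightarrow> tm \<Rightarrow> fm" where
  "DepthLe p y = inst (\<^bold>\<exists>2. Depth \<^bold>v0 \<^bold>v2 \<^bold>\<and> Le \<^bold>v2 \<^bold>v1) [p, y]"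

text \<open>\<open>e\<close> is the code of \<open>ind(p)\<close>, for a formula \<open>p\<close> with at most \<open>v\<close> free.\<close>

definition CInd :: "tm \<Rightarrow> tm \<Rightarrow> tm \<Rightarrow> fm" where
  "CInd v p e = inst
     (\<^bold>\<exists>3. \<^bold>\<exists>4. \<^bold>\<exists>5. \<^bold>\<exists>6. \<^bold>\<exists>7. \<^bold>\<exists>8. \<^bold>\<exists>9. \<^bold>\<exists>10.
        CSucc \<^bold>v0 \<^bold>v3 \<^bold>\<and> Sub \<^bold>v0 \<^bold>v3 \<^bold>v1 \<^bold>v4 \<^bold>\<and> CImp \<^bold>v1 \<^bold>v4 \<^bold>v5 \<^bold>\<and> CAll \<^bold>v0 \<^bold>v5 \<^bold>v6 \<^bold>\<and>
        CZero \<^bold>v7 \<^bold>\<and> Sub \<^bold>v0 \<^bold>v7 \<^bold>v1 \<^bold>v8 \<^bold>\<and> CAll \<^bold>v0 \<^bold>v1 \<^bold>v9 \<^bold>\<and> CImp \<^bold>v8 \<^bold>v9 \<^bold>v10 \<^bold>\<and>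
        CImp \<^bold>v6 \<^bold>v10 \<^bold>v2) [v, p, e]"


section \<open>Truth\<close>

text \<open>\<open>e = p(x)\<close>, the result of substituting the numeral of \<open>x\<close> for \<open>v\<close> in \<open>p\<close>.\<close>

definition SubNum :: "tm \<Rightarrow> tm \<Rightarrow> tm \<Rightarrow> tm \<Rightarrow> fm" where
  "SubNum v x p e = inst (\<^bold>\<exists>4. Numeral \<^bold>v1 \<^bold>v4 \<^bold>\<and> Sub \<^bold>v0 \<^bold>v4 \<^bold>v2 \<^bold>v3) [v, x, p, e]"

definition TrEq :: "tm \<Rightarrow> tm \<Rightarrow> fm" where
  "TrEq s t = inst (\<^bold>\<exists>2. CEq \<^bold>v0 \<^bold>v1 \<^bold>v2 \<^bold>\<and> Tr \<^bold>v2) [s, t]"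

definition TrNeg :: "tm \<Rightarrow> fm" where
  "TrNeg p = inst (\<^bold>\<exists>1. CNeg \<^bold>v0 \<^bold>v1 \<^bold>\<and> Tr \<^bold>v1) [p]"

definition TrOr :: "tm \<Rightarrow> tm \<Rightarrow> fm" where
  "TrOr p q = inst (\<^bold>\<exists>2. COr \<^bold>v0 \<^bold>v1 \<^bold>v2 \<^bold>\<and> Tr \<^bold>v2) [p, q]"

definition TrEx :: "tm \<Rightarrow> tm \<Rightarrow> fm" where
  "TrEx v p = inst (\<^bold>\<exists>2. CEx \<^bold>v0 \<^bold>v1 \<^bold>v2 \<^bold>\<and> Tr \<^bold>v2) [v, p]"

definition TrSub :: "tm \<Rightarrow> tm \<Rightarrow> tm \<Rightarrow> fm" where
  "TrSub v r p = inst (\<^bold>\<exists>3. Sub \<^bold>v0 \<^bold>v1 \<^bold>v2 \<^bold>v3 \<^bold>\<and> Tr \<^bold>v3) [v, r, p]"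

definition TrSubNum :: "tm \<Rightarrow> tm \<Rightarrow> tm \<Rightarrow> fm" where
  "TrSubNum v x p = inst (\<^bold>\<exists>3. SubNum \<^bold>v0 \<^bold>v1 \<^bold>v2 \<^bold>v3 \<^bold>\<and> Tr \<^bold>v3) [v, x, p]"

definition TrNegSubNum :: "tm \<Rightarrow> tm \<Rightarrow> tm \<Rightarrow> fm" where
  "TrNegSubNum v x p = inst (\<^bold>\<exists>3. SubNum \<^bold>v0 \<^bold>v1 \<^bold>v2 \<^bold>v3 \<^bold>\<and> TrNeg \<^bold>v3) [v, x, p]"

definition tot :: "tm \<Rightarrow> fm" where
  "tot p = inst
     (\<^bold>\<exists>1. IsFm1 \<^bold>v1 \<^bold>v0 \<^bold>\<and> (\<^bold>\<forall>2. TrSubNum \<^bold>v1 \<^bold>v2 \<^bold>v0 \<^bold>\<or> TrNegSubNum \<^bold>v1 \<^bold>v2 \<^bold>v0)) [p]"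

definition WPT_1a :: fm where
  "WPT_1a = (\<^bold>\<forall>0. \<^bold>\<forall>1. ClosedTerm \<^bold>v0 \<^bold>\<and> ClosedTerm \<^bold>v1 \<^bold>\<longrightarrow>
     (TrEq \<^bold>v0 \<^bold>v1 \<^bold>\<longleftrightarrow> EqVal \<^bold>v0 \<^bold>v1))"

definition WPT_1b :: fm where
  "WPT_1b = (\<^bold>\<forall>0. \<^bold>\<forall>1. ClosedTerm \<^bold>v0 \<^bold>\<and> ClosedTerm \<^bold>v1 \<^bold>\<longrightarrow>
     ((\<^bold>\<exists>2. CEq \<^bold>v0 \<^bold>v1 \<^bold>v2 \<^bold>\<and> TrNeg \<^bold>v2) \<^bold>\<longleftrightarrow> \<^bold>\<not> EqVal \<^bold>v0 \<^bold>v1))"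

definition WPT_2a :: fm where
  "WPT_2a = (\<^bold>\<forall>0. \<^bold>\<forall>1. Sentence \<^bold>v0 \<^bold>\<and> Sentence \<^bold>v1 \<^bold>\<longrightarrow>
     (TrOr \<^bold>v0 \<^bold>v1 \<^bold>\<longleftrightarrow> tot \<^bold>v0 \<^bold>\<and> tot \<^bold>v1 \<^bold>\<and> (Tr \<^bold>v0 \<^bold>\<or> Tr \<^bold>v1)))"

definition WPT_2b :: fm where
  "WPT_2b = (\<^bold>\<forall>0. \<^bold>\<forall>1. Sentence \<^bold>v0 \<^bold>\<and> Sentence \<^bold>v1 \<^bold>\<longrightarrow>
     ((\<^bold>\<exists>2. COr \<^bold>v0 \<^bold>v1 \<^bold>v2 \<^bold>\<and> TrNeg \<^bold>v2) \<^bold>\<longleftrightarrow> TrNeg \<^bold>v0 \<^bold>\<and> TrNeg \<^bold>v1))"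

definition WPT_3a :: fm where
  "WPT_3a = (\<^bold>\<forall>0. \<^bold>\<forall>1. IsFm1 \<^bold>v0 \<^bold>v1 \<^bold>\<longrightarrow>
     (TrEx \<^bold>v0 \<^bold>v1 \<^bold>\<longleftrightarrow> tot \<^bold>v1 \<^bold>\<and> (\<^bold>\<exists>2. TrSubNum \<^bold>v0 \<^bold>v2 \<^bold>v1)))"

definition WPT_3b :: fm where
  "WPT_3b = (\<^bold>\<forall>0. \<^bold>\<forall>1. IsFm1 \<^bold>v0 \<^bold>v1 \<^bold>\<longrightarrow>
     ((\<^bold>\<exists>2. CEx \<^bold>v0 \<^bold>v1 \<^bold>v2 \<^bold>\<and> TrNeg \<^bold>v2) \<^bold>\<longleftrightarrow> (\<^bold>\<forall>2. TrNegSubNum \<^bold>v0 \<^bold>v2 \<^bold>v1)))"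

definition WPT_4 :: fm where
  "WPT_4 = (\<^bold>\<forall>0. Sentence \<^bold>v0 \<^bold>\<longrightarrow> ((\<^bold>\<exists>1. CNeg \<^bold>v0 \<^bold>v1 \<^bold>\<and> TrNeg \<^bold>v1) \<^bold>\<longleftrightarrow> Tr \<^bold>v0))"

definition WPT_5 :: fm where
  "WPT_5 = (\<^bold>\<forall>0. \<^bold>\<forall>1. IsFm1 \<^bold>v0 \<^bold>v1 \<^bold>\<longrightarrow>
     (\<^bold>\<forall>2. \<^bold>\<forall>3. ClosedTerm \<^bold>v2 \<^bold>\<and> ClosedTerm \<^bold>v3 \<^bold>\<longrightarrow> EqVal \<^bold>v2 \<^bold>v3 \<^bold>\<longrightarrow>
       (TrSub \<^bold>v0 \<^bold>v2 \<^bold>v1 \<^bold>\<longleftrightarrow> TrSub \<^bold>v0 \<^bold>v3 \<^bold>v1)))"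

definition WPT :: "fm set" where
  "WPT = PA \<union> {WPT_1a, WPT_1b, WPT_2a, WPT_2b, WPT_3a, WPT_3b, WPT_4, WPT_5}"

definition INT_ax :: fm where
  "INT_ax = (\<^bold>\<forall>0. \<^bold>\<forall>1. IsFm1 \<^bold>v0 \<^bold>v1 \<^bold>\<longrightarrow>
     (\<^bold>\<forall>2. TrSubNum \<^bold>v0 \<^bold>v2 \<^bold>v1 \<^bold>\<longrightarrow> TrSubNum \<^bold>v0 (Succ \<^bold>v2) \<^bold>v1) \<^bold>\<longrightarrow>
     TrSubNum \<^bold>v0 Zero \<^bold>v1 \<^bold>\<longrightarrow> (\<^bold>\<forall>2. TrSubNum \<^bold>v0 \<^bold>v2 \<^bold>v1))"


section \<open>Properties of truth theories\<close>

definition CC :: "tm \<Rightarrow> fm" where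
  "CC x = inst
     ((\<^bold>\<forall>1. \<^bold>\<forall>2. ClosedTerm \<^bold>v1 \<^bold>\<and> ClosedTerm \<^bold>v2 \<^bold>\<longrightarrow> CEq \<^bold>v1 \<^bold>v2 \<^bold>v0 \<^bold>\<longrightarrow>
         (Tr \<^bold>v0 \<^bold>\<longleftrightarrow> EqVal \<^bold>v1 \<^bold>v2)) \<^bold>\<and>
      (\<^bold>\<forall>1. \<^bold>\<forall>2. Sentence \<^bold>v1 \<^bold>\<and> Sentence \<^bold>v2 \<^bold>\<longrightarrow> COr \<^bold>v1 \<^bold>v2 \<^bold>v0 \<^bold>\<longrightarrow>
         (Tr \<^bold>v0 \<^bold>\<longleftrightarrow> Tr \<^bold>v1 \<^bold>\<or> Tr \<^bold>v2)) \<^bold>\<and>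
      (\<^bold>\<forall>1. Sentence \<^bold>v1 \<^bold>\<longrightarrow> CNeg \<^bold>v1 \<^bold>v0 \<^bold>\<longrightarrow> (Tr \<^bold>v0 \<^bold>\<longleftrightarrow> \<^bold>\<not> Tr \<^bold>v1)) \<^bold>\<and>
      (\<^bold>\<forall>1. \<^bold>\<forall>2. IsFm1 \<^bold>v1 \<^bold>v2 \<^bold>\<longrightarrow> CEx \<^bold>v1 \<^bold>v2 \<^bold>v0 \<^bold>\<longrightarrow>
         (Tr \<^bold>v0 \<^bold>\<longleftrightarrow> (\<^bold>\<exists>3. TrSubNum \<^bold>v1 \<^bold>v3 \<^bold>v2))) \<^bold>\<and>
      (\<^bold>\<forall>1. IsFm1 \<^bold>v1 \<^bold>v0 \<^bold>\<longrightarrow>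
         (\<^bold>\<forall>2. \<^bold>\<forall>3. ClosedTerm \<^bold>v2 \<^bold>\<and> ClosedTerm \<^bold>v3 \<^bold>\<longrightarrow> EqVal \<^bold>v2 \<^bold>v3 \<^bold>\<longrightarrow>
           (TrSub \<^bold>v1 \<^bold>v2 \<^bold>v0 \<^bold>\<longleftrightarrow> TrSub \<^bold>v1 \<^bold>v3 \<^bold>v0)))) [x]"

text \<open>A formula \<open>D(y)\<close> is a formula with at most \<open>\<^bold>v0\<close> free, and \<open>D(t)\<close> is \<open>inst D [t]\<close>.\<close>

definition defines_initial_segment :: "fm set \<Rightarrow> fm \<Rightarrow> bool" where
  "defines_initial_segment Th D \<longleftrightarrow> fv D \<subseteq> {0} \<and>
     (Th \<turnstile> \<^bold>\<forall>0. inst D [\<^bold>v0] \<^bold>\<longrightarrow> (\<^bold>\<forall>1. Le \<^bold>v1 \<^bold>v0 \<^bold>\<longrightarrow> inst D [\<^bold>v1])) \<and>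
     (Th \<turnstile> inst D [Zero] \<^bold>\<and> (\<^bold>\<forall>0. inst D [\<^bold>v0] \<^bold>\<longrightarrow> inst D [Succ \<^bold>v0]))"

definition partially_classically_compositional :: "fm set \<Rightarrow> bool" where
  "partially_classically_compositional Th \<longleftrightarrow> (\<exists>D. defines_initial_segment Th D \<and>
     (Th \<turnstile> \<^bold>\<forall>0. inst D [\<^bold>v0] \<^bold>\<longrightarrow> (\<^bold>\<forall>1. IsFm \<^bold>v1 \<^bold>\<longrightarrow> DepthLe \<^bold>v1 \<^bold>v0 \<^bold>\<longrightarrow> CC \<^bold>v1)))"

text \<open>In \<open>\<phi>(v)\<close> the variable \<open>v\<close> is arbitrary if \<open>\<phi>\<close> happens to be a sentence.\<close>

definition proves_truth_of_induction :: "fm set \<Rightarrow> bool" where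
  "proves_truth_of_induction Th \<longleftrightarrow> (\<exists>D. defines_initial_segment Th D \<and>
     (Th \<turnstile> \<^bold>\<forall>0. \<^bold>\<forall>1. IsFm1 \<^bold>v0 \<^bold>v1 \<^bold>\<longrightarrow> inst D [\<^bold>v1] \<^bold>\<longrightarrow>
        (\<^bold>\<exists>2. CInd \<^bold>v0 \<^bold>v1 \<^bold>v2 \<^bold>\<and> Tr \<^bold>v2)))"

end

theory Submission
  imports Defs "HOL-Library.Countable_Set"
begin

text \<open>Working inside the Hilbert calculus is avoided altogether: by the completeness theorem it
  suffices to verify each claim in every model of the theory, standard or not. There the claims are
  ordinary statements about a semiring with a predicate \<open>tr\<close>, and the one thing to be careful about
  is that induction is available for arithmetically definable relations only (\<open>pa_induct\<close>), never
  for those that mention \<open>tr\<close>.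

  The initial segment \<open>D\<close> consists of those \<open>y\<close> such that, of every sentence \<open>\<phi>\<close> of depth at most
  \<open>y\<close>, exactly one of \<open>\<phi>\<close> and \<open>\<not> \<phi>\<close> is true. The typing conditions \<open>tot\<close> in the axioms for \<open>\<or>\<close> and
  \<open>\<exists>\<close> only ask that instances be true or false, so below a depth in \<open>D\<close> they are satisfied and the
  axioms become the classical clauses. In particular \<open>T(\<phi> \<or> \<psi>)\<close> and \<open>T(\<not> (\<phi> \<or> \<psi>))\<close> are then
  complementary if the same holds of \<open>\<phi>\<close> and \<open>\<psi>\<close>, and similarly for \<open>\<exists>\<close> and, by the axiom on double
  negation, for \<open>\<not>\<close>. Therefore \<open>D\<close> is closed under successor (\<open>decided_add_1\<close>), and truth is
  compositional on the formulae whose depth is in \<open>D\<close> (\<open>decided_compositional\<close>); the regularity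
  clause of \<open>CC\<close> is one of the axioms. What remains is arithmetized syntax without \<open>T\<close>, above all
  that \<open>\<phi>(x)\<close> exists, is a sentence, and has the same depth as \<open>\<phi>\<close>.

  The same \<open>D\<close> proves the truth of induction. The depth of a formula does not exceed its code, and
  \<open>ind(\<phi>)\<close> is deeper than \<open>\<phi>\<close> by a fixed standard number only. So if \<open>D\<close> holds of the code of \<open>\<phi>\<close>, it
  holds of the depth of every subformula of \<open>ind(\<phi>)\<close>, and truth distributes over the connectives of
  \<open>ind(\<phi>)\<close>. As substituting first \<open>S v\<close> and then the numeral of \<open>x\<close> for \<open>v\<close> amounts to substituting the
  numeral of \<open>x + 1\<close> (\<open>sub_cSucc_comp\<close>), what results is precisely the instance of \<open>INT\<close> for \<open>\<phi>\<close>
  (\<open>induction_true_if_decided\<close>).\<close>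

section \<open>Structures and satisfaction\<close>

datatype 'a interp =
  Interp (zeroI: 'a) (sucI: "'a \<Rightarrow> 'a") (addI: "'a \<Rightarrow> 'a \<Rightarrow> 'a") (mulI: "'a \<Rightarrow> 'a \<Rightarrow> 'a") (trI: "'a \<Rightarrow> bool")

primrec tval :: "'a interp \<Rightarrow> (nat \<Rightarrow> 'a) \<Rightarrow> tm \<Rightarrow> 'a" where
  "tval I e (Var x) = e x"
| "tval I e Zero = zeroI I"
| "tval I e (Succ t) = sucI I (tval I e t)"
| "tval I e (Add t u) = addI I (tval I e t) (tval I e u)"
| "tval I e (Mul t u) = mulI I (tval I e t) (tval I e u)"

primrec sat :: "'a interp \<Rightarrow> (nat \<Rightarrow> 'a) \<Rightarrow> fm \<Rightarrow> bool" where
  "sat I e (t \<^bold>= u) \<longleftrightarrow> tval I e t = tval I e u"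
| "sat I e (Tr t) \<longleftrightarrow> trI I (tval I e t)"
| "sat I e (\<^bold>\<not> \<phi>) \<longleftrightarrow> \<not> sat I e \<phi>"
| "sat I e (\<phi> \<^bold>\<or> \<psi>) \<longleftrightarrow> sat I e \<phi> \<or> sat I e \<psi>"
| "sat I e (\<^bold>\<exists>x. \<phi>) \<longleftrightarrow> (\<exists>a. sat I (e(x := a)) \<phi>)"

lemma sat_Imp: "sat I e (\<phi> \<^bold>\<longrightarrow> \<psi>) \<longleftrightarrow> (sat I e \<phi> \<longrightarrow> sat I e \<psi>)"
  and sat_Conj: "sat I e (\<phi> \<^bold>\<and> \<psi>) \<longleftrightarrow> sat I e \<phi> \<and> sat I e \<psi>"
  and sat_Iff: "sat I e (\<phi> \<^bold>\<longleftrightarrow> \<psi>) \<longleftrightarrow> (sat I e \<phi> \<longleftrightarrow> sat I e \<psi>)"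
  and sat_Forall: "sat I e (\<^bold>\<forall>x. \<phi>) \<longleftrightarrow> (\<forall>a. sat I (e(x := a)) \<phi>)"
  by auto

lemma finite_tvars [simp]: "finite (tvars t)"
  by (induction t) auto

lemma finite_fv [simp]: "finite (fv \<phi>)"
  by (induction \<phi>) auto

lemma tval_cong: "(\<And>x. x \<in> tvars t \<Longrightarrow> e x = e' x) \<Longrightarrow> tval I e t = tval I e' t"
  by (induction t) auto

lemma sat_cong: "(\<And>x. x \<in> fv \<phi> \<Longrightarrow> e x = e' x) \<Longrightarrow> sat I e \<phi> = sat I e' \<phi>"
proof (induction \<phi> arbitrary: e e')
  case (Eq t u)
  then show ?case using tval_cong[of t e e' I] tval_cong[of u e e' I] by auto
next
  case (Tr t)
  then show ?case using tval_cong[of t e e' I] by auto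
next
  case (Neg \<phi>)
  have "sat I e \<phi> = sat I e' \<phi>"
    by (rule Neg.IH) (use Neg.prems in simp)
  then show ?case by simp
next
  case (Or \<phi> \<psi>)
  then show ?case by (metis UnI1 UnI2 fv.simps(4) sat.simps(4))
next
  case (Exists x \<phi>)
  have "sat I (e(x := a)) \<phi> = sat I (e'(x := a)) \<phi>" for a
    by (rule Exists.IH) (use Exists.prems in auto)
  then show ?case by simp
qed

lemma sat_foldr_Forall:
  "sat I e (foldr Forall xs \<phi>) \<Longrightarrow> (\<And>x. x \<notin> set xs \<Longrightarrow> e' x = e x) \<Longrightarrow> sat I e' \<phi>"
proof (induction xs arbitrary: e)
  case Nil
  then have "e' = e" by auto
  with Nil show ?case by simp
next
  case (Cons x xs)
  have "sat I (e(x := e' x)) (foldr Forall xs \<phi>)" using Cons.prems(1) by simp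
  then show ?case by (rule Cons.IH) (use Cons.prems(2) in auto)
qed

lemma tval_tsubst: "tval I e (tsubst t \<sigma>) = tval I (\<lambda>x. tval I e (\<sigma> x)) t"
  by (induction t) auto

lemma avoid_notin: "finite A \<Longrightarrow> avoid A x \<notin> A"
  unfolding avoid_def using Max_ge Suc_n_not_le_n by metis

lemma sat_subst: "sat I e (subst \<phi> \<sigma>) = sat I (\<lambda>x. tval I e (\<sigma> x)) \<phi>"
proof (induction \<phi> arbitrary: e \<sigma>)
  case (Exists x \<phi>)
  define z where "z = avoid (\<Union>y \<in> fv \<phi> - {x}. tvars (\<sigma> y)) x"
  have z: "z \<notin> (\<Union>y \<in> fv \<phi> - {x}. tvars (\<sigma> y))"
    unfolding z_def by (rule avoid_notin) auto
  have "sat I (\<lambda>y. tval I (e(z := a)) ((\<sigma>(x := Var z)) y)) \<phi>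
      = sat I ((\<lambda>y. tval I e (\<sigma> y))(x := a)) \<phi>" for a
    by (rule sat_cong) (use z in \<open>auto intro!: tval_cong\<close>)
  then show ?case
    by (simp add: Exists.IH z_def[symmetric] Let_def del: fun_upd_apply)
qed (simp_all add: tval_tsubst)

lemma sat_subst1: "sat I e (subst1 \<phi> x t) = sat I (e(x := tval I e t)) \<phi>"
  unfolding subst1_def sat_subst by (rule sat_cong) auto

lemma sat_inst:
  "sat I e (inst \<phi> ts) = sat I (\<lambda>i. if i < length ts then tval I e (ts ! i) else e i) \<phi>"
  unfolding inst_def sat_subst by (rule sat_cong) auto

lemma tvars_tsubst: "tvars (tsubst t \<sigma>) = (\<Union>y \<in> tvars t. tvars (\<sigma> y))"
  by (induction t) auto

lemma fv_subst_subset: "fv (subst \<phi> \<sigma>) \<subseteq> (\<Union>y \<in> fv \<phi>. tvars (\<sigma> y))"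
proof (induction \<phi> arbitrary: \<sigma>)
  case (Exists x \<phi>)
  obtain z where z: "subst (\<^bold>\<exists>x. \<phi>) \<sigma> = (\<^bold>\<exists>z. subst \<phi> (\<sigma>(x := Var z)))"
    by (auto simp: Let_def)
  show ?case
  proof
    fix w assume "w \<in> fv (subst (\<^bold>\<exists>x. \<phi>) \<sigma>)"
    then have "w \<in> fv (subst \<phi> (\<sigma>(x := Var z)))" "w \<noteq> z"
      unfolding z by auto
    then show "w \<in> (\<Union>y \<in> fv (\<^bold>\<exists>x. \<phi>). tvars (\<sigma> y))"
      using subsetD[OF Exists[of "\<sigma>(x := Var z)"]] by (fastforce split: if_splits)
  qed
next
  case (Or \<phi> \<psi>)
  show ?case using Or[of \<sigma>] by simp blast
qed (auto simp: tvars_tsubst)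

section \<open>Completeness\<close>

lemma prop_value_imps:
  "prop_value I (foldr Imp \<Gamma> \<phi>) \<longleftrightarrow> ((\<forall>\<gamma>\<in>set \<Gamma>. prop_value I \<gamma>) \<longrightarrow> prop_value I \<phi>)"
  by (induction \<Gamma>) auto

text \<open>All propositional reasoning goes through this rule. It holds because
  \<open>\<gamma>\<^sub>1 \<longrightarrow> \<dots> \<longrightarrow> \<gamma>\<^sub>n \<longrightarrow> \<phi>\<close> is itself a tautology and hence an axiom.\<close>

lemma proves_taut_consequence:
  assumes "\<forall>\<gamma>\<in>set \<Gamma>. (Th \<turnstile> \<gamma>)" and "\<And>I. (\<forall>\<gamma>\<in>set \<Gamma>. prop_value I \<gamma>) \<Longrightarrow> prop_value I \<phi>"
  shows "Th \<turnstile> \<phi>"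
proof -
  have "Th \<turnstile> foldr Imp \<Gamma> \<phi>"
    using assms(2) by (intro Taut) (auto simp: tautology_def prop_value_imps)
  with assms(1) show ?thesis
    by (induction \<Gamma>) (auto intro: MP)
qed

lemma proves_taut2:
  assumes "Th \<turnstile> \<phi>" "Th \<turnstile> \<psi>" "\<And>I. prop_value I \<phi> \<Longrightarrow> prop_value I \<psi> \<Longrightarrow> prop_value I \<chi>"
  shows "Th \<turnstile> \<chi>"
  by (rule proves_taut_consequence[where \<Gamma> = "[\<phi>, \<psi>]"]) (use assms in auto)

text \<open>A finite set of formulae, given as a list, is inconsistent with \<open>Th\<close>. The absurdity derived
  from it is \<open>\<not> 0 = 0\<close>, since the language has no falsity constant.\<close>

definition refutes :: "fm set \<Rightarrow> fm list \<Rightarrow> bool" where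
  "refutes Th \<Gamma> \<longleftrightarrow> (Th \<turnstile> foldr Imp \<Gamma> (\<^bold>\<not> Zero \<^bold>= Zero))"

text \<open>Case analysis for refutations: whatever makes \<open>\<Gamma>\<close> true, together with the theorems \<open>\<Phi>\<close>, makes
  one of the refuted sets true. With no refuted set at all, \<open>\<Gamma>\<close> contradicts \<open>\<Phi>\<close> outright.\<close>

lemma refutes_taut:
  assumes "\<forall>\<Delta>\<in>set \<Delta>s. refutes Th \<Delta>" "\<forall>\<phi>\<in>set \<Phi>. (Th \<turnstile> \<phi>)"
    and "\<And>I. \<forall>\<gamma>\<in>set \<Gamma>. prop_value I \<gamma> \<Longrightarrow> \<forall>\<phi>\<in>set \<Phi>. prop_value I \<phi> \<Longrightarrow>
           \<exists>\<Delta>\<in>set \<Delta>s. \<forall>\<gamma>\<in>set \<Delta>. prop_value I \<gamma>"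
  shows "refutes Th \<Gamma>"
  unfolding refutes_def
proof (rule proves_taut_consequence)
  show "\<forall>\<gamma>\<in>set (map (\<lambda>\<Delta>. foldr Imp \<Delta> (\<^bold>\<not> Zero \<^bold>= Zero)) \<Delta>s @ \<Phi>). (Th \<turnstile> \<gamma>)"
    using assms(1,2) by (auto simp: refutes_def)
  show "prop_value I (foldr Imp \<Gamma> (\<^bold>\<not> Zero \<^bold>= Zero))"
    if "\<forall>\<gamma>\<in>set (map (\<lambda>\<Delta>. foldr Imp \<Delta> (\<^bold>\<not> Zero \<^bold>= Zero)) \<Delta>s @ \<Phi>). prop_value I \<gamma>" for I
    using that assms(3)[of I] by (simp add: prop_value_imps ball_Un)
qed

primrec allvars :: "fm \<Rightarrow> nat set" where
  "allvars (t \<^bold>= u) = tvars t \<union> tvars u"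
| "allvars (Tr t) = tvars t"
| "allvars (\<^bold>\<not> \<phi>) = allvars \<phi>"
| "allvars (\<phi> \<^bold>\<or> \<psi>) = allvars \<phi> \<union> allvars \<psi>"
| "allvars (\<^bold>\<exists>x. \<phi>) = insert x (allvars \<phi>)"

lemma finite_allvars [simp]: "finite (allvars \<phi>)"
  by (induction \<phi>) auto

lemma fv_subset_allvars: "fv \<phi> \<subseteq> allvars \<phi>"
  by (induction \<phi>) auto

lemma tsubst_Var: "(\<And>x. x \<in> tvars t \<Longrightarrow> \<sigma> x = Var x) \<Longrightarrow> tsubst t \<sigma> = t"
  by (induction t) auto

lemma subst_Var: "(\<And>x. x \<in> fv \<phi> \<Longrightarrow> \<sigma> x = Var x) \<Longrightarrow> subst \<phi> \<sigma> = \<phi>"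
proof (induction \<phi> arbitrary: \<sigma>)
  case (Exists x \<phi>)
  have "x \<notin> (\<Union>y \<in> fv \<phi> - {x}. tvars (\<sigma> y))"
    using Exists.prems by auto
  then have "avoid (\<Union>y \<in> fv \<phi> - {x}. tvars (\<sigma> y)) x = x"
    by (simp add: avoid_def)
  moreover have "subst \<phi> (\<sigma>(x := Var x)) = \<phi>"
    by (rule Exists.IH) (use Exists.prems in auto)
  ultimately show ?case by (simp add: Let_def)
qed (auto simp: tsubst_Var)

lemma tsubst_rename_back:
  "z \<notin> tvars t \<Longrightarrow> tsubst (tsubst t (Var(x := Var z))) (Var(z := Var x)) = t"
  by (induction t) auto

text \<open>If \<open>z\<close> does not occur even bound, capture-avoiding substitution renames nothing on the way to \<open>z\<close>
  and back, so the round trip is the identity syntactically. This is what makes renaming of a bound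
  variable derivable in the Hilbert calculus.\<close>

lemma subst_rename_back:
  "z \<notin> allvars \<phi> \<Longrightarrow> subst (subst \<phi> (Var(x := Var z))) (Var(z := Var x)) = \<phi>"
proof (induction \<phi>)
  case (Exists y \<phi>)
  have z: "z \<notin> allvars \<phi>" "z \<noteq> y" "z \<notin> fv \<phi>"
    using Exists.prems fv_subset_allvars[of \<phi>] by auto
  show ?case
  proof (cases "y = x \<or> x \<notin> fv \<phi>")
    case True
    then have "x \<notin> fv (\<^bold>\<exists>y. \<phi>)" by auto
    then have "subst (\<^bold>\<exists>y. \<phi>) (Var(x := Var z)) = (\<^bold>\<exists>y. \<phi>)"
      by (intro subst_Var) auto
    moreover have "subst (\<^bold>\<exists>y. \<phi>) (Var(z := Var x)) = (\<^bold>\<exists>y. \<phi>)"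
      by (rule subst_Var) (use z in auto)
    ultimately show ?thesis by (simp only:)
  next
    case False
    then have [simp]: "y \<noteq> x" by auto
    have upd: "(Var(x := Var z))(y := Var y) = Var(x := Var z)"
      "(Var(z := Var x))(y := Var y) = Var(z := Var x)"
      using z by auto
    have "y \<notin> (\<Union>y' \<in> fv \<phi> - {y}. tvars ((Var(x := Var z)) y'))"
      using z by auto
    then have 1: "avoid (\<Union>y' \<in> fv \<phi> - {y}. tvars ((Var(x := Var z)) y')) y = y"
      by (simp add: avoid_def del: UN_iff)
    have "y \<notin> (\<Union>y' \<in> fv (subst \<phi> (Var(x := Var z))) - {y}. tvars ((Var(z := Var x)) y'))"
      using \<open>y \<noteq> x\<close> by (auto split: if_splits)
    then have 2: "avoid (\<Union>y' \<in> fv (subst \<phi> (Var(x := Var z))) - {y}. tvars ((Var(z := Var x)) y')) y = y"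
      by (simp add: avoid_def del: UN_iff)
    show ?thesis
      unfolding subst.simps Let_def 1 upd 2 using Exists.IH z by (simp del: fun_upd_apply)
  qed
qed (simp_all add: tsubst_rename_back)

lemma Ex_rename:
  assumes "z \<notin> allvars \<phi>"
  shows "Th \<turnstile> (\<^bold>\<exists>x. \<phi>) \<^bold>\<longrightarrow> (\<^bold>\<exists>z. subst1 \<phi> x (Var z))"
proof (rule Ex_elim)
  have "Th \<turnstile> subst1 (subst1 \<phi> x (Var z)) z (Var x) \<^bold>\<longrightarrow> (\<^bold>\<exists>z. subst1 \<phi> x (Var z))"
    by (rule Ex_intro)
  then show "Th \<turnstile> \<phi> \<^bold>\<longrightarrow> (\<^bold>\<exists>z. subst1 \<phi> x (Var z))"
    using subst_rename_back[OF assms] by (simp add: subst1_def)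
  show "x \<notin> fv (\<^bold>\<exists>z. subst1 \<phi> x (Var z))"
    using fv_subst_subset[of \<phi> "Var(x := Var z)"] by (auto simp: subst1_def split: if_splits)
qed

lemma fv_imps: "fv (foldr Imp \<Gamma> \<phi>) = (\<Union>\<gamma>\<in>set \<Gamma>. fv \<gamma>) \<union> fv \<phi>"
  by (induction \<Gamma>) auto

text \<open>A variable that occurs in none of the finitely many formulae under consideration can serve
  as a Henkin constant; whether it occurs in \<open>Th\<close> does not matter, because theorems can be
  generalized over all variables.\<close>

lemma refutes_witness:
  assumes "refutes Th (subst1 \<phi> x (Var z) # (\<^bold>\<exists>x. \<phi>) # \<Gamma>)"
    and z: "z \<notin> (\<Union>\<gamma>\<in>set ((\<^bold>\<exists>x. \<phi>) # \<Gamma>). allvars \<gamma>)"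
  shows "refutes Th ((\<^bold>\<exists>x. \<phi>) # \<Gamma>)"
proof -
  let ?\<psi> = "foldr Imp ((\<^bold>\<exists>x. \<phi>) # \<Gamma>) (\<^bold>\<not> Zero \<^bold>= Zero)"
  have "Th \<turnstile> (\<^bold>\<exists>z. subst1 \<phi> x (Var z)) \<^bold>\<longrightarrow> ?\<psi>"
  proof (rule Ex_elim)
    show "Th \<turnstile> subst1 \<phi> x (Var z) \<^bold>\<longrightarrow> ?\<psi>"
      using assms(1) by (simp add: refutes_def)
    show "z \<notin> fv ?\<psi>"
      unfolding fv_imps using z fv_subset_allvars by (auto; blast)
  qed
  moreover have "Th \<turnstile> (\<^bold>\<exists>x. \<phi>) \<^bold>\<longrightarrow> (\<^bold>\<exists>z. subst1 \<phi> x (Var z))"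
    using z by (intro Ex_rename) auto
  ultimately have "Th \<turnstile> ?\<psi>"
    by (rule proves_taut2) auto
  then show ?thesis by (simp add: refutes_def)
qed

instance tm :: countable
  by countable_datatype

instance fm :: countable
  by countable_datatype

definition fresh_var :: "fm list \<Rightarrow> nat" where
  "fresh_var \<Gamma> = (SOME z. z \<notin> (\<Union>\<gamma>\<in>set \<Gamma>. allvars \<gamma>))"

lemma fresh_var: "fresh_var \<Gamma> \<notin> (\<Union>\<gamma>\<in>set \<Gamma>. allvars \<gamma>)"
proof -
  have "finite (\<Union>\<gamma>\<in>set \<Gamma>. allvars \<gamma>)" by auto
  then show ?thesis
    unfolding fresh_var_def using ex_new_if_finite[OF infinite_UNIV_nat] by (metis someI_ex)
qed

fun add_witness :: "fm list \<Rightarrow> fm list" where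
  "add_witness ((\<^bold>\<exists>x. \<phi>) # \<Gamma>) = subst1 \<phi> x (Var (fresh_var ((\<^bold>\<exists>x. \<phi>) # \<Gamma>))) # (\<^bold>\<exists>x. \<phi>) # \<Gamma>"
| "add_witness \<Gamma> = \<Gamma>"

lemma add_witness_subset: "set \<Gamma> \<subseteq> set (add_witness \<Gamma>)"
  by (induction \<Gamma> rule: add_witness.induct) auto

lemma refutes_add_witness: "refutes Th (add_witness \<Gamma>) \<Longrightarrow> refutes Th \<Gamma>"
  by (induction \<Gamma> rule: add_witness.induct) (auto intro: refutes_witness[OF _ fresh_var])

text \<open>The \<open>n\<close>-th formula is added unless it is refuted by what has been collected so far; an existential
  formula brings its witness along. All stages are finite, so fresh variables never run out.\<close>

primrec henkin_stage :: "fm set \<Rightarrow> fm list \<Rightarrow> nat \<Rightarrow> fm list" where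
  "henkin_stage Th \<Gamma> 0 = \<Gamma>"
| "henkin_stage Th \<Gamma> (Suc n) =
    (let \<Delta> = henkin_stage Th \<Gamma> n; \<chi> = from_nat n
     in if refutes Th (\<chi> # \<Delta>) then (\<^bold>\<not> \<chi>) # \<Delta> else add_witness (\<chi> # \<Delta>))"

definition henkin :: "fm set \<Rightarrow> fm list \<Rightarrow> fm set" where
  "henkin Th \<Gamma> = (\<Union>n. set (henkin_stage Th \<Gamma> n))"

lemma henkin_stage_mono: "m \<le> n \<Longrightarrow> set (henkin_stage Th \<Gamma> m) \<subseteq> set (henkin_stage Th \<Gamma> n)"
proof (induction n rule: dec_induct)
  case (step n)
  then show ?case
    using add_witness_subset[of "from_nat n # henkin_stage Th \<Gamma> n"] by (auto simp: Let_def)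
qed simp

context
  fixes Th :: "fm set" and \<Gamma> :: "fm list"
  assumes consistent: "\<not> refutes Th \<Gamma>"
begin

lemma henkin_stage_consistent: "\<not> refutes Th (henkin_stage Th \<Gamma> n)"
proof (induction n)
  case 0
  show ?case using consistent by simp
next
  case (Suc n)
  let ?\<Delta> = "henkin_stage Th \<Gamma> n" and ?\<chi> = "from_nat n :: fm"
  show ?case
  proof (cases "refutes Th (?\<chi> # ?\<Delta>)")
    case True
    have "\<not> refutes Th ((\<^bold>\<not> ?\<chi>) # ?\<Delta>)"
    proof
      assume "refutes Th ((\<^bold>\<not> ?\<chi>) # ?\<Delta>)"
      with True have "refutes Th ?\<Delta>"
        by (intro refutes_taut[where \<Delta>s = "[?\<chi> # ?\<Delta>, (\<^bold>\<not> ?\<chi>) # ?\<Delta>]" and \<Phi> = "[]"]) auto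
      with Suc show False ..
    qed
    with True show ?thesis by (simp add: Let_def)
  next
    case False
    then show ?thesis using refutes_add_witness by (auto simp: Let_def)
  qed
qed

text \<open>Consistency of the union reduces to that of the stages, because a refutation uses finitely many
  formulae.\<close>

lemma henkin_finite_subset:
  "set \<Delta> \<subseteq> henkin Th \<Gamma> \<Longrightarrow> \<exists>n. set \<Delta> \<subseteq> set (henkin_stage Th \<Gamma> n)"
proof (induction \<Delta>)
  case (Cons \<delta> \<Delta>)
  then obtain m n where "\<delta> \<in> set (henkin_stage Th \<Gamma> m)" "set \<Delta> \<subseteq> set (henkin_stage Th \<Gamma> n)"
    by (auto simp: henkin_def)
  then have "set (\<delta> # \<Delta>) \<subseteq> set (henkin_stage Th \<Gamma> (max m n))"
    using henkin_stage_mono[of m "max m n" Th \<Gamma>] henkin_stage_mono[of n "max m n" Th \<Gamma>] by auto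
  then show ?case ..
qed simp

lemma henkin_consistent: "set \<Delta> \<subseteq> henkin Th \<Gamma> \<Longrightarrow> \<not> refutes Th \<Delta>"
proof
  assume "set \<Delta> \<subseteq> henkin Th \<Gamma>" and r: "refutes Th \<Delta>"
  then obtain n where "set \<Delta> \<subseteq> set (henkin_stage Th \<Gamma> n)"
    using henkin_finite_subset by blast
  with r have "refutes Th (henkin_stage Th \<Gamma> n)"
    by (intro refutes_taut[where \<Delta>s = "[\<Delta>]" and \<Phi> = "[]"]) auto
  then show False using henkin_stage_consistent by simp
qed

lemma henkin_complete: "\<phi> \<in> henkin Th \<Gamma> \<or> (\<^bold>\<not> \<phi>) \<in> henkin Th \<Gamma>"
proof -
  have "\<phi> \<in> set (henkin_stage Th \<Gamma> (Suc (to_nat \<phi>))) \<or> (\<^bold>\<not> \<phi>) \<in> set (henkin_stage Th \<Gamma> (Suc (to_nat \<phi>)))"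
    using add_witness_subset[of "\<phi> # henkin_stage Th \<Gamma> (to_nat \<phi>)"] by (auto simp: Let_def)
  then show ?thesis unfolding henkin_def by blast
qed

lemma henkin_closed:
  assumes "set \<Delta> \<subseteq> henkin Th \<Gamma>" "\<forall>\<phi>\<in>set \<Phi>. (Th \<turnstile> \<phi>)"
    and "\<And>I. \<forall>\<phi>\<in>set \<Delta>. prop_value I \<phi> \<Longrightarrow> \<forall>\<phi>\<in>set \<Phi>. prop_value I \<phi> \<Longrightarrow> prop_value I \<psi>"
  shows "\<psi> \<in> henkin Th \<Gamma>"
proof (rule ccontr)
  assume "\<psi> \<notin> henkin Th \<Gamma>"
  then have "set ((\<^bold>\<not> \<psi>) # \<Delta>) \<subseteq> henkin Th \<Gamma>"
    using henkin_complete assms(1) by auto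
  moreover have "refutes Th ((\<^bold>\<not> \<psi>) # \<Delta>)"
    by (rule refutes_taut[where \<Delta>s = "[]" and \<Phi> = \<Phi>]) (use assms(2,3) in auto)
  ultimately show False using henkin_consistent by blast
qed

lemma henkin_theorem: "Th \<turnstile> \<phi> \<Longrightarrow> \<phi> \<in> henkin Th \<Gamma>"
  by (rule henkin_closed[where \<Delta> = "[]" and \<Phi> = "[\<phi>]"]) auto

lemma henkin_MP: "\<phi> \<in> henkin Th \<Gamma> \<Longrightarrow> Th \<turnstile> \<phi> \<^bold>\<longrightarrow> \<psi> \<Longrightarrow> \<psi> \<in> henkin Th \<Gamma>"
  by (rule henkin_closed[where \<Delta> = "[\<phi>]" and \<Phi> = "[\<phi> \<^bold>\<longrightarrow> \<psi>]"]) auto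

lemma henkin_Neg: "(\<^bold>\<not> \<phi>) \<in> henkin Th \<Gamma> \<longleftrightarrow> \<phi> \<notin> henkin Th \<Gamma>"
proof
  show "\<phi> \<notin> henkin Th \<Gamma> \<Longrightarrow> (\<^bold>\<not> \<phi>) \<in> henkin Th \<Gamma>"
    using henkin_complete by blast
  assume "(\<^bold>\<not> \<phi>) \<in> henkin Th \<Gamma>"
  moreover have "refutes Th [\<phi>, \<^bold>\<not> \<phi>]"
    by (rule refutes_taut[where \<Delta>s = "[]" and \<Phi> = "[]"]) auto
  ultimately show "\<phi> \<notin> henkin Th \<Gamma>"
    using henkin_consistent[of "[\<phi>, \<^bold>\<not> \<phi>]"] by auto
qed

lemma henkin_Or: "(\<phi> \<^bold>\<or> \<psi>) \<in> henkin Th \<Gamma> \<longleftrightarrow> \<phi> \<in> henkin Th \<Gamma> \<or> \<psi> \<in> henkin Th \<Gamma>"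
proof
  assume *: "(\<phi> \<^bold>\<or> \<psi>) \<in> henkin Th \<Gamma>"
  show "\<phi> \<in> henkin Th \<Gamma> \<or> \<psi> \<in> henkin Th \<Gamma>"
  proof (rule disjCI)
    assume "\<psi> \<notin> henkin Th \<Gamma>"
    then show "\<phi> \<in> henkin Th \<Gamma>"
      by (intro henkin_closed[where \<Delta> = "[\<phi> \<^bold>\<or> \<psi>, \<^bold>\<not> \<psi>]" and \<Phi> = "[]"]) (auto simp: * henkin_Neg)
  qed
next
  assume "\<phi> \<in> henkin Th \<Gamma> \<or> \<psi> \<in> henkin Th \<Gamma>"
  then show "(\<phi> \<^bold>\<or> \<psi>) \<in> henkin Th \<Gamma>"
    using henkin_closed[where \<Delta> = "[\<phi>]" and \<Phi> = "[]" and \<psi> = "\<phi> \<^bold>\<or> \<psi>"]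
      henkin_closed[where \<Delta> = "[\<psi>]" and \<Phi> = "[]" and \<psi> = "\<phi> \<^bold>\<or> \<psi>"] by auto
qed

text \<open>Left to right, the witness was added at the stage at which the formula itself was considered: it
  was not refuted then, because it belongs to a consistent set.\<close>

lemma henkin_Exists: "(\<^bold>\<exists>x. \<phi>) \<in> henkin Th \<Gamma> \<longleftrightarrow> (\<exists>t. subst1 \<phi> x t \<in> henkin Th \<Gamma>)"
proof
  assume *: "(\<^bold>\<exists>x. \<phi>) \<in> henkin Th \<Gamma>"
  let ?\<chi> = "\<^bold>\<exists>x. \<phi>"
  let ?\<Delta> = "henkin_stage Th \<Gamma> (to_nat ?\<chi>)"
  have "\<not> refutes Th (?\<chi> # ?\<Delta>)"
    using * by (intro henkin_consistent) (auto simp: henkin_def)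
  then have "subst1 \<phi> x (Var (fresh_var (?\<chi> # ?\<Delta>))) \<in> set (henkin_stage Th \<Gamma> (Suc (to_nat ?\<chi>)))"
    by (simp add: Let_def)
  then show "\<exists>t. subst1 \<phi> x t \<in> henkin Th \<Gamma>"
    unfolding henkin_def by blast
next
  assume "\<exists>t. subst1 \<phi> x t \<in> henkin Th \<Gamma>"
  then show "(\<^bold>\<exists>x. \<phi>) \<in> henkin Th \<Gamma>"
    using henkin_MP Ex_intro by blast
qed

lemma henkin_MP2:
  "\<phi> \<in> henkin Th \<Gamma> \<Longrightarrow> \<psi> \<in> henkin Th \<Gamma> \<Longrightarrow> Th \<turnstile> \<phi> \<^bold>\<longrightarrow> \<psi> \<^bold>\<longrightarrow> \<chi> \<Longrightarrow> \<chi> \<in> henkin Th \<Gamma>"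
  by (rule henkin_closed[where \<Delta> = "[\<phi>, \<psi>]" and \<Phi> = "[\<phi> \<^bold>\<longrightarrow> \<psi> \<^bold>\<longrightarrow> \<chi>]"]) auto

definition term_class :: "tm \<Rightarrow> tm set" where
  "term_class t = {u. (t \<^bold>= u) \<in> henkin Th \<Gamma>}"

lemma henkin_refl: "(t \<^bold>= t) \<in> henkin Th \<Gamma>"
  by (rule henkin_theorem) (rule Eq_refl)

lemma henkin_sym: "(t \<^bold>= u) \<in> henkin Th \<Gamma> \<Longrightarrow> (u \<^bold>= t) \<in> henkin Th \<Gamma>"
  by (rule henkin_closed[where \<Delta> = "[t \<^bold>= u, t \<^bold>= t]" and
        \<Phi> = "[t \<^bold>= u \<^bold>\<longrightarrow> t \<^bold>= t \<^bold>\<longrightarrow> t \<^bold>= t \<^bold>\<longrightarrow> u \<^bold>= t]"]) (auto simp: henkin_refl intro: Eq_Eq)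

lemma henkin_trans:
  "(t \<^bold>= u) \<in> henkin Th \<Gamma> \<Longrightarrow> (u \<^bold>= w) \<in> henkin Th \<Gamma> \<Longrightarrow> (t \<^bold>= w) \<in> henkin Th \<Gamma>"
  by (rule henkin_closed[where \<Delta> = "[u \<^bold>= t, u \<^bold>= w, w \<^bold>= w]" and
        \<Phi> = "[u \<^bold>= t \<^bold>\<longrightarrow> w \<^bold>= w \<^bold>\<longrightarrow> u \<^bold>= w \<^bold>\<longrightarrow> t \<^bold>= w]"]) (auto simp: henkin_refl henkin_sym intro: Eq_Eq)

lemma term_class_eq_iff: "term_class t = term_class u \<longleftrightarrow> (t \<^bold>= u) \<in> henkin Th \<Gamma>"
  unfolding term_class_def using henkin_refl henkin_sym henkin_trans by blast

text \<open>The elements are the classes of terms that the Henkin set declares equal, transported to the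
  natural numbers along an enumeration, where equality can be interpreted by equality. Every variable denotes its own
  class, so that satisfaction of \<open>\<phi>\<close> is membership in the Henkin set, by induction on the size
  of \<open>\<phi>\<close>.\<close>

lemma henkin_model:
  assumes inf: "infinite (range term_class)"
  shows "\<exists>(I :: nat interp) e. \<forall>\<phi>. sat I e \<phi> \<longleftrightarrow> \<phi> \<in> henkin Th \<Gamma>"
proof -
  define f where "f t = to_nat_on (range term_class) (term_class t)" for t
  have bij: "bij_betw (to_nat_on (range term_class)) (range term_class) UNIV"
    by (rule to_nat_on_infinite[OF countable_image[OF countableI_type] inf])
  have f_eq: "f t = f u \<longleftrightarrow> (t \<^bold>= u) \<in> henkin Th \<Gamma>" for t u
    using bij term_class_eq_iff unfolding f_def bij_betw_def inj_on_def by (metis rangeI)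
  have f_surj: "surj f"
    using bij unfolding f_def bij_betw_def by (auto simp: image_image)
  \<comment> \<open>A representative of each class; the operations are well defined on classes by the equality
    axioms.\<close>
  define g where "g = inv f"
  have fg [simp]: "f (g n) = n" for n
    unfolding g_def by (rule surj_f_inv_f[OF f_surj])
  have gf: "(g (f t) \<^bold>= t) \<in> henkin Th \<Gamma>" for t
    unfolding f_eq[symmetric] by simp
  define I where "I = Interp (f Zero) (\<lambda>a. f (Succ (g a))) (\<lambda>a b. f (Add (g a) (g b)))
    (\<lambda>a b. f (Mul (g a) (g b))) (\<lambda>a. Tr (g a) \<in> henkin Th \<Gamma>)"
  have suc: "f (Succ (g (f t))) = f (Succ t)" for t
    unfolding f_eq by (rule henkin_MP[OF gf Eq_Succ])
  have add: "f (Add (g (f t)) (g (f u))) = f (Add t u)" for t u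
    unfolding f_eq by (rule henkin_MP2[OF gf gf Eq_Add])
  have mul: "f (Mul (g (f t)) (g (f u))) = f (Mul t u)" for t u
    unfolding f_eq by (rule henkin_MP2[OF gf gf Eq_Mul])
  have tr: "Tr (g (f t)) \<in> henkin Th \<Gamma> \<longleftrightarrow> Tr t \<in> henkin Th \<Gamma>" for t
    using henkin_MP2[OF gf _ Eq_Tr] henkin_MP2[OF henkin_sym[OF gf] _ Eq_Tr] by blast
  let ?e = "\<lambda>x. f (Var x)"
  have tval: "tval I ?e t = f t" for t
    by (induction t) (simp_all add: I_def suc add mul)
  have size: "size (subst \<phi> \<sigma>) = size \<phi>" for \<phi> \<sigma>
    by (induction \<phi> arbitrary: \<sigma>) (simp_all add: Let_def)
  have "sat I ?e \<phi> \<longleftrightarrow> \<phi> \<in> henkin Th \<Gamma>" for \<phi>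
  proof (induction "size \<phi>" arbitrary: \<phi> rule: less_induct)
    case less
    show ?case
    proof (cases \<phi>)
      case (Eq t u)
      then show ?thesis by (simp add: tval f_eq)
    next
      case (Tr t)
      then show ?thesis by (simp add: tval) (simp add: I_def tr)
    next
      case (Neg \<psi>)
      then show ?thesis using less[of \<psi>] by (simp add: henkin_Neg)
    next
      case (Or \<psi> \<chi>)
      then show ?thesis using less[of \<psi>] less[of \<chi>] by (simp add: henkin_Or)
    next
      case (Exists x \<psi>)
      have "sat I ?e \<phi> \<longleftrightarrow> (\<exists>t. sat I (?e(x := f t)) \<psi>)"
        unfolding Exists by (simp, metis fg)
      also have "\<dots> \<longleftrightarrow> (\<exists>t. sat I ?e (subst1 \<psi> x t))"
        by (simp add: sat_subst1 tval)
      also have "\<dots> \<longleftrightarrow> (\<exists>t. subst1 \<psi> x t \<in> henkin Th \<Gamma>)"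
        using less Exists by (simp add: subst1_def size)
      finally show ?thesis by (simp add: Exists henkin_Exists)
    qed
  qed
  then show ?thesis by blast
qed

end

lemma proves_Forall_inst: "Th \<turnstile> (\<^bold>\<forall>x. \<phi>) \<Longrightarrow> Th \<turnstile> subst1 \<phi> x t"
  by (rule proves_taut_consequence[where \<Gamma> =
       "[\<^bold>\<forall>x. \<phi>, subst1 (\<^bold>\<not> \<phi>) x t \<^bold>\<longrightarrow> (\<^bold>\<exists>x. \<^bold>\<not> \<phi>)]"]) (auto intro: Ex_intro[of _ "\<^bold>\<not> \<phi>", unfolded subst1_def subst.simps] simp: subst1_def)

lemma proves_generalize: "Th \<turnstile> \<phi> \<Longrightarrow> Th \<turnstile> (\<^bold>\<forall>x. \<phi>)"
proof -
  assume *: "Th \<turnstile> \<phi>"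
  have "Th \<turnstile> (\<^bold>\<not> \<phi>) \<^bold>\<longrightarrow> (\<^bold>\<not> Zero \<^bold>= Zero)"
    by (rule proves_taut_consequence[where \<Gamma> = "[\<phi>]"]) (use * in auto)
  then have "Th \<turnstile> (\<^bold>\<exists>x. \<^bold>\<not> \<phi>) \<^bold>\<longrightarrow> (\<^bold>\<not> Zero \<^bold>= Zero)"
    by (rule Ex_elim) simp
  then show ?thesis
    by (intro proves_taut_consequence[where \<Gamma> = "[_ \<^bold>\<longrightarrow> _, Zero \<^bold>= Zero]"]) (auto intro: Eq_refl)
qed

lemma tvars_num [simp]: "tvars (num n) = {}"
  by (induction n) (auto simp: num_def)

lemma num_Suc: "num (Suc n) = Succ (num n)"
  by (simp add: num_def)

lemma tsubst_num [simp]: "tsubst (num n) \<sigma> = num n"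
  by (rule tsubst_Var) simp

text \<open>The term model of a theory that contains \<open>PA\<close> is infinite because of this, and can therefore
  be realized on the type of natural numbers.\<close>

lemma PA_num_distinct:
  assumes "PA \<subseteq> Th" "n < m"
  shows "Th \<turnstile> \<^bold>\<not> num m \<^bold>= num n"
  using assms(2)
proof (induction n arbitrary: m)
  case 0
  then obtain k where m: "m = Suc k" by (cases m) auto
  have "Th \<turnstile> \<^bold>\<forall>0. \<^bold>\<not> Succ \<^bold>v0 \<^bold>= Zero"
    using assms(1) by (intro Axiom) (auto simp: PA_def)
  from proves_Forall_inst[OF this, of "num k"] show ?case
    by (simp add: m num_Suc subst1_def) (simp add: num_def)
next
  case (Suc n)
  then obtain k where m: "m = Suc k" "n < k" by (cases m) auto
  have "Th \<turnstile> \<^bold>\<forall>0. \<^bold>\<forall>1. Succ \<^bold>v0 \<^bold>= Succ \<^bold>v1 \<^bold>\<longrightarrow> \<^bold>v0 \<^bold>= \<^bold>v1"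
    using assms(1) by (intro Axiom) (auto simp: PA_def)
  from proves_Forall_inst[OF this, of "num k"]
  have "Th \<turnstile> \<^bold>\<forall>1. Succ (num k) \<^bold>= Succ \<^bold>v1 \<^bold>\<longrightarrow> num k \<^bold>= \<^bold>v1"
    by (simp add: subst1_def Let_def avoid_def)
  from proves_Forall_inst[OF this, of "num n"]
  have "Th \<turnstile> Succ (num k) \<^bold>= Succ (num n) \<^bold>\<longrightarrow> num k \<^bold>= num n"
    by (simp add: subst1_def)
  moreover have "Th \<turnstile> \<^bold>\<not> num k \<^bold>= num n"
    by (rule Suc.IH[OF m(2)])
  ultimately show ?case
    unfolding m num_Suc by (rule proves_taut2) auto
qed

definition models :: "'a interp \<Rightarrow> fm set \<Rightarrow> bool" (infix \<open>\<Turnstile>\<close> 50) where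
  "I \<Turnstile> Th \<longleftrightarrow> (\<forall>\<phi>\<in>Th. \<forall>e. sat I e \<phi>)"

text \<open>If \<open>\<phi>\<close> is not provable, \<open>\<not> \<phi>\<close> is consistent with \<open>Th\<close> and extends to a Henkin set, whose term
  model satisfies \<open>\<not> \<phi>\<close> under the canonical assignment. The axioms hold there under all
  assignments, as their universal closures are provable and belong to the Henkin set.\<close>

theorem completeness:
  assumes PA: "PA \<subseteq> Th" and valid: "\<And>I :: nat interp. I \<Turnstile> Th \<Longrightarrow> I \<Turnstile> {\<phi>}"
  shows "Th \<turnstile> \<phi>"
proof (rule ccontr)
  assume "\<not> (Th \<turnstile> \<phi>)"
  have c: "\<not> refutes Th [\<^bold>\<not> \<phi>]"
  proof
    assume "refutes Th [\<^bold>\<not> \<phi>]"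
    then have "Th \<turnstile> \<phi>"
      unfolding refutes_def
      by (intro proves_taut_consequence[where \<Gamma> = "[_ \<^bold>\<longrightarrow> _, Zero \<^bold>= Zero]"]) (auto intro: Eq_refl)
    then show False using \<open>\<not> (Th \<turnstile> \<phi>)\<close> by simp
  qed
  have "term_class Th [\<^bold>\<not> \<phi>] (num m) \<noteq> term_class Th [\<^bold>\<not> \<phi>] (num n)" if "n < m" for m n
    using henkin_theorem[OF c PA_num_distinct[OF PA that]] henkin_Neg[OF c]
    by (simp add: term_class_eq_iff[OF c])
  then have "inj (\<lambda>n. term_class Th [\<^bold>\<not> \<phi>] (num n))"
    by (intro injI) (metis linorder_neqE_nat)
  then have "infinite (range (\<lambda>n. term_class Th [\<^bold>\<not> \<phi>] (num n)))"
    using finite_imageD infinite_UNIV_nat by blast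
  then have "infinite (range (term_class Th [\<^bold>\<not> \<phi>]))"
    by (rule contrapos_nn) (auto elim!: finite_subset[rotated])
  from henkin_model[OF c this] obtain I :: "nat interp" and e
    where I: "\<And>\<psi>. sat I e \<psi> \<longleftrightarrow> \<psi> \<in> henkin Th [\<^bold>\<not> \<phi>]" by blast
  have "I \<Turnstile> Th"
    unfolding models_def
  proof (intro ballI allI)
    fix \<psi> e' assume \<psi>: "\<psi> \<in> Th"
    have gen: "Th \<turnstile> foldr Forall xs \<psi>" for xs
      by (induction xs) (use \<psi> in \<open>auto intro: Axiom proves_generalize\<close>)
    obtain xs where xs: "set xs = fv \<psi>" using finite_list[OF finite_fv] by blast
    have "sat I (\<lambda>x. if x \<in> fv \<psi> then e' x else e x) \<psi>"
      by (rule sat_foldr_Forall[of I e xs]) (use gen henkin_theorem[OF c] I xs in auto)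
    then show "sat I e' \<psi>" by (rule sat_cong[THEN iffD1, rotated]) simp
  qed
  with valid have "sat I e \<phi>" by (auto simp: models_def)
  moreover have "(\<^bold>\<not> \<phi>) \<in> henkin Th [\<^bold>\<not> \<phi>]"
    unfolding henkin_def by (rule UN_I[of 0]) auto
  ultimately show False using I henkin_Neg[OF c] by blast
qed

section \<open>Models of Peano Arithmetic with a truth predicate\<close>

text \<open>Each model is regarded as a type of its own, so that arithmetic in it has the usual notation and,
  once the type class is known to be a subclass of \<open>linordered_semidom\<close>, the algebraic library
  applies. Order and truncated subtraction are the ones definable from addition.\<close>

class pa_model = zero + one + plus + times + minus + ord +
  fixes tr :: "'a \<Rightarrow> bool"
  assumes models_PA: "Interp 0 (\<lambda>x. x + 1) (+) (*) tr \<Turnstile> PA"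
    and pa_le_def: "x \<le> y \<longleftrightarrow> (\<exists>z. y = x + z)"
    and pa_less_def: "x < y \<longleftrightarrow> x \<le> y \<and> x \<noteq> y"
    and pa_minus_def: "x - y = (if y \<le> x then THE z. x = y + z else 0)"

abbreviation self_interp :: "'a::pa_model interp" where
  "self_interp \<equiv> Interp 0 (\<lambda>x. x + 1) (+) (*) tr"

abbreviation holds :: "(nat \<Rightarrow> 'a::pa_model) \<Rightarrow> fm \<Rightarrow> bool" where
  "holds \<equiv> sat self_interp"

abbreviation val :: "(nat \<Rightarrow> 'a::pa_model) \<Rightarrow> tm \<Rightarrow> 'a" where
  "val \<equiv> tval self_interp"

lemma holds_PA: "\<phi> \<in> PA \<Longrightarrow> holds (e :: nat \<Rightarrow> 'a::pa_model) \<phi>"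
  using models_PA unfolding models_def by blast

subsection \<open>Definable relations\<close>

definition interleave :: "(nat \<Rightarrow> 'a) \<Rightarrow> (nat \<Rightarrow> 'a) \<Rightarrow> nat \<Rightarrow> 'a" where
  "interleave e c i = (if even i then e (i div 2) else c (i div 2))"

text \<open>The even variables are the arguments of the relation. The odd ones carry parameters \<open>c\<close> from
  the model, so arbitrary elements may occur in definable relations; and there is always room for
  the parameters of a second formula.\<close>

definition definable :: "((nat \<Rightarrow> 'a::pa_model) \<Rightarrow> bool) \<Rightarrow> bool" where
  "definable P \<longleftrightarrow> (\<exists>\<phi> c. arithmetical \<phi> \<and> (\<forall>e. P e \<longleftrightarrow> holds (interleave e c) \<phi>))"

lemma definableI:
  "arithmetical \<phi> \<Longrightarrow> (\<And>e. P e \<longleftrightarrow> holds (interleave e c) \<phi>) \<Longrightarrow> definable P"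
  unfolding definable_def by blast

lemma definableE:
  assumes "definable P"
  obtains \<phi> c where "arithmetical \<phi>" "\<And>e. P e \<longleftrightarrow> holds (interleave e c) \<phi>"
  using assms unfolding definable_def by blast

lemma arithmetical_subst [simp]: "arithmetical (subst \<phi> \<sigma>) = arithmetical \<phi>"
  by (induction \<phi> arbitrary: \<sigma>) (simp_all add: Let_def)

lemma definable_Not: "definable P \<Longrightarrow> definable (\<lambda>e. \<not> P e)"
  by (elim definableE) (auto intro!: definableI[of "\<^bold>\<not> _"])

lemma definable_disj:
  assumes "definable P" "definable Q"
  shows "definable (\<lambda>e. P e \<or> Q e)"
proof -
  from assms obtain \<phi> c \<psi> d where \<phi>: "arithmetical \<phi>" "\<And>e. P e \<longleftrightarrow> holds (interleave e c) \<phi>"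
    and \<psi>: "arithmetical \<psi>" "\<And>e. Q e \<longleftrightarrow> holds (interleave e d) \<psi>"
    by (elim definableE) blast
  \<comment> \<open>The parameters of \<open>\<phi>\<close> and \<open>\<psi>\<close> are interleaved: the \<open>k\<close>-th parameter, stored in variable
    \<open>2 k + 1\<close>, moves to \<open>2 (2 k) + 1\<close> for \<open>\<phi>\<close> and to \<open>2 (2 k + 1) + 1\<close> for \<open>\<psi>\<close>.\<close>
  define \<rho>1 where "\<rho>1 i = Var (if even i then i else 4 * (i div 2) + 1)" for i
  define \<rho>2 where "\<rho>2 i = Var (if even i then i else 4 * (i div 2) + 3)" for i
  have 1: "(\<lambda>i. val (interleave e (interleave c d)) (\<rho>1 i)) = interleave e c" for e
    by (rule ext) (auto simp: \<rho>1_def interleave_def elim!: oddE)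
  have "(4 * k + 3) div 2 = Suc (2 * k)" for k :: nat by presburger
  then have 2: "(\<lambda>i. val (interleave e (interleave c d)) (\<rho>2 i)) = interleave e d" for e
    by (intro ext) (auto simp: \<rho>2_def interleave_def)
  show ?thesis
    by (rule definableI[of "subst \<phi> \<rho>1 \<^bold>\<or> subst \<psi> \<rho>2" _ "interleave c d"])
      (simp_all add: \<phi> \<psi> sat_subst 1 2)
qed

lemma definable_conj: "definable P \<Longrightarrow> definable Q \<Longrightarrow> definable (\<lambda>e. P e \<and> Q e)"
  using definable_Not[OF definable_disj[OF definable_Not definable_Not], of P Q] by simp

lemma definable_imp: "definable P \<Longrightarrow> definable Q \<Longrightarrow> definable (\<lambda>e. P e \<longrightarrow> Q e)"
  unfolding imp_conv_disj by (rule definable_disj[OF definable_Not])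

lemma definable_iff: "definable P \<Longrightarrow> definable Q \<Longrightarrow> definable (\<lambda>e. P e \<longleftrightarrow> Q e)"
  unfolding iff_conv_conj_imp by (intro definable_conj definable_imp)

text \<open>The bound variable becomes argument \<open>0\<close>, and the others are shifted. In this form the rule can be
  applied backwards by higher-order pattern unification: if \<open>e\<close> occurs only in the shape \<open>e i\<close>, the
  premise reduces to a statement of the same kind, and \<open>definable_intros\<close> settles definability of
  concrete relations.\<close>

lemma definable_Ex:
  assumes "definable (\<lambda>e. Q (e 0) (\<lambda>i. e (Suc i)))"
  shows "definable (\<lambda>e. \<exists>x. Q x e)"
proof -
  from assms obtain \<phi> c
    where \<phi>: "arithmetical \<phi>" "\<And>e. Q (e 0) (\<lambda>i. e (Suc i)) \<longleftrightarrow> holds (interleave e c) \<phi>"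
    by (elim definableE) blast
  \<comment> \<open>Argument \<open>0\<close> is quantified as the fresh variable \<open>n\<close>; argument \<open>k + 1\<close>, stored in variable
    \<open>2 (k + 1)\<close>, moves down by two.\<close>
  define n where "n = Suc (Max (insert 0 (fv \<phi>)))"
  have n: "i < n" if "i \<in> fv \<phi>" for i
    using that by (simp add: n_def less_Suc_eq_le)
  define \<rho> where "\<rho> i = Var (if i = 0 then n else if even i then i - 2 else i)" for i
  have "Q x e \<longleftrightarrow> holds ((interleave e c)(n := x)) (subst \<phi> \<rho>)" for x e
  proof -
    have "Q x e \<longleftrightarrow> holds (interleave (case_nat x e) c) \<phi>"
      using \<phi>(2)[of "case_nat x e"] by simp
    also have "\<dots> \<longleftrightarrow> holds (\<lambda>i. val ((interleave e c)(n := x)) (\<rho> i)) \<phi>"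
    proof (rule sat_cong)
      fix i assume "i \<in> fv \<phi>"
      with n have "i < n" by simp
      then show "interleave (case_nat x e) c i = val ((interleave e c)(n := x)) (\<rho> i)"
        by (auto simp: interleave_def \<rho>_def elim!: evenE split: nat.split)
    qed
    finally show ?thesis by (simp only: sat_subst)
  qed
  then show ?thesis
    by (intro definableI[of "Exists n (subst \<phi> \<rho>)" _ c]) (simp_all add: \<phi>(1))
qed

lemma definable_All:
  "definable (\<lambda>e. Q (e 0) (\<lambda>i. e (Suc i))) \<Longrightarrow> definable (\<lambda>e. \<forall>x. Q x e)"
  using definable_Not[OF definable_Ex[OF definable_Not], of Q] by simp

lemma definable_rename: "definable P \<Longrightarrow> definable (\<lambda>e. P (\<lambda>i. e (\<rho> i)))"
proof -
  assume "definable P"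
  then obtain \<phi> c where \<phi>: "arithmetical \<phi>" "\<And>e. P e \<longleftrightarrow> holds (interleave e c) \<phi>"
    by (elim definableE) blast
  define \<sigma> where "\<sigma> i = Var (if even i then 2 * \<rho> (i div 2) else i)" for i
  have "(\<lambda>i. val (interleave e c) (\<sigma> i)) = interleave (\<lambda>i. e (\<rho> i)) c" for e
    by (rule ext) (auto simp: \<sigma>_def interleave_def)
  then show ?thesis
    by (intro definableI[of "subst \<phi> \<sigma>" _ c]) (simp_all add: \<phi> sat_subst)
qed

text \<open>Definability of the graph rather than by a term, so that the pairing function is included.\<close>

definition definable_fun :: "((nat \<Rightarrow> 'a::pa_model) \<Rightarrow> 'a) \<Rightarrow> bool" where
  "definable_fun f \<longleftrightarrow> definable (\<lambda>e. e 0 = f (\<lambda>i. e (Suc i)))"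

lemma definable_eq_vars: "definable (\<lambda>e. e i = e j)"
  by (rule definableI[of "Var (2 * i) \<^bold>= Var (2 * j)" _ undefined]) (simp_all add: interleave_def)

lemma definable_fun_var: "definable_fun (\<lambda>e. e i)"
  unfolding definable_fun_def by (rule definable_eq_vars)

lemma definable_fun_const: "definable_fun (\<lambda>e. a)"
  unfolding definable_fun_def
  by (rule definableI[of "Var 0 \<^bold>= Var 1" _ "\<lambda>_. a"]) (simp_all add: interleave_def)

lemma definable_comp:
  assumes "definable (\<lambda>e. Q (e 0) (\<lambda>i. e (Suc i)))" "definable_fun f"
  shows "definable (\<lambda>e. Q (f e) e)"
proof -
  have "definable (\<lambda>e. \<exists>x. x = f e \<and> Q x e)"
    using assms unfolding definable_fun_def by (intro definable_Ex definable_conj)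
  then show ?thesis by simp
qed

lemma definable_eq: "definable_fun f \<Longrightarrow> definable_fun g \<Longrightarrow> definable (\<lambda>e. f e = g e)"
  by (rule definable_comp[where Q = "\<lambda>x e. x = g e"]) (simp_all add: definable_fun_def)

lemma definable_fun_shift: "definable_fun f \<Longrightarrow> definable_fun (\<lambda>e. f (\<lambda>i. e (Suc i)))"
  unfolding definable_fun_def
  using definable_rename[of "\<lambda>e. e 0 = f (\<lambda>i. e (Suc i))" "case_nat 0 (\<lambda>i. Suc (Suc i))"] by simp

lemma definable_fun_shift2: "definable_fun f \<Longrightarrow> definable_fun (\<lambda>e. f (\<lambda>i. e (Suc (Suc i))))"
  using definable_fun_shift[OF definable_fun_shift] .

lemma definable_fun_binop:
  assumes R: "definable (\<lambda>e. R (e 0) (e 1) (e 2))" and h: "\<And>x y z. x = h y z \<longleftrightarrow> R x y z"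
    and "definable_fun f" "definable_fun g"
  shows "definable_fun (\<lambda>e. h (f e) (g e))"
proof -
  have "definable (\<lambda>e. R (e 2) (e 1) (e 0))"
    using definable_rename[OF R, of "\<lambda>i. 2 - i"] by (simp add: numeral_2_eq_2)
  then have "definable (\<lambda>e. \<exists>y. y = f (\<lambda>i. e (Suc i)) \<and> (\<exists>z. z = g (\<lambda>i. e (Suc i)) \<and> R (e 0) y z))"
    using definable_fun_shift2[OF definable_fun_shift[OF assms(4)]]
      definable_fun_shift2[OF assms(3)] definable_fun_shift[OF assms(3)]
    by (intro definable_Ex definable_conj definable_eq definable_fun_var definable_fun_shift2
        definable_fun_shift[OF assms(3)] assms)
      (simp_all add: numeral_2_eq_2 definable_fun_shift definable_fun_shift2 assms)
  then show ?thesis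
    by (simp add: definable_fun_def h)
qed

lemma definable_fun_add: "definable_fun f \<Longrightarrow> definable_fun g \<Longrightarrow> definable_fun (\<lambda>e. f e + g e)"
  by (rule definable_fun_binop[where R = "\<lambda>x y z. x = y + z"])
    (auto intro!: definableI[of "Var 0 \<^bold>= Add (Var 2) (Var 4)" _ undefined] simp: interleave_def)

lemma definable_fun_mult: "definable_fun f \<Longrightarrow> definable_fun g \<Longrightarrow> definable_fun (\<lambda>e. f e * g e)"
  by (rule definable_fun_binop[where R = "\<lambda>x y z. x = y * z"])
    (auto intro!: definableI[of "Var 0 \<^bold>= Mul (Var 2) (Var 4)" _ undefined] simp: interleave_def)

lemma definable_le: "definable_fun f \<Longrightarrow> definable_fun g \<Longrightarrow> definable (\<lambda>e. f e \<le> g e)"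
  unfolding pa_le_def
  by (intro definable_Ex definable_eq definable_fun_add definable_fun_shift definable_fun_var)

lemma definable_less: "definable_fun f \<Longrightarrow> definable_fun g \<Longrightarrow> definable (\<lambda>e. f e < g e)"
  unfolding pa_less_def by (intro definable_conj definable_le definable_Not definable_eq)

lemmas definable_intros = definable_Ex definable_All definable_conj definable_disj definable_imp
  definable_iff definable_Not definable_eq definable_le definable_less definable_fun_var
  definable_fun_const definable_fun_add definable_fun_mult

text \<open>The point where the induction scheme enters.\<close>

lemma pa_induct:
  assumes P: "definable (\<lambda>e. P (e 0))" and "P 0" and step: "\<And>x. P x \<Longrightarrow> P (x + 1)"
  shows "P x"
proof -
  from P obtain \<phi> c where \<phi>: "arithmetical \<phi>" "\<And>e. P (e 0) \<longleftrightarrow> holds (interleave e c) \<phi>"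
    by (elim definableE) blast
  let ?e = "interleave (\<lambda>_. x) c"
  have P_iff: "holds (?e(0 := y)) \<phi> \<longleftrightarrow> P y" for y
  proof -
    have "?e(0 := y) = interleave ((\<lambda>_. x)(0 := y)) c"
      by (rule ext) (auto simp: interleave_def)
    then show ?thesis using \<phi>(2)[of "(\<lambda>_. x)(0 := y)"] by simp
  qed
  have "ind \<phi> 0 \<in> PA"
    using \<phi>(1) by (auto simp: PA_def)
  then have "holds ?e (ind \<phi> 0)"
    by (rule holds_PA)
  then have "holds ?e ((\<^bold>\<forall>0. \<phi> \<^bold>\<longrightarrow> subst1 \<phi> 0 (Succ (Var 0))) \<^bold>\<longrightarrow> subst1 \<phi> 0 Zero \<^bold>\<longrightarrow> (\<^bold>\<forall>0. \<phi>))"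
    unfolding ind_def universal_closure_def by (rule sat_foldr_Forall) simp
  then show ?thesis
    using assms(2) step by (simp add: sat_subst1 P_iff)
qed

subsection \<open>Elementary arithmetic\<close>

lemma pa_add_1_neq_0: "x + 1 \<noteq> (0 :: 'a::pa_model)"
proof -
  have "holds (\<lambda>_. x) (\<^bold>\<forall>0. \<^bold>\<not> Succ \<^bold>v0 \<^bold>= Zero)" by (rule holds_PA) (simp add: PA_def)
  then show ?thesis by simp
qed

lemma pa_add_1_cancel: "x + 1 = y + 1 \<Longrightarrow> x = (y :: 'a::pa_model)"
proof -
  have "holds (\<lambda>_. x) (\<^bold>\<forall>0. \<^bold>\<forall>1. Succ \<^bold>v0 \<^bold>= Succ \<^bold>v1 \<^bold>\<longrightarrow> \<^bold>v0 \<^bold>= \<^bold>v1)"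
    by (rule holds_PA) (simp add: PA_def)
  then show "x + 1 = y + 1 \<Longrightarrow> x = y" by simp
qed

lemma pa_add_0: "x + 0 = (x :: 'a::pa_model)"
proof -
  have "holds (\<lambda>_. x) (\<^bold>\<forall>0. Add \<^bold>v0 Zero \<^bold>= \<^bold>v0)" by (rule holds_PA) (simp add: PA_def)
  then show ?thesis by simp
qed

lemma pa_add_add_1: "x + (y + 1) = (x + y) + (1 :: 'a::pa_model)"
proof -
  have "holds (\<lambda>_. x) (\<^bold>\<forall>0. \<^bold>\<forall>1. Add \<^bold>v0 (Succ \<^bold>v1) \<^bold>= Succ (Add \<^bold>v0 \<^bold>v1))"
    by (rule holds_PA) (simp add: PA_def)
  then show ?thesis by simp
qed

lemma pa_mult_0: "x * 0 = (0 :: 'a::pa_model)"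
proof -
  have "holds (\<lambda>_. x) (\<^bold>\<forall>0. Mul \<^bold>v0 Zero \<^bold>= Zero)" by (rule holds_PA) (simp add: PA_def)
  then show ?thesis by simp
qed

lemma pa_mult_add_1: "x * (y + 1) = x * y + (x :: 'a::pa_model)"
proof -
  have "holds (\<lambda>_. x) (\<^bold>\<forall>0. \<^bold>\<forall>1. Mul \<^bold>v0 (Succ \<^bold>v1) \<^bold>= Add (Mul \<^bold>v0 \<^bold>v1) \<^bold>v0)"
    by (rule holds_PA) (simp add: PA_def)
  then show ?thesis by simp
qed

lemma pa_0_add: "0 + x = (x :: 'a::pa_model)"
  by (rule pa_induct[of "\<lambda>x. 0 + x = x"], (intro definable_intros)[1])
    (simp_all add: pa_add_0 pa_add_add_1)

lemma pa_add_1_add: "(x + 1) + y = (x + y) + (1 :: 'a::pa_model)"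
  by (rule pa_induct[of "\<lambda>y. (x + 1) + y = (x + y) + 1"], (intro definable_intros)[1])
    (simp_all add: pa_add_0 pa_add_add_1)

lemma pa_add_commute: "x + y = y + (x :: 'a::pa_model)"
  by (rule pa_induct[of "\<lambda>y. x + y = y + x"], (intro definable_intros)[1])
    (simp_all add: pa_add_0 pa_0_add pa_add_add_1 pa_add_1_add)

lemma pa_add_assoc: "(x + y) + z = x + (y + (z :: 'a::pa_model))"
  by (rule pa_induct[of "\<lambda>z. (x + y) + z = x + (y + z)"], (intro definable_intros)[1])
    (simp_all add: pa_add_0 pa_add_add_1)

lemma pa_add_left_commute: "x + (y + z) = y + (x + (z :: 'a::pa_model))"
  by (metis pa_add_assoc pa_add_commute)

lemma pa_0_mult: "0 * x = (0 :: 'a::pa_model)"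
  by (rule pa_induct[of "\<lambda>x. 0 * x = 0"], (intro definable_intros)[1])
    (simp_all add: pa_add_0 pa_mult_0 pa_mult_add_1)

lemma pa_add_1_mult: "(x + 1) * y = x * y + (y :: 'a::pa_model)"
  by (rule pa_induct[of "\<lambda>y. (x + 1) * y = x * y + y"], (intro definable_intros)[1])
    (simp_all add: pa_mult_0 pa_add_0 pa_mult_add_1 pa_add_assoc pa_add_commute pa_add_left_commute)

lemma pa_mult_commute: "x * y = y * (x :: 'a::pa_model)"
  by (rule pa_induct[of "\<lambda>y. x * y = y * x"], (intro definable_intros)[1])
    (simp_all add: pa_mult_0 pa_0_mult pa_mult_add_1 pa_add_1_mult)

lemma pa_distrib: "x * (y + z) = x * y + x * (z :: 'a::pa_model)"
  by (rule pa_induct[of "\<lambda>z. x * (y + z) = x * y + x * z"], (intro definable_intros)[1])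
    (simp_all add: pa_add_0 pa_mult_0 pa_mult_add_1 pa_add_assoc[symmetric])

lemma pa_mult_1: "x * 1 = (x :: 'a::pa_model)"
  using pa_mult_add_1[of x 0] by (simp add: pa_mult_0 pa_0_add)

lemma pa_mult_assoc: "(x * y) * z = x * (y * (z :: 'a::pa_model))"
  by (rule pa_induct[of "\<lambda>z. (x * y) * z = x * (y * z)"], (intro definable_intros)[1])
    (simp_all add: pa_mult_0 pa_mult_add_1 pa_distrib pa_mult_1)

lemma pa_add_cancel: "x + z = y + z \<Longrightarrow> x = (y :: 'a::pa_model)"
proof -
  have "x + z = y + z \<longrightarrow> x = y"
    by (rule pa_induct[of "\<lambda>z. x + z = y + z \<longrightarrow> x = y"], (intro definable_intros)[1])
      (auto simp: pa_add_0 pa_add_assoc[symmetric] dest: pa_add_1_cancel)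
  then show "x + z = y + z \<Longrightarrow> x = y" by simp
qed

lemma pa_cases: "x = 0 \<or> (\<exists>y. x = y + (1 :: 'a::pa_model))"
  by (rule pa_induct[of "\<lambda>x. x = 0 \<or> (\<exists>y. x = y + 1)"], (intro definable_intros)[1]) auto

lemma pa_add_eq_0: "x + y = 0 \<Longrightarrow> x = (0 :: 'a::pa_model)"
  using pa_cases[of y] pa_add_1_neq_0 by (metis pa_add_0 pa_add_assoc)

lemma pa_mult_eq_0: "x * y = 0 \<Longrightarrow> x = 0 \<or> y = (0 :: 'a::pa_model)"
  using pa_cases[of y] by (metis pa_add_commute pa_add_eq_0 pa_mult_add_1)

lemma pa_linear: "(\<exists>z. y = x + z) \<or> (\<exists>z. x = y + (z :: 'a::pa_model))"
proof (rule pa_induct[of "\<lambda>y. (\<exists>z. y = x + z) \<or> (\<exists>z. x = y + z)"], (intro definable_intros)[1])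
  show "(\<exists>z. 0 = x + z) \<or> (\<exists>z. x = 0 + z)" by (metis pa_0_add)
  fix y assume "(\<exists>z. y = x + z) \<or> (\<exists>z. x = y + z)"
  then show "(\<exists>z. y + 1 = x + z) \<or> (\<exists>z. x = (y + 1) + z)"
  proof
    assume "\<exists>z. x = y + z"
    then obtain z where z: "x = y + z" ..
    show ?thesis
      using pa_cases[of z] by (metis pa_add_0 pa_add_add_1 pa_add_assoc pa_add_commute z)
  qed (metis pa_add_assoc)
qed

text \<open>Subtraction is truncated, so the laws for it need case distinctions; everything else is
  immediate from the Peano axioms and their consequences above.\<close>

instance pa_model \<subseteq> linordered_semidom
proof
  fix a b c :: 'a
  have minus: "x - y = z" if "x = y + z" for x y z :: 'a
    using that pa_add_cancel[of _ y] unfolding pa_minus_def pa_le_def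
    by (auto simp: pa_add_commute[of y] intro!: the_equality)
  have minus0: "x - y = 0" if "\<not> y \<le> x" for x y :: 'a
    using that unfolding pa_minus_def by simp
  have cancel: "x + y = x + z \<Longrightarrow> y = z" for x y z :: 'a
    using pa_add_cancel[of y x z] by (simp add: pa_add_commute)
  show add0: "0 + a = a" by (rule pa_0_add)
  show "a + b + c = a + (b + c)" by (rule pa_add_assoc)
  show "a + b = b + a" by (rule pa_add_commute)
  show "a * b * c = a * (b * c)" by (rule pa_mult_assoc)
  show "a * b = b * a" by (rule pa_mult_commute)
  show "1 * a = a" by (metis pa_mult_1 pa_mult_commute)
  show "(a + b) * c = a * c + b * c" by (metis pa_distrib pa_mult_commute)
  show "a * (b + c) = a * b + a * c" by (rule pa_distrib)
  show "(0::'a) \<noteq> 1" using pa_add_1_neq_0[of 0] pa_0_add[of 1] by metis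
  show "a + b - a = b" by (rule minus) simp
  show "0 * a = 0" by (rule pa_0_mult)
  show "a * 0 = 0" by (rule pa_mult_0)
  show "a \<le> a" unfolding pa_le_def by (metis pa_add_0)
  show "(a < b) = (a \<le> b \<and> \<not> b \<le> a)"
    unfolding pa_less_def pa_le_def
    by (metis pa_add_0 pa_add_assoc pa_add_eq_0 cancel)
  show "a \<le> b \<Longrightarrow> b \<le> c \<Longrightarrow> a \<le> c" unfolding pa_le_def by (metis pa_add_assoc)
  show "a \<le> b \<Longrightarrow> b \<le> a \<Longrightarrow> a = b"
    unfolding pa_le_def by (metis pa_add_0 pa_add_assoc pa_add_eq_0 cancel)
  show "a \<le> b \<or> b \<le> a" unfolding pa_le_def by (rule pa_linear)
  show "a \<le> b \<Longrightarrow> c + a \<le> c + b" unfolding pa_le_def by (metis pa_add_assoc)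
  have le_imp: "\<exists>z. y = x + z" if "x \<le> y" for x y :: 'a
    using that unfolding pa_le_def .
  have le_add: "x \<le> x + y" for x y :: 'a
    unfolding pa_le_def by blast
  show "a - b - c = a - (b + c)"
  proof (cases "b \<le> a")
    case True
    then obtain z where a: "a = b + z" using le_imp by blast
    show ?thesis
    proof (cases "c \<le> z")
      case True
      then obtain w where "z = c + w" using le_imp by blast
      then show ?thesis using minus[of a b z] minus[of z c w] minus[of a "b + c" w]
        by (simp add: a pa_add_assoc)
    next
      case False
      have "\<not> b + c \<le> a"
        using False le_imp[of "b + c" a] le_add unfolding a by (metis cancel pa_add_assoc)
      with False show ?thesis using minus[of a b z] minus0 a by simp
    qed
  next
    case False
    then have "\<not> b + c \<le> a"
      using le_imp[of "b + c" a] le_add by (metis pa_add_assoc)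
    moreover have "0 - c = 0"
      using minus0[of c 0] minus[of 0 c 0] le_imp[of c 0] by (metis pa_add_0 pa_add_eq_0)
    ultimately show ?thesis using False minus0 by simp
  qed
  show "a * (b - c) = a * b - a * c"
  proof (cases "c \<le> b")
    case True
    then obtain z where "b = c + z" using le_imp by blast
    then show ?thesis using minus[of b c z] minus[of "a * b" "a * c" "a * z"] by (simp add: pa_distrib)
  next
    case False
    then obtain z where c: "c = b + z" using pa_linear[of c b] le_add by metis
    have "a * b - a * c = 0"
    proof (cases "a * c \<le> a * b")
      case True
      then obtain w where w: "a * b = a * c + w" using le_imp by blast
      then have "a * b + 0 = a * b + (a * z + w)"
        by (simp add: c pa_distrib pa_add_0 pa_add_assoc[symmetric])
      then have "a * z + w = 0" using cancel by metis
      then have "w = 0" by (metis pa_add_commute pa_add_eq_0)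
      then show ?thesis using minus[OF w] by simp
    qed (rule minus0)
    with False show ?thesis using minus0 pa_mult_0 by simp
  qed
  show "a \<noteq> 0 \<Longrightarrow> b \<noteq> 0 \<Longrightarrow> a * b \<noteq> 0" using pa_mult_eq_0 by blast
  show "(0::'a) < 1"
    using le_add[of 0 1] pa_add_1_neq_0[of 0] unfolding pa_less_def pa_0_add by metis
  show "b \<le> a \<Longrightarrow> a - b + b = a"
    using le_imp[of b a] minus pa_add_commute by metis
  show "a < b \<Longrightarrow> 0 < c \<Longrightarrow> c * a < c * b"
    unfolding pa_less_def
    by (metis cancel le_add le_imp pa_add_0 pa_distrib pa_mult_eq_0)
qed

lemma less_add_1_iff: "x < y + 1 \<longleftrightarrow> x \<le> (y :: 'a::pa_model)"
proof
  assume "x < y + 1"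
  show "x \<le> y"
  proof (rule ccontr)
    assume "\<not> x \<le> y"
    then obtain z where z: "x = y + z" "z \<noteq> 0"
      by (metis le_cases pa_le_def add_0_right order_refl)
    then obtain w where "z = w + 1" using pa_cases by blast
    then have "y + 1 \<le> x" using z unfolding pa_le_def by (metis add.assoc add.commute)
    with \<open>x < y + 1\<close> show False by simp
  qed
next
  assume "x \<le> y"
  then show "x < y + 1" by (rule le_less_trans) simp
qed

lemma pa_zero_le [simp]: "0 \<le> (x :: 'a::pa_model)"
  unfolding pa_le_def by simp

lemma pa_le_0_iff [simp]: "x \<le> 0 \<longleftrightarrow> x = (0 :: 'a::pa_model)"
  by (metis antisym order_refl pa_zero_le)

lemma pa_gr_0_iff [simp]: "0 < x \<longleftrightarrow> x \<noteq> (0 :: 'a::pa_model)"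
  by (metis pa_zero_le order_le_less order_less_irrefl)

lemma pa_not_less_0 [simp]: "\<not> x < (0 :: 'a::pa_model)"
  using pa_zero_le leD by blast

lemma pa_less_induct:
  assumes P: "definable (\<lambda>e. P (e 0))" and step: "\<And>x. (\<And>y. y < x \<Longrightarrow> P y) \<Longrightarrow> P x"
  shows "P (x :: 'a::pa_model)"
proof -
  have "\<forall>y. y < x \<longrightarrow> P y"
  proof (rule pa_induct[of "\<lambda>x. \<forall>y. y < x \<longrightarrow> P y"])
    show "definable (\<lambda>e. \<forall>y :: 'a. y < e 0 \<longrightarrow> P y)"
      by (intro definable_intros P)
    fix x :: 'a assume "\<forall>y. y < x \<longrightarrow> P y"
    then show "\<forall>y. y < x + 1 \<longrightarrow> P y"
      using step less_add_1_iff by (metis order_le_less)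
  qed simp
  then show ?thesis using step by blast
qed

section \<open>Pairs and finite sets in a model\<close>

text \<open>The Cantor pairing function contains a division by \<open>2\<close>, which is always possible.\<close>

lemma even_mult_add_1: "\<exists>m. m + m = n * (n + (1 :: 'a::pa_model))"
proof (rule pa_induct[of "\<lambda>n. \<exists>m. m + m = n * (n + 1)"], (intro definable_intros)[1])
  fix x :: 'a assume "\<exists>m. m + m = x * (x + 1)"
  then obtain m where m: "m + m = x * (x + 1)" ..
  have "(m + (x + 1)) + (m + (x + 1)) = (m + m) + ((x + 1) + (x + 1))"
    by (simp add: ac_simps)
  also have "\<dots> = (x + 1) * (x + 1 + 1)"
    unfolding m by (simp add: algebra_simps)
  finally show "\<exists>m. m + m = (x + 1) * (x + 1 + 1)" ..
qed (auto intro: exI[of _ 0])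

lemma double_less_iff: "x + x < y + y \<longleftrightarrow> x < (y :: 'a::linordered_semidom)"
  by (metis add_strict_mono linorder_less_linear order_less_asym)

lemma double_eq_iff: "x + x = y + y \<longleftrightarrow> x = (y :: 'a::linordered_semidom)"
  by (metis double_less_iff linorder_less_linear order_less_irrefl)

definition pair :: "'a::pa_model \<Rightarrow> 'a \<Rightarrow> 'a" where
  "pair x y = (THE z. z + z = (x + y) * (x + y + 1) + (x + x))"

lemma pair_iff: "z = pair x y \<longleftrightarrow> z + z = (x + y) * (x + y + 1) + (x + x)"
proof -
  obtain m where m: "m + m = (x + y) * (x + y + 1)" using even_mult_add_1 by blast
  have "(m + x) + (m + x) = (m + m) + (x + x)"
    by (simp add: ac_simps)
  then have "\<exists>z. z + z = (x + y) * (x + y + 1) + (x + x)"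
    unfolding m by blast
  then have "\<exists>!z. z + z = (x + y) * (x + y + 1) + (x + x)"
    using double_eq_iff by metis
  from theI'[OF this] this show ?thesis
    unfolding pair_def[symmetric] by blast
qed

lemma pair_double: "pair x y + pair x y = (x + y) * (x + y + 1) + (x + x)"
  using pair_iff by blast

lemma definable_fun_pair:
  "definable_fun f \<Longrightarrow> definable_fun g \<Longrightarrow> definable_fun (\<lambda>e. pair (f e) (g e))"
  by (rule definable_fun_binop[OF _ pair_iff]) (intro definable_intros)+

lemmas definable_intros' = definable_intros definable_fun_pair

text \<open>The pairs with a given sum \<open>n\<close> lie between \<open>n (n + 1)/2\<close> and \<open>n (n + 1)/2 + n\<close>, so
  larger sums give larger codes. Injectivity is a consequence: the sum is determined first, and then
  the first component.\<close>

lemma pair_less_if_sum_less: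
  assumes "x + y < x' + y'"
  shows "pair x y < pair x' y'"
proof -
  have le: "x + y + 1 \<le> x' + y'"
    using assms less_add_1_iff[of "x + y + 1" "x' + y'"] by simp
  have "(x + y) * (x + y + 1) + (x + x) < (x + y) * (x + y + 1) + ((x + y + 1) + (x + y + 1))"
    by (intro add_strict_left_mono add_strict_mono) (simp_all add: less_add_1_iff add_increasing2)
  also have "\<dots> = (x + y + 1) * (x + y + 1 + 1)"
    by (simp add: algebra_simps)
  also have "\<dots> \<le> (x' + y') * (x' + y' + 1)"
    using le by (intro mult_mono) auto
  also have "\<dots> \<le> (x' + y') * (x' + y' + 1) + (x' + x')"
    by simp
  finally show ?thesis
    unfolding pair_double[symmetric] double_less_iff .
qed

lemma pair_eq_iff [simp]: "pair x y = pair x' y' \<longleftrightarrow> x = x' \<and> y = y'"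
proof
  assume eq: "pair x y = pair x' y'"
  then have s: "x + y = x' + y'"
    using pair_less_if_sum_less by (metis linorder_less_linear order_less_irrefl)
  have "(x + y) * (x + y + 1) + (x + x) = (x + y) * (x + y + 1) + (x' + x')"
    using eq pair_double[of x y] pair_double[of x' y'] s by simp
  then have "x = x'" by (simp only: add_left_cancel double_eq_iff)
  with s show "x = x' \<and> y = y'" by simp
qed simp

lemma sum_le_pair: "x + y \<le> pair x y"
proof -
  have "(x + y) + (x + y) \<le> (x + y) * (x + y + 1) + (x + x)"
  proof (cases "x + y = 0")
    case False
    then have "1 \<le> x + y"
      using less_add_1_iff[of 1 "x + y"] pa_gr_0_iff[of "x + y"] by (metis add_less_cancel_right add_0)
    then have "(x + y) * (1 + 1) \<le> (x + y) * (x + y + 1)"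
      by (intro mult_left_mono add_right_mono) auto
    then have "(x + y) + (x + y) \<le> (x + y) * (x + y + 1)"
      by (simp only: distrib_left[of "x + y" 1 1] mult_1_right)
    then show ?thesis by (rule order_trans) simp
  qed (simp add: add_increasing)
  then show ?thesis
    unfolding pair_double[symmetric] by (meson double_less_iff leD leI)
qed

lemma le_pair1: "x \<le> pair x y" and le_pair2: "y \<le> pair x y"
  using sum_le_pair[of x y] pa_zero_le[of x] pa_zero_le[of y]
  by (metis add_increasing2 order_trans order_refl, metis add_increasing order_trans order_refl)

lemma less_pair:
  assumes "x \<noteq> 0"
  shows "y < pair x y"
proof -
  have "y < x + y" using assms by simp
  then show ?thesis using sum_le_pair by (rule less_le_trans)
qed

definition mem :: "'a::pa_model \<Rightarrow> 'a \<Rightarrow> bool" where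
  "mem x s \<longleftrightarrow> (\<exists>k a b c. s = pair k (pair a b) \<and> x < k \<and> a = c * ((x + 1) * b + 1))"

lemma definable_mem: "definable_fun f \<Longrightarrow> definable_fun g \<Longrightarrow> definable (\<lambda>e. mem (f e) (g e))"
  unfolding mem_def
  by (intro definable_intros' definable_fun_shift)

lemma mem_less: "mem x s \<Longrightarrow> x < s"
  unfolding mem_def using le_pair1 less_le_trans by blast

text \<open>Provides the number \<open>b\<close> in the code of a set of elements below \<open>k\<close>: its moduli are pairwise coprime
  because all differences of elements divide \<open>b\<close>.\<close>

lemma common_multiple: "\<exists>b. b \<noteq> 0 \<and> (\<forall>x. 0 < x \<and> x \<le> k \<longrightarrow> (\<exists>c. b = x * (c :: 'a::pa_model)))"
proof (rule pa_induct[of "\<lambda>k. \<exists>b. b \<noteq> 0 \<and> (\<forall>x. 0 < x \<and> x \<le> k \<longrightarrow> (\<exists>c. b = x * c))"],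
    (intro definable_intros)[1])
  show "\<exists>b. b \<noteq> 0 \<and> (\<forall>x. 0 < x \<and> x \<le> 0 \<longrightarrow> (\<exists>c. b = x * (c :: 'a)))"
    by (rule exI[of _ 1]) auto
  fix k :: 'a assume "\<exists>b. b \<noteq> 0 \<and> (\<forall>x. 0 < x \<and> x \<le> k \<longrightarrow> (\<exists>c. b = x * c))"
  then obtain b where b: "b \<noteq> 0" "\<And>x. 0 < x \<Longrightarrow> x \<le> k \<Longrightarrow> \<exists>c. b = x * c" by blast
  have "\<exists>c. b * (k + 1) = x * c" if "0 < x" "x \<le> k + 1" for x
  proof (cases "x = k + 1")
    case False
    then have "x < k + 1" using that by simp
    then have "x \<le> k" by (simp only: less_add_1_iff)
    then show ?thesis using b(2)[of x] that by (metis mult.assoc)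
  qed (metis mult.commute)
  moreover have "b * (k + 1) \<noteq> 0" using b(1) pa_add_1_neq_0 by simp
  ultimately show "\<exists>b. b \<noteq> 0 \<and> (\<forall>x. 0 < x \<and> x \<le> k + 1 \<longrightarrow> (\<exists>c. b = x * c))" by blast
qed

text \<open>The modulus \<open>m = (x + 1) b + 1\<close> is coprime to the modulus of \<open>j\<close>: modulo \<open>m\<close>, the product of
  \<open>x + 1\<close> and \<open>(j + 1) b + 1\<close> is \<open>x - j = \<plusminus> d\<close>, which divides \<open>b\<close>, and \<open>b\<close> is invertible, its
  inverse being \<open>- (x + 1)\<close>. Thus \<open>m\<close> divides successively \<open>a d\<close>, \<open>a b\<close> and \<open>a\<close>. No prime factorization
  or gcd inside the model is involved.\<close>

lemma modulus_cancel:
  fixes a b :: "'a::linordered_semidom"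
  assumes dvd: "(x + 1) * b + 1 dvd a * ((j + 1) * b + 1)"
    and diff: "x = j + d \<or> j = x + d" "d dvd b"
  shows "(x + 1) * b + 1 dvd a"
proof -
  let ?m = "(x + 1) * b + 1" and ?n = "(j + 1) * b + 1"
  have "?m dvd a * d"
    using diff(1)
  proof
    assume x: "x = j + d"
    have "a * ?n * (x + 1) = a * d + ?m * (a * (j + 1))"
      by (simp add: x algebra_simps)
    moreover have "?m dvd a * ?n * (x + 1)" using dvd by simp
    ultimately show ?thesis by (metis dvd_add_left_iff dvd_triv_left)
  next
    assume j: "j = x + d"
    have "?m * (a * (j + 1)) = a * d + a * ?n * (x + 1)"
      by (simp add: j algebra_simps)
    moreover have "?m dvd a * ?n * (x + 1)" using dvd by simp
    ultimately show ?thesis by (metis dvd_add_left_iff dvd_triv_left)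
  qed
  moreover obtain c where "b = d * c" using diff(2) by (elim dvdE)
  ultimately have "?m dvd a * b" by (metis dvd_mult2 mult.assoc)
  then have "?m dvd a * b * (x + 1)" by simp
  moreover have "?m * a = a + a * b * (x + 1)"
    by (simp add: algebra_simps)
  ultimately show ?thesis by (metis dvd_add_left_iff dvd_triv_left)
qed

text \<open>The number \<open>a\<close> in the code of the set is the product of the moduli of its elements. It is obtained
  by induction on a bound \<open>j\<close> of the elements taken into account, as multiplication by the modulus
  of \<open>j\<close> affects divisibility by no other modulus.\<close>

lemma comprehension:
  assumes P: "definable (\<lambda>e. P (e 0))"
  shows "\<exists>s. \<forall>x. mem x s \<longleftrightarrow> x < k \<and> P (x :: 'a::pa_model)"
proof -
  obtain b where b: "b \<noteq> 0" "\<And>x. 0 < x \<Longrightarrow> x \<le> k \<Longrightarrow> \<exists>c. b = x * c"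
    using common_multiple[of k] by blast
  have diff: "\<exists>d. (x = j + d \<or> j = x + d) \<and> d dvd b" if "x < k" "j < k" "x \<noteq> j" for x j
  proof -
    obtain d where d: "x = j + d \<or> j = x + d" using pa_linear[of j x] by blast
    then have "d \<le> x \<or> d \<le> j" by (auto simp: add_increasing)
    then have "0 < d" "d \<le> k" using that d
      by (auto intro: order_trans[OF _ less_imp_le])
    with b(2) d show ?thesis by (metis dvd_triv_left)
  qed
  have "\<exists>a. a \<noteq> 0 \<and> (\<forall>x. x < k \<longrightarrow> ((\<exists>c. a = c * ((x + 1) * b + 1)) \<longleftrightarrow> x < j \<and> P x))" for j
  proof (rule pa_induct[of
        "\<lambda>j. \<exists>a. a \<noteq> 0 \<and> (\<forall>x. x < k \<longrightarrow> ((\<exists>c. a = c * ((x + 1) * b + 1)) \<longleftrightarrow> x < j \<and> P x))"])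
    show "definable (\<lambda>e. \<exists>a :: 'a. a \<noteq> 0 \<and>
        (\<forall>x. x < k \<longrightarrow> ((\<exists>c. a = c * ((x + 1) * b + 1)) \<longleftrightarrow> x < e 0 \<and> P x)))"
      by (intro definable_intros P)
    have "(1 :: 'a) \<noteq> c * ((x + 1) * b + 1)" for c x
    proof
      assume *: "1 = c * ((x + 1) * b + 1)"
      then have "c \<noteq> 0" by auto
      have "1 < (x + 1) * b + 1" using b(1) pa_add_1_neq_0[of x] by simp
      moreover have "(x + 1) * b + 1 \<le> c * ((x + 1) * b + 1)"
        using \<open>c \<noteq> 0\<close> mult_right_mono[of 1 c "(x + 1) * b + 1"] less_add_1_iff[of 1 c]
          add_strict_right_mono[of 0 c 1] by simp
      ultimately show False using * by simp
    qed
    then show "\<exists>a. a \<noteq> 0 \<and> (\<forall>x. x < k \<longrightarrow> ((\<exists>c. a = c * ((x + 1) * b + 1)) \<longleftrightarrow> x < 0 \<and> P x))"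
      by (intro exI[of _ 1]) auto
    fix j :: 'a
    assume "\<exists>a. a \<noteq> 0 \<and> (\<forall>x. x < k \<longrightarrow> ((\<exists>c. a = c * ((x + 1) * b + 1)) \<longleftrightarrow> x < j \<and> P x))"
    then obtain a where a: "a \<noteq> 0"
      "\<And>x. x < k \<Longrightarrow> (\<exists>c. a = c * ((x + 1) * b + 1)) \<longleftrightarrow> x < j \<and> P x" by blast
    have dvd: "(\<exists>c. a' = c * ((x + 1) * b + 1)) \<longleftrightarrow> (x + 1) * b + 1 dvd a'" for a' x
      by (metis dvd_def mult.commute)
    show "\<exists>a. a \<noteq> 0 \<and> (\<forall>x. x < k \<longrightarrow> ((\<exists>c. a = c * ((x + 1) * b + 1)) \<longleftrightarrow> x < j + 1 \<and> P x))"
    proof (cases "P j \<and> j < k")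
      case True
      have "(x + 1) * b + 1 dvd a * ((j + 1) * b + 1) \<longleftrightarrow> x < j + 1 \<and> P x" if "x < k" for x
      proof (cases "x = j")
        case False
        with that True diff obtain d where "x = j + d \<or> j = x + d" "d dvd b" by blast
        then have "(x + 1) * b + 1 dvd a * ((j + 1) * b + 1) \<longleftrightarrow> (x + 1) * b + 1 dvd a"
          using modulus_cancel by (metis dvd_mult2)
        then show ?thesis
          using a(2)[OF that] False unfolding dvd less_add_1_iff by (auto simp: order_le_less)
      qed (use True in simp)
      moreover have "a * ((j + 1) * b + 1) \<noteq> 0" using a(1) pa_add_1_neq_0 by simp
      ultimately show ?thesis unfolding dvd by blast
    next
      case False
      then have "x < j + 1 \<and> P x \<longleftrightarrow> x < j \<and> P x" if "x < k" for x
        using that unfolding less_add_1_iff by (auto simp: order_le_less)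
      with a show ?thesis by metis
    qed
  qed
  from this[of k] obtain a where a: "\<And>x. x < k \<Longrightarrow> (\<exists>c. a = c * ((x + 1) * b + 1)) \<longleftrightarrow> x < k \<and> P x"
    by blast
  have "mem x (pair k (pair a b)) \<longleftrightarrow> x < k \<and> P x" for x
    unfolding mem_def using a[of x] by auto
  then show ?thesis by blast
qed

section \<open>Inductively generated sets\<close>

text \<open>The semantic counterpart of \<open>Gen\<close>. A rule is a monotone operator \<open>F\<close>: the conclusion \<open>x\<close> follows
  from premises in \<open>A\<close> if \<open>F A x\<close>.\<close>

definition gen :: "(('a::pa_model \<Rightarrow> bool) \<Rightarrow> 'a \<Rightarrow> bool) \<Rightarrow> 'a \<Rightarrow> bool" where
  "gen F x \<longleftrightarrow> (\<exists>s. mem x s \<and> (\<forall>z. mem z s \<longrightarrow> F (\<lambda>y. mem y s) z))"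

text \<open>A monotone rule all of whose instances use at most two premises.\<close>

definition finitary :: "(('a \<Rightarrow> bool) \<Rightarrow> bool) \<Rightarrow> bool" where
  "finitary F \<longleftrightarrow>
    (\<forall>A B. (\<forall>y. A y \<longrightarrow> B y) \<longrightarrow> F A \<longrightarrow> F B) \<and>
    (\<forall>A. F A \<longrightarrow> F (\<lambda>_. False) \<or> (\<exists>a b. A a \<and> A b \<and> F (\<lambda>y. y = a \<or> y = b)))"

lemma finitary_const: "finitary (\<lambda>A. c)"
  unfolding finitary_def by blast

lemma finitary_mem: "finitary (\<lambda>A. A a)" "finitary (\<lambda>A. A a \<and> c)" "finitary (\<lambda>A. A a \<and> A b \<and> c)"
  unfolding finitary_def by blast+

lemma finitary_conj: "finitary F \<Longrightarrow> finitary (\<lambda>A. c \<and> F A)" "finitary F \<Longrightarrow> finitary (\<lambda>A. F A \<and> c)"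
  by (cases c; simp add: finitary_const)+

lemma finitary_disj: "finitary F \<Longrightarrow> finitary G \<Longrightarrow> finitary (\<lambda>A. F A \<or> G A)"
  unfolding finitary_def by metis

lemma finitary_Ex: "(\<And>x. finitary (F x)) \<Longrightarrow> finitary (\<lambda>A. \<exists>x. F x A)"
  unfolding finitary_def by metis

lemmas finitary_intros = finitary_const finitary_mem(3,2,1) finitary_conj finitary_disj finitary_Ex

text \<open>From right to left, the derivations of at most two premises are united into one finite set,
  to which the conclusion is added. Restricting the number of premises makes this possible by
  comprehension alone; arbitrarily many derivations could be collected only with the help of the
  collection scheme.\<close>

lemma gen_unfold:
  fixes F :: "('a::pa_model \<Rightarrow> bool) \<Rightarrow> 'a \<Rightarrow> bool"
  assumes F: "\<And>x. finitary (\<lambda>A. F A x)"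
  shows "gen F x \<longleftrightarrow> F (gen F) x"
proof
  have mono: "F A z \<Longrightarrow> (\<And>y. A y \<Longrightarrow> B y) \<Longrightarrow> F B z" for A B z
    using F unfolding finitary_def by blast
  show "gen F x \<Longrightarrow> F (gen F) x"
    unfolding gen_def using mono by (smt (verit, ccfv_threshold))
  have un: "\<exists>s. mem x s \<and> (\<forall>z. mem z s \<longrightarrow> z = x \<or> gen F z) \<and> (\<forall>z. mem z s \<longrightarrow> F (\<lambda>y. mem y s) z)"
    if s: "\<forall>z. mem z s \<longrightarrow> F (\<lambda>y. mem y s) z" and t: "\<forall>z. mem z t \<longrightarrow> F (\<lambda>y. mem y t) z"
      and x: "F (\<lambda>y. mem y s \<or> mem y t) x" for s t
  proof -
    have "definable (\<lambda>e. mem (e 0) s \<or> mem (e 0) t \<or> e 0 = x)"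
      by (intro definable_intros definable_mem)
    from comprehension[OF this, of "s + t + (x + 1)"] obtain u where
      u: "mem y u \<longleftrightarrow> y < s + t + (x + 1) \<and> (mem y s \<or> mem y t \<or> y = x)" for y by blast
    have "y < s + t + (x + 1)" if "mem y s \<or> mem y t \<or> y = x" for y
    proof -
      have "y < s + (t + (x + 1))" if "mem y s" using mem_less[OF that] by (rule less_le_trans) simp
      moreover have "y < t + (s + (x + 1))" if "mem y t" using mem_less[OF that] by (rule less_le_trans) simp
      moreover have "x < (s + t) + (x + 1)" by (rule less_le_trans[of _ "x + 1"]) (simp_all add: add_increasing)
      ultimately show ?thesis using that by (auto simp: ac_simps)
    qed
    with u have u': "mem y u \<longleftrightarrow> mem y s \<or> mem y t \<or> y = x" for y by blast
    have "\<forall>z. mem z u \<longrightarrow> F (\<lambda>y. mem y u) z"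
      using s t x mono unfolding u' by (smt (verit, ccfv_threshold))
    moreover have "z = x \<or> gen F z" if "mem z u" for z
      using that s t unfolding u' gen_def by blast
    ultimately show ?thesis using u' by blast
  qed
  assume "F (gen F) x"
  then consider "F (\<lambda>_. False) x" | a b where "gen F a" "gen F b" "F (\<lambda>y. y = a \<or> y = b) x"
    using F unfolding finitary_def by blast
  then show "gen F x"
  proof cases
    case 1
    have "\<exists>s :: 'a. \<forall>x. \<not> mem x s"
      using comprehension[of "\<lambda>_. True" "0 :: 'a"] by (simp add: definable_eq_vars[of 0 0, simplified])
    then obtain s :: 'a where "\<forall>x. \<not> mem x s" by blast
    then show ?thesis using un[of s s] mono[OF 1] unfolding gen_def by blast
  next
    case 2
    then obtain s t where s: "mem a s" "\<forall>z. mem z s \<longrightarrow> F (\<lambda>y. mem y s) z"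
      and t: "mem b t" "\<forall>z. mem z t \<longrightarrow> F (\<lambda>y. mem y t) z" unfolding gen_def by blast
    have "F (\<lambda>y. mem y s \<or> mem y t) x"
      by (rule mono[OF 2(3)]) (use s t in auto)
    then show ?thesis using un[OF s(2) t(2)] unfolding gen_def by blast
  qed
qed

section \<open>Syntax inside a model\<close>

text \<open>As the constructors merely abbreviate pairs tagged with numerals, injectivity and distinctness are
  settled by \<open>pair_eq_iff\<close>.\<close>

abbreviation cZero :: "'a::pa_model" where "cZero \<equiv> pair 1 0"
abbreviation cSucc :: "'a::pa_model \<Rightarrow> 'a" where "cSucc t \<equiv> pair 2 t"
abbreviation cAdd :: "'a::pa_model \<Rightarrow> 'a \<Rightarrow> 'a" where "cAdd t u \<equiv> pair 3 (pair t u)"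
abbreviation cMul :: "'a::pa_model \<Rightarrow> 'a \<Rightarrow> 'a" where "cMul t u \<equiv> pair 4 (pair t u)"
abbreviation cEq :: "'a::pa_model \<Rightarrow> 'a \<Rightarrow> 'a" where "cEq t u \<equiv> pair 5 (pair t u)"
abbreviation cNeg :: "'a::pa_model \<Rightarrow> 'a" where "cNeg p \<equiv> pair 6 p"
abbreviation cOr :: "'a::pa_model \<Rightarrow> 'a \<Rightarrow> 'a" where "cOr p q \<equiv> pair 7 (pair p q)"
abbreviation cEx :: "'a::pa_model \<Rightarrow> 'a \<Rightarrow> 'a" where "cEx v p \<equiv> pair 8 (pair v p)"
abbreviation cImp :: "'a::pa_model \<Rightarrow> 'a \<Rightarrow> 'a" where "cImp p q \<equiv> cOr (cNeg p) q"
abbreviation cAll :: "'a::pa_model \<Rightarrow> 'a \<Rightarrow> 'a" where "cAll v p \<equiv> cNeg (cEx v (cNeg p))"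

lemma less_cSucc [simp]: "t < pair (numeral k) t"
  by (rule less_pair) simp

lemma less_cAdd1 [simp]: "t < pair (numeral k) (pair t u)"
  by (rule le_less_trans[OF le_pair1 less_pair]) simp

lemma less_cAdd2 [simp]: "u < pair (numeral k) (pair t u)"
  by (rule le_less_trans[OF le_pair2 less_pair]) simp

definition isVar :: "'a::pa_model \<Rightarrow> bool" where
  "isVar e \<longleftrightarrow> (\<exists>i. e = pair 0 i)"

lemma isVar_pair [simp]: "isVar (pair k i) \<longleftrightarrow> k = 0"
  by (auto simp: isVar_def)

text \<open>The following notions mirror their syntactic namesakes, with the bodies of the rules written as
  operators.\<close>

definition isTerm :: "'a::pa_model \<Rightarrow> bool" where
  "isTerm = gen (\<lambda>A x. isVar x \<or> x = cZero \<or> (\<exists>t. A t \<and> x = cSucc t)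
     \<or> (\<exists>t u. A t \<and> A u \<and> (x = cAdd t u \<or> x = cMul t u)))"

definition isFm :: "'a::pa_model \<Rightarrow> bool" where
  "isFm = gen (\<lambda>A x. (\<exists>t u. isTerm t \<and> isTerm u \<and> x = cEq t u) \<or> (\<exists>p. A p \<and> x = cNeg p)
     \<or> (\<exists>p q. A p \<and> A q \<and> x = cOr p q) \<or> (\<exists>v p. isVar v \<and> A p \<and> x = cEx v p))"

definition freeIn :: "'a::pa_model \<Rightarrow> 'a \<Rightarrow> bool" where
  "freeIn v e \<longleftrightarrow> gen (\<lambda>A x. \<exists>e v. x = pair e v \<and>
     ((isVar e \<and> e = v)
      \<or> (\<exists>d. A (pair d v) \<and> (e = cSucc d \<or> e = cNeg d))
      \<or> (\<exists>c d. (A (pair c v) \<or> A (pair d v)) \<and> (e = cAdd c d \<or> e = cMul c d \<or> e = cEq c d \<or> e = cOr c d))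
      \<or> (\<exists>w d. e = cEx w d \<and> w \<noteq> v \<and> A (pair d v)))) (pair e v)"

definition sub :: "'a::pa_model \<Rightarrow> 'a \<Rightarrow> 'a \<Rightarrow> 'a \<Rightarrow> bool" where
  "sub v r e e' \<longleftrightarrow> gen (\<lambda>A x. \<exists>e e' m v r. m = pair v r \<and> x = pair e (pair e' m) \<and>
     ((isVar e \<and> e = v \<and> e' = r)
      \<or> (isVar e \<and> e \<noteq> v \<and> e' = e)
      \<or> (e = cZero \<and> e' = e)
      \<or> (\<exists>d d'. A (pair d (pair d' m)) \<and> ((e = cSucc d \<and> e' = cSucc d') \<or> (e = cNeg d \<and> e' = cNeg d')))
      \<or> (\<exists>c c' d d'. A (pair c (pair c' m)) \<and> A (pair d (pair d' m)) \<and>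
           ((e = cAdd c d \<and> e' = cAdd c' d') \<or> (e = cMul c d \<and> e' = cMul c' d')
            \<or> (e = cEq c d \<and> e' = cEq c' d') \<or> (e = cOr c d \<and> e' = cOr c' d')))
      \<or> (\<exists>d. e = cEx v d \<and> e' = e)
      \<or> (\<exists>w d d'. e = cEx w d \<and> w \<noteq> v \<and> A (pair d (pair d' m)) \<and> e' = cEx w d')))
     (pair e (pair e' (pair v r)))"

definition numeralOf :: "'a::pa_model \<Rightarrow> 'a \<Rightarrow> bool" where
  "numeralOf x n \<longleftrightarrow> gen (\<lambda>A z. \<exists>x n. z = pair x n \<and>
     ((x = 0 \<and> n = cZero) \<or> (\<exists>y m. A (pair y m) \<and> x = y + 1 \<and> n = cSucc m))) (pair x n)"

definition depth :: "'a::pa_model \<Rightarrow> 'a \<Rightarrow> bool" where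
  "depth p n \<longleftrightarrow> gen (\<lambda>A x. \<exists>p n. x = pair p n \<and>
     (((\<exists>t u. p = cEq t u) \<and> n = 0)
      \<or> (\<exists>q m. A (pair q m) \<and> p = cNeg q \<and> n = m + 1)
      \<or> (\<exists>q m q' m'. A (pair q m) \<and> A (pair q' m') \<and> p = cOr q q' \<and>
           ((m \<le> m' \<and> n = m' + 1) \<or> (m' \<le> m \<and> n = m + 1)))
      \<or> (\<exists>q m v. A (pair q m) \<and> p = cEx v q \<and> n = m + 1))) (pair p n)"

subsection \<open>Recursion equations\<close>

lemma isTerm_unfold:
  "isTerm x \<longleftrightarrow> isVar x \<or> x = cZero \<or> (\<exists>t. isTerm t \<and> x = cSucc t)
     \<or> (\<exists>t u. isTerm t \<and> isTerm u \<and> (x = cAdd t u \<or> x = cMul t u))"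
  unfolding isTerm_def by (rule gen_unfold) (intro finitary_intros)

lemma isFm_unfold:
  "isFm x \<longleftrightarrow> (\<exists>t u. isTerm t \<and> isTerm u \<and> x = cEq t u) \<or> (\<exists>p. isFm p \<and> x = cNeg p)
     \<or> (\<exists>p q. isFm p \<and> isFm q \<and> x = cOr p q) \<or> (\<exists>v p. isVar v \<and> isFm p \<and> x = cEx v p)"
  unfolding isFm_def by (rule gen_unfold) (intro finitary_intros)

lemma freeIn_unfold:
  "freeIn v e \<longleftrightarrow> (isVar e \<and> e = v)
      \<or> (\<exists>d. freeIn v d \<and> (e = cSucc d \<or> e = cNeg d))
      \<or> (\<exists>c d. (freeIn v c \<or> freeIn v d) \<and> (e = cAdd c d \<or> e = cMul c d \<or> e = cEq c d \<or> e = cOr c d))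
      \<or> (\<exists>w d. e = cEx w d \<and> w \<noteq> v \<and> freeIn v d)"
  unfolding freeIn_def by (subst gen_unfold, intro finitary_intros) simp

lemma sub_unfold:
  "sub v r e e' \<longleftrightarrow> (isVar e \<and> e = v \<and> e' = r)
      \<or> (isVar e \<and> e \<noteq> v \<and> e' = e)
      \<or> (e = cZero \<and> e' = e)
      \<or> (\<exists>d d'. sub v r d d' \<and> ((e = cSucc d \<and> e' = cSucc d') \<or> (e = cNeg d \<and> e' = cNeg d')))
      \<or> (\<exists>c c' d d'. sub v r c c' \<and> sub v r d d' \<and>
           ((e = cAdd c d \<and> e' = cAdd c' d') \<or> (e = cMul c d \<and> e' = cMul c' d')
            \<or> (e = cEq c d \<and> e' = cEq c' d') \<or> (e = cOr c d \<and> e' = cOr c' d')))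
      \<or> (\<exists>d. e = cEx v d \<and> e' = e)
      \<or> (\<exists>w d d'. e = cEx w d \<and> w \<noteq> v \<and> sub v r d d' \<and> e' = cEx w d')"
  unfolding sub_def by (subst gen_unfold, intro finitary_intros) simp

lemma numeralOf_unfold:
  "numeralOf x n \<longleftrightarrow> (x = 0 \<and> n = cZero) \<or> (\<exists>y m. numeralOf y m \<and> x = y + 1 \<and> n = cSucc m)"
  unfolding numeralOf_def by (subst gen_unfold, intro finitary_intros) simp

lemma depth_unfold:
  "depth p n \<longleftrightarrow> ((\<exists>t u. p = cEq t u) \<and> n = 0)
      \<or> (\<exists>q m. depth q m \<and> p = cNeg q \<and> n = m + 1)
      \<or> (\<exists>q m q' m'. depth q m \<and> depth q' m' \<and> p = cOr q q' \<and>
           ((m \<le> m' \<and> n = m' + 1) \<or> (m' \<le> m \<and> n = m + 1)))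
      \<or> (\<exists>q m v. depth q m \<and> p = cEx v q \<and> n = m + 1)"
  unfolding depth_def by (subst gen_unfold, intro finitary_intros) simp

lemma isFm_simps [simp]:
  "isFm (cEq t u) \<longleftrightarrow> isTerm t \<and> isTerm u"
  "isFm (cNeg p) \<longleftrightarrow> isFm p"
  "isFm (cOr p q) \<longleftrightarrow> isFm p \<and> isFm q"
  "isFm (cEx v p) \<longleftrightarrow> isVar v \<and> isFm p"
  by (subst isFm_unfold; simp)+

lemma isTerm_simps [simp]:
  "isTerm (pair 0 i)"
  "isTerm cZero"
  "isTerm (cSucc t) \<longleftrightarrow> isTerm t"
  "isTerm (cAdd t u) \<longleftrightarrow> isTerm t \<and> isTerm u"
  "isTerm (cMul t u) \<longleftrightarrow> isTerm t \<and> isTerm u"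
  by (subst isTerm_unfold; simp)+

lemma freeIn_simps [simp]:
  "freeIn v (pair 0 i) \<longleftrightarrow> v = pair 0 i"
  "\<not> freeIn v cZero"
  "freeIn v (cSucc t) \<longleftrightarrow> freeIn v t"
  "freeIn v (cAdd t u) \<longleftrightarrow> freeIn v t \<or> freeIn v u"
  "freeIn v (cMul t u) \<longleftrightarrow> freeIn v t \<or> freeIn v u"
  "freeIn v (cEq t u) \<longleftrightarrow> freeIn v t \<or> freeIn v u"
  "freeIn v (cNeg p) \<longleftrightarrow> freeIn v p"
  "freeIn v (cOr p q) \<longleftrightarrow> freeIn v p \<or> freeIn v q"
  "freeIn v (cEx w p) \<longleftrightarrow> w \<noteq> v \<and> freeIn v p"
  by (subst freeIn_unfold; auto)+

lemma sub_simps [simp]: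
  "sub v r (pair 0 i) e' \<longleftrightarrow> e' = (if v = pair 0 i then r else pair 0 i)"
  "sub v r cZero e' \<longleftrightarrow> e' = cZero"
  "sub v r (cSucc t) e' \<longleftrightarrow> (\<exists>t'. sub v r t t' \<and> e' = cSucc t')"
  "sub v r (cAdd t u) e' \<longleftrightarrow> (\<exists>t' u'. sub v r t t' \<and> sub v r u u' \<and> e' = cAdd t' u')"
  "sub v r (cMul t u) e' \<longleftrightarrow> (\<exists>t' u'. sub v r t t' \<and> sub v r u u' \<and> e' = cMul t' u')"
  "sub v r (cEq t u) e' \<longleftrightarrow> (\<exists>t' u'. sub v r t t' \<and> sub v r u u' \<and> e' = cEq t' u')"
  "sub v r (cNeg p) e' \<longleftrightarrow> (\<exists>p'. sub v r p p' \<and> e' = cNeg p')"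
  "sub v r (cOr p q) e' \<longleftrightarrow> (\<exists>p' q'. sub v r p p' \<and> sub v r q q' \<and> e' = cOr p' q')"
  "sub v r (cEx w p) e' \<longleftrightarrow> (if w = v then e' = cEx w p else \<exists>p'. sub v r p p' \<and> e' = cEx w p')"
  by (subst sub_unfold; auto)+

lemma depth_simps [simp]:
  "depth (cEq t u) n \<longleftrightarrow> n = 0"
  "depth (cNeg p) n \<longleftrightarrow> (\<exists>m. depth p m \<and> n = m + 1)"
  "depth (cOr p q) n \<longleftrightarrow> (\<exists>m m'. depth p m \<and> depth q m' \<and> n = max m m' + 1)"
  "depth (cEx v p) n \<longleftrightarrow> (\<exists>m. depth p m \<and> n = m + 1)"
proof -
  have max: "(m \<le> m' \<and> n = m' + 1) \<or> (m' \<le> m \<and> n = m + 1) \<longleftrightarrow> n = max m m' + 1" for m m'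
    by (auto simp: max_def)
  show "depth (cEq t u) n \<longleftrightarrow> n = 0"
    using depth_unfold[of "cEq t u" n] by simp
  show "depth (cNeg p) n \<longleftrightarrow> (\<exists>m. depth p m \<and> n = m + 1)"
    using depth_unfold[of "cNeg p" n] by simp
  show "depth (cOr p q) n \<longleftrightarrow> (\<exists>m m'. depth p m \<and> depth q m' \<and> n = max m m' + 1)"
    using depth_unfold[of "cOr p q" n] unfolding max pair_eq_iff by auto
  show "depth (cEx v p) n \<longleftrightarrow> (\<exists>m. depth p m \<and> n = m + 1)"
    using depth_unfold[of "cEx v p" n] by simp
qed

lemma numeralOf_0 [simp]: "numeralOf 0 n \<longleftrightarrow> n = cZero"
  using pa_add_1_neq_0 numeralOf_unfold[of 0 n] by metis

lemma numeralOf_Suc [simp]: "numeralOf (x + 1) n \<longleftrightarrow> (\<exists>m. numeralOf x m \<and> n = cSucc m)"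
  using pa_add_1_neq_0 numeralOf_unfold[of "x + 1" n] by (metis add_right_cancel)

subsection \<open>Definability\<close>

text \<open>The operator is only ever applied to a coded set, so its definability need be known just for
  those.\<close>

lemma definable_gen:
  "definable (\<lambda>e. F (\<lambda>y. mem y (e (Suc 0))) (e 0) (\<lambda>i. e (Suc (Suc i)))) \<Longrightarrow> definable_fun f \<Longrightarrow>
   definable (\<lambda>e. gen (\<lambda>A z. F A z e) (f e))"
  unfolding gen_def
  by (intro definable_intros' definable_mem definable_fun_shift) simp

lemma definable_isVar: "definable_fun f \<Longrightarrow> definable (\<lambda>e. isVar (f e))"
  unfolding isVar_def by (intro definable_intros' definable_fun_shift)

lemma definable_isTerm: "definable_fun f \<Longrightarrow> definable (\<lambda>e. isTerm (f e))"
  unfolding isTerm_def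
  by (rule definable_gen, intro definable_intros' definable_mem definable_isVar)

lemma definable_isFm: "definable_fun f \<Longrightarrow> definable (\<lambda>e. isFm (f e))"
  unfolding isFm_def
  by (rule definable_gen, intro definable_intros' definable_mem definable_isVar definable_isTerm)

lemma definable_freeIn: "definable_fun f \<Longrightarrow> definable_fun g \<Longrightarrow> definable (\<lambda>e. freeIn (f e) (g e))"
  unfolding freeIn_def
  by (rule definable_gen, intro definable_intros' definable_mem definable_isVar)
    (intro definable_fun_pair)

lemma definable_sub:
  "definable_fun f \<Longrightarrow> definable_fun g \<Longrightarrow> definable_fun h \<Longrightarrow> definable_fun k \<Longrightarrow>
   definable (\<lambda>e. sub (f e) (g e) (h e) (k e))"
  unfolding sub_def
  by (rule definable_gen, intro definable_intros' definable_mem definable_isVar)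
    (intro definable_fun_pair)

lemma definable_numeralOf:
  "definable_fun f \<Longrightarrow> definable_fun g \<Longrightarrow> definable (\<lambda>e. numeralOf (f e) (g e))"
  unfolding numeralOf_def
  by (rule definable_gen, intro definable_intros' definable_mem) (intro definable_fun_pair)

lemma definable_depth: "definable_fun f \<Longrightarrow> definable_fun g \<Longrightarrow> definable (\<lambda>e. depth (f e) (g e))"
  unfolding depth_def
  by (rule definable_gen, intro definable_intros' definable_mem) (intro definable_fun_pair)

lemmas definable_syntax = definable_intros' definable_isVar definable_isTerm definable_isFm
  definable_freeIn definable_sub definable_numeralOf definable_depth

subsection \<open>Substitution, numerals and depth\<close>

lemma add_1_le_iff: "x + 1 \<le> y \<longleftrightarrow> x < (y :: 'a::pa_model)"
  using less_add_1_iff[of "x + 1" y] by simp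

text \<open>Structural induction on a term or formula into which one can substitute. The components of a code
  are smaller, so this is course-of-values induction for the definable relation \<open>P\<close>. Under a
  quantifier that binds \<open>v\<close> itself nothing is substituted, and nothing is known of the body, whence
  the guarded hypothesis in the last case.\<close>

lemma sub_induct [consumes 1, case_names definable Var Zero Succ Add Mul Eq Neg Or Ex]:
  assumes sub: "sub v r e e'" and P: "definable (\<lambda>e. P (e 0))"
    and Var: "\<And>i. P (pair 0 i)" and Zero: "P cZero" and Succ: "\<And>t. P t \<Longrightarrow> P (cSucc t)"
    and Add: "\<And>t u. P t \<Longrightarrow> P u \<Longrightarrow> P (cAdd t u)" and Mul: "\<And>t u. P t \<Longrightarrow> P u \<Longrightarrow> P (cMul t u)"
    and Eq: "\<And>t u. P t \<Longrightarrow> P u \<Longrightarrow> P (cEq t u)" and Neg: "\<And>p. P p \<Longrightarrow> P (cNeg p)"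
    and Or: "\<And>p q. P p \<Longrightarrow> P q \<Longrightarrow> P (cOr p q)" and Ex: "\<And>w p. (w \<noteq> v \<Longrightarrow> P p) \<Longrightarrow> P (cEx w p)"
  shows "P e"
proof -
  have "\<forall>e'. sub v r e e' \<longrightarrow> P e"
  proof (rule pa_less_induct[of "\<lambda>e. \<forall>e'. sub v r e e' \<longrightarrow> P e"])
    show "definable (\<lambda>e. \<forall>e'. sub v r (e 0) e' \<longrightarrow> P (e 0))"
      using definable_rename[OF P, of Suc] by (intro definable_syntax)
    fix e assume "\<And>d. d < e \<Longrightarrow> \<forall>d'. sub v r d d' \<longrightarrow> P d"
    then have IH: "P d" if "d < e" "sub v r d d'" for d d'
      using that by blast
    show "\<forall>e'. sub v r e e' \<longrightarrow> P e"
    proof (intro allI impI)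
      fix e' assume "sub v r e e'"
      then consider "isVar e" | "e = cZero" | t t' where "e = cSucc t" "sub v r t t'"
        | p p' where "e = cNeg p" "sub v r p p'"
        | c c' d d' where "e = cAdd c d \<or> e = cMul c d \<or> e = cEq c d \<or> e = cOr c d"
            "sub v r c c'" "sub v r d d'"
        | p where "e = cEx v p" | w p p' where "e = cEx w p" "sub v r p p'"
        unfolding sub_unfold[of v r e e'] by blast
      then show "P e"
      proof cases
        case 1
        then show ?thesis using Var by (auto simp: isVar_def)
      next
        case 2
        then show ?thesis using Zero by simp
      next
        case 3
        then show ?thesis using IH[of t t'] Succ by simp
      next
        case 4
        then show ?thesis using IH[of p p'] Neg by simp
      next
        case 5
        then show ?thesis using IH[of c c'] IH[of d d'] Add Mul Eq Or by auto
      next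
        case 6
        then show ?thesis using Ex by blast
      next
        case 7
        then show ?thesis using IH[of p p'] Ex by simp
      qed
    qed
  qed
  then show ?thesis using sub by blast
qed

lemma sub_functional: "sub v r e e1 \<Longrightarrow> sub v r e e2 \<Longrightarrow> e1 = e2"
proof -
  assume sub: "sub v r e e1" "sub v r e e2"
  from sub(1) have "\<forall>e1 e2. sub v r e e1 \<longrightarrow> sub v r e e2 \<longrightarrow> e1 = e2"
    by (induction rule: sub_induct) ((intro definable_syntax)[1], auto split: if_splits)
  with sub show ?thesis by blast
qed

lemma sub_freeIn: "sub v r e e' \<Longrightarrow> freeIn w e' \<Longrightarrow> freeIn w e \<and> w \<noteq> v \<or> freeIn w r"
proof -
  assume sub: "sub v r e e'" and free: "freeIn w e'"
  from sub have "\<forall>e'. sub v r e e' \<longrightarrow> freeIn w e' \<longrightarrow> freeIn w e \<and> w \<noteq> v \<or> freeIn w r"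
    by (induction rule: sub_induct) ((intro definable_syntax)[1], auto split: if_splits)
  with sub free show ?thesis by blast
qed

lemma sub_depth: "sub v r e e' \<Longrightarrow> depth e n \<Longrightarrow> depth e' n"
proof -
  assume sub: "sub v r e e'" and d: "depth e n"
  have no: "\<not> depth (pair 0 i) m" "\<not> depth cZero m" "\<not> depth (cSucc t) m" "\<not> depth (cAdd t u) m"
    "\<not> depth (cMul t u) m" for i m t u :: 'a
    by (simp_all add: depth_unfold[of "pair _ _"])
  from sub have "\<forall>e' n. sub v r e e' \<longrightarrow> depth e n \<longrightarrow> depth e' n"
  proof (induction rule: sub_induct)
    case definable
    show ?case by (intro definable_syntax)
  next
    case (Or p q)
    show ?case by (auto, metis Or)
  qed (auto simp: no split: if_splits)
  with sub d show ?thesis by blast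
qed

text \<open>After the first substitution the variable \<open>v\<close> occurs free exactly at the positions of
  the new terms \<open>S v\<close>, and the second one turns these into \<open>S n\<close>.\<close>

lemma sub_cSucc_comp:
  assumes "isVar v" "sub v (cSucc v) e e1" "sub v n e1 e2"
  shows "sub v (cSucc n) e e2"
proof -
  obtain i where v: "v = pair 0 i" using assms(1) by (auto simp: isVar_def)
  from assms(2) have "\<forall>e1 e2. sub v (cSucc v) e e1 \<longrightarrow> sub v n e1 e2 \<longrightarrow> sub v (cSucc n) e e2"
    by (induction rule: sub_induct) ((intro definable_syntax)[1], auto simp: v split: if_splits)
  with assms show ?thesis by blast
qed

lemma isTerm_sub: "isTerm e \<Longrightarrow> isTerm r \<Longrightarrow> \<exists>e'. sub v r e e' \<and> isTerm e'"
proof -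
  assume e: "isTerm e" and r: "isTerm r"
  have "isTerm e \<longrightarrow> (\<exists>e'. sub v r e e' \<and> isTerm e')"
  proof (rule pa_less_induct[of "\<lambda>e. isTerm e \<longrightarrow> (\<exists>e'. sub v r e e' \<and> isTerm e')"],
      (intro definable_syntax)[1], intro impI)
    fix e assume IH: "\<And>d. d < e \<Longrightarrow> isTerm d \<longrightarrow> (\<exists>d'. sub v r d d' \<and> isTerm d')"
    assume "isTerm e"
    then consider i where "e = pair 0 i" | "e = cZero" | t where "isTerm t" "e = cSucc t"
      | t u where "isTerm t" "isTerm u" "e = cAdd t u \<or> e = cMul t u"
      unfolding isTerm_unfold[of e] isVar_def by blast
    then show "\<exists>e'. sub v r e e' \<and> isTerm e'"
    proof cases
      case 1
      then show ?thesis using r by simp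
    next
      case 2
      then show ?thesis by simp
    next
      case 3
      then show ?thesis using IH[of t] by auto
    next
      case 4
      then obtain t' u' where "sub v r t t'" "isTerm t'" "sub v r u u'" "isTerm u'"
        using IH[of t] IH[of u] by auto
      with 4(3) show ?thesis
        by (elim disjE) (rule exI[of _ "cAdd t' u'"], auto, rule exI[of _ "cMul t' u'"], auto)
    qed
  qed
  with e show ?thesis by blast
qed

lemma isFm_cases [consumes 1, case_names Eq Neg Or Ex]:
  assumes "isFm p"
  obtains t u where "p = cEq t u" "isTerm t" "isTerm u" | q where "p = cNeg q" "isFm q"
    | q q' where "p = cOr q q'" "isFm q" "isFm q'" | v q where "p = cEx v q" "isVar v" "isFm q"
  using assms unfolding isFm_unfold[of p] by blast

lemma isFm_induct [consumes 1, case_names definable Eq Neg Or Ex]: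
  assumes p: "isFm p" and P: "definable (\<lambda>e. P (e 0))"
    and Eq: "\<And>t u. isTerm t \<Longrightarrow> isTerm u \<Longrightarrow> P (cEq t u)" and Neg: "\<And>p. P p \<Longrightarrow> P (cNeg p)"
    and Or: "\<And>p q. P p \<Longrightarrow> P q \<Longrightarrow> P (cOr p q)"
    and Ex: "\<And>v p. isVar v \<Longrightarrow> isFm p \<Longrightarrow> P p \<Longrightarrow> P (cEx v p)"
  shows "P p"
proof -
  have "isFm p \<longrightarrow> P p"
  proof (rule pa_less_induct[of "\<lambda>p. isFm p \<longrightarrow> P p"])
    show "definable (\<lambda>e. isFm (e 0) \<longrightarrow> P (e 0))"
      by (intro definable_syntax P)
    fix p assume IH: "\<And>q. q < p \<Longrightarrow> isFm q \<longrightarrow> P q"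
    show "isFm p \<longrightarrow> P p"
    proof
      assume "isFm p"
      then show "P p"
        by (cases rule: isFm_cases) (use IH Eq Neg Or Ex in auto)
    qed
  qed
  with p show ?thesis by blast
qed

lemma isFm_sub: "isFm e \<Longrightarrow> isTerm r \<Longrightarrow> \<exists>e'. sub v r e e' \<and> isFm e'"
proof (induction rule: isFm_induct)
  case definable
  show ?case by (intro definable_syntax)
next
  case (Eq t u)
  then obtain t' u' where "sub v r t t'" "isTerm t'" "sub v r u u'" "isTerm u'"
    using isTerm_sub[of t r v] isTerm_sub[of u r v] \<open>isTerm r\<close> by blast
  then show ?case by (intro exI[of _ "cEq t' u'"]) auto
next
  case (Neg p)
  then show ?case by auto
next
  case (Or p q)
  then obtain p' q' where "sub v r p p'" "isFm p'" "sub v r q q'" "isFm q'" by blast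
  then show ?case by (intro exI[of _ "cOr p' q'"]) auto
next
  case (Ex w p)
  then obtain p' where "sub v r p p'" "isFm p'" by blast
  with Ex show ?case by (intro exI[of _ "if w = v then cEx w p else cEx w p'"]) auto
qed

text \<open>Every constructor of formulae strictly increases the code, and raises the depth by one.
  This is how a segment that contains the code of a formula also bounds its depth.\<close>

lemma ex_depth_le: "isFm p \<Longrightarrow> \<exists>n. depth p n \<and> n \<le> p"
proof (induction rule: isFm_induct)
  case definable
  show ?case by (intro definable_syntax)
next
  case (Eq t u)
  then show ?case by simp
next
  case (Neg p)
  then obtain n where "depth p n" "n \<le> p" by blast
  then show ?case by (intro exI[of _ "n + 1"]) (auto simp: add_1_le_iff intro: le_less_trans)
next
  case (Or p q)
  then obtain m n where "depth p m" "m \<le> p" "depth q n" "n \<le> q" by blast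
  then show ?case
    by (intro exI[of _ "max m n + 1"]) (auto simp: add_1_le_iff intro: le_less_trans)
next
  case (Ex v p)
  then obtain n where "depth p n" "n \<le> p" by blast
  then show ?case by (intro exI[of _ "n + 1"]) (auto simp: add_1_le_iff intro: le_less_trans)
qed

definition closedTerm :: "'a::pa_model \<Rightarrow> bool" where
  "closedTerm t \<longleftrightarrow> isTerm t \<and> (\<forall>v. \<not> freeIn v t)"

definition sentence :: "'a::pa_model \<Rightarrow> bool" where
  "sentence p \<longleftrightarrow> isFm p \<and> (\<forall>v. \<not> freeIn v p)"

definition isFm1 :: "'a::pa_model \<Rightarrow> 'a \<Rightarrow> bool" where
  "isFm1 v p \<longleftrightarrow> isVar v \<and> isFm p \<and> (\<forall>w. freeIn w p \<longrightarrow> w = v)"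

lemma ex1_numeralOf: "\<exists>!n. numeralOf x n"
proof -
  have "\<exists>n. \<forall>m. numeralOf x m \<longleftrightarrow> m = n"
    by (rule pa_induct[of "\<lambda>x. \<exists>n. \<forall>m. numeralOf x m \<longleftrightarrow> m = n"],
        (intro definable_syntax)[1]) auto
  then show ?thesis by metis
qed

lemma numeralOf_closedTerm: "numeralOf x n \<Longrightarrow> closedTerm n"
proof -
  assume n: "numeralOf x n"
  have "\<forall>n. numeralOf x n \<longrightarrow> isTerm n \<and> (\<forall>v. \<not> freeIn v n)"
    by (rule pa_induct[of "\<lambda>x. \<forall>n. numeralOf x n \<longrightarrow> isTerm n \<and> (\<forall>v. \<not> freeIn v n)"],
        (intro definable_syntax)[1]) auto
  with n show ?thesis unfolding closedTerm_def by blast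
qed

definition subNum :: "'a::pa_model \<Rightarrow> 'a \<Rightarrow> 'a \<Rightarrow> 'a \<Rightarrow> bool" where
  "subNum v x p e \<longleftrightarrow> (\<exists>n. numeralOf x n \<and> sub v n p e)"

text \<open>The code of \<open>\<phi>(x)\<close>, as a function; it is meaningful for formulae only, where substitution is total
  (\<open>subNum_iff\<close>).\<close>

definition numInst :: "'a::pa_model \<Rightarrow> 'a \<Rightarrow> 'a \<Rightarrow> 'a" where
  "numInst v x p = (THE e. subNum v x p e)"

lemma subNum_functional: "subNum v x p e \<Longrightarrow> subNum v x p e' \<Longrightarrow> e = e'"
  unfolding subNum_def using ex1_numeralOf sub_functional by blast

lemma numInst_eq: "subNum v x p e \<Longrightarrow> numInst v x p = e"
  unfolding numInst_def using subNum_functional by blast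

lemma isFm_subNum: "isFm p \<Longrightarrow> \<exists>e. subNum v x p e \<and> isFm e"
  unfolding subNum_def
  using ex1_numeralOf[of x] isFm_sub[of p] numeralOf_closedTerm unfolding closedTerm_def by metis

lemma subNum_iff: "isFm p \<Longrightarrow> subNum v x p e \<longleftrightarrow> e = numInst v x p"
  using isFm_subNum numInst_eq by metis

lemma sentence_numInst: "isFm1 v p \<Longrightarrow> sentence (numInst v x p)"
proof -
  assume p: "isFm1 v p"
  then obtain e where e: "subNum v x p e" "isFm e" using isFm_subNum unfolding isFm1_def by blast
  then have "\<not> freeIn w e" for w
    using p sub_freeIn[of v _ p e w] numeralOf_closedTerm
    unfolding subNum_def closedTerm_def isFm1_def by blast
  with e show ?thesis unfolding sentence_def numInst_eq[OF e(1)] by simp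
qed

lemma depth_numInst: "isFm p \<Longrightarrow> depth p n \<Longrightarrow> depth (numInst v x p) n"
  using isFm_subNum[of p v x] numInst_eq sub_depth unfolding subNum_def by metis

lemma numInst_cNeg: "isFm p \<Longrightarrow> numInst v x (cNeg p) = cNeg (numInst v x p)"
  using isFm_subNum[of p v x] numInst_eq[of v x p] by (intro numInst_eq) (auto simp: subNum_def)

lemma numInst_cOr: "isFm p \<Longrightarrow> isFm q \<Longrightarrow> numInst v x (cOr p q) = cOr (numInst v x p) (numInst v x q)"
proof -
  assume "isFm p" "isFm q"
  then obtain p' q' where *: "subNum v x p p'" "subNum v x q q'"
    using isFm_subNum by blast
  then obtain n where "numeralOf x n" "sub v n p p'" "sub v n q q'"
    unfolding subNum_def using ex1_numeralOf[of x] by blast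
  then have "subNum v x (cOr p q) (cOr p' q')" by (auto simp: subNum_def)
  with * show ?thesis using numInst_eq by metis
qed

lemma numInst_0: "isFm p \<Longrightarrow> sub v cZero p e \<longleftrightarrow> e = numInst v 0 p"
  using subNum_iff[of p v 0 e] by (simp add: subNum_def)

lemma numInst_sub_cSucc:
  assumes "isVar v" "isFm p" "sub v (cSucc v) p p'" "isFm p'"
  shows "numInst v x p' = numInst v (x + 1) p"
proof -
  obtain e where e: "subNum v x p' e" using isFm_subNum[OF assms(4)] by blast
  then have "subNum v (x + 1) p e"
    unfolding subNum_def using sub_cSucc_comp[OF assms(1,3)] by auto
  with e show ?thesis using numInst_eq by metis
qed

section \<open>The arithmetized notions in a model\<close>

text \<open>Every formula of arithmetized syntax is evaluated once. Used as simplification rules, these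
  equations translate the axioms and the claims into statements about \<open>tr\<close> and codes.\<close>

lemma val_num [simp]: "val e (num n) = of_nat n"
  by (induction n) (simp_all add: num_def add.commute)

lemma holds_Le [simp]: "holds e (Le t u) \<longleftrightarrow> val e t \<le> val e u"
  unfolding Le_def pa_le_def by (simp add: sat_inst) metis

lemma holds_Lt [simp]: "holds e (Lt t u) \<longleftrightarrow> val e t < val e u"
  unfolding Lt_def by (simp add: add_1_le_iff)

lemma holds_CPair [simp]: "holds e (CPair x y z) \<longleftrightarrow> val e z = pair (val e x) (val e y)"
  unfolding CPair_def pair_iff by simp

lemma holds_Elem [simp]: "holds e (Elem x s) \<longleftrightarrow> mem (val e x) (val e s)"
  unfolding Elem_def mem_def by (simp add: sat_inst; blast)

lemma holds_PairElem [simp]: "holds e (PairElem x y s) \<longleftrightarrow> mem (pair (val e x) (val e y)) (val e s)"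
  unfolding PairElem_def by (simp add: sat_inst)

lemma holds_Triple [simp]:
  "holds e (Triple x y z w) \<longleftrightarrow> val e w = pair (val e x) (pair (val e y) (val e z))"
  unfolding Triple_def by (simp add: sat_inst)

lemma holds_TripleElem [simp]:
  "holds e (TripleElem x y z s) \<longleftrightarrow> mem (pair (val e x) (pair (val e y) (val e z))) (val e s)"
  unfolding TripleElem_def by (simp add: sat_inst)

lemma holds_constructors [simp]:
  "holds e (CZero u) \<longleftrightarrow> val e u = cZero"
  "holds e (CSucc t u) \<longleftrightarrow> val e u = cSucc (val e t)"
  "holds e (CAdd s t u) \<longleftrightarrow> val e u = cAdd (val e s) (val e t)"
  "holds e (CMul s t u) \<longleftrightarrow> val e u = cMul (val e s) (val e t)"
  "holds e (CEq s t u) \<longleftrightarrow> val e u = cEq (val e s) (val e t)"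
  "holds e (CNeg t u) \<longleftrightarrow> val e u = cNeg (val e t)"
  "holds e (COr s t u) \<longleftrightarrow> val e u = cOr (val e s) (val e t)"
  "holds e (CEx s t u) \<longleftrightarrow> val e u = cEx (val e s) (val e t)"
  unfolding CZero_def CSucc_def CAdd_def CMul_def CEq_def CNeg_def COr_def CEx_def by simp_all

lemma holds_CImp [simp]: "holds e (CImp p q u) \<longleftrightarrow> val e u = cImp (val e p) (val e q)"
  unfolding CImp_def by (simp add: sat_inst)

lemma holds_CAll [simp]: "holds e (CAll v p u) \<longleftrightarrow> val e u = cAll (val e v) (val e p)"
  unfolding CAll_def by (simp add: sat_inst)

lemma holds_IsVar [simp]: "holds e (IsVar x) \<longleftrightarrow> isVar (val e x)"
  unfolding IsVar_def isVar_def by (simp add: sat_inst)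

lemma holds_IsTerm [simp]: "holds e (IsTerm x) \<longleftrightarrow> isTerm (val e x)"
  unfolding IsTerm_def isTerm_def Gen_def gen_def by (simp add: sat_inst)

lemma holds_IsFm [simp]: "holds e (IsFm x) \<longleftrightarrow> isFm (val e x)"
  unfolding IsFm_def isFm_def Gen_def gen_def by (simp add: sat_inst)

lemma holds_FreeIn [simp]: "holds e (FreeIn v x) \<longleftrightarrow> freeIn (val e v) (val e x)"
  unfolding FreeIn_def freeIn_def Gen_def gen_def by (simp add: sat_inst)

lemma holds_ClosedTerm [simp]: "holds e (ClosedTerm x) \<longleftrightarrow> closedTerm (val e x)"
  unfolding ClosedTerm_def closedTerm_def by (simp add: sat_inst)

lemma holds_Sentence [simp]: "holds e (Sentence x) \<longleftrightarrow> sentence (val e x)"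
  unfolding Sentence_def sentence_def by (simp add: sat_inst)

lemma holds_IsFm1 [simp]: "holds e (IsFm1 v p) \<longleftrightarrow> isFm1 (val e v) (val e p)"
  unfolding IsFm1_def isFm1_def by (auto simp: sat_inst)

text \<open>After simplification, the rule and its semantic counterpart differ in the scopes of quantifiers
  only. They are matched connective by connective, which leaves small goals.\<close>

lemma holds_Sub [simp]: "holds e (Sub v r x y) \<longleftrightarrow> sub (val e v) (val e r) (val e x) (val e y)"
  unfolding Sub_def sub_def Gen_def gen_def by (simp add: sat_inst del: ex_simps;
      intro ex_cong1 conj_cong[OF refl] all_cong1 imp_cong[OF refl] arg_cong2[where f = disj]; blast)

lemma holds_Numeral [simp]: "holds e (Numeral x n) \<longleftrightarrow> numeralOf (val e x) (val e n)"
  unfolding Numeral_def numeralOf_def Gen_def gen_def by (simp add: sat_inst del: ex_simps;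
      intro ex_cong1 conj_cong[OF refl] all_cong1 imp_cong[OF refl] arg_cong2[where f = disj]; blast)

lemma holds_Depth [simp]: "holds e (Depth p n) \<longleftrightarrow> depth (val e p) (val e n)"
  unfolding Depth_def depth_def Gen_def gen_def by (simp add: sat_inst del: ex_simps;
      intro ex_cong1 conj_cong[OF refl] all_cong1 imp_cong[OF refl] arg_cong2[where f = disj]; blast)

definition hasVal :: "'a::pa_model \<Rightarrow> 'a \<Rightarrow> bool" where
  "hasVal t y \<longleftrightarrow> gen (\<lambda>A x. \<exists>t y. x = pair t y \<and>
     ((t = cZero \<and> y = 0)
      \<or> (\<exists>u z. A (pair u z) \<and> t = cSucc u \<and> y = z + 1)
      \<or> (\<exists>u z u' z'. A (pair u z) \<and> A (pair u' z') \<and>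
           ((t = cAdd u u' \<and> y = z + z') \<or> (t = cMul u u' \<and> y = z * z'))))) (pair t y)"

definition eqVal :: "'a::pa_model \<Rightarrow> 'a \<Rightarrow> bool" where
  "eqVal s t \<longleftrightarrow> (\<exists>y. hasVal s y \<and> hasVal t y)"

lemma holds_Val [simp]: "holds e (Val t y) \<longleftrightarrow> hasVal (val e t) (val e y)"
  unfolding Val_def hasVal_def Gen_def gen_def by (simp add: sat_inst del: ex_simps;
      intro ex_cong1 conj_cong[OF refl] all_cong1 imp_cong[OF refl] arg_cong2[where f = disj]; blast)

lemma holds_EqVal [simp]: "holds e (EqVal s t) \<longleftrightarrow> eqVal (val e s) (val e t)"
  unfolding EqVal_def eqVal_def by (simp add: sat_inst)

definition depthLe :: "'a::pa_model \<Rightarrow> 'a \<Rightarrow> bool" where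
  "depthLe p y \<longleftrightarrow> (\<exists>n. depth p n \<and> n \<le> y)"

lemma holds_DepthLe [simp]: "holds e (DepthLe p y) \<longleftrightarrow> depthLe (val e p) (val e y)"
  unfolding DepthLe_def depthLe_def by (simp add: sat_inst)

lemma holds_CInd [simp]: "holds e (CInd v p x) \<longleftrightarrow>
    (\<exists>p' p0. sub (val e v) (cSucc (val e v)) (val e p) p' \<and> sub (val e v) cZero (val e p) p0 \<and>
      val e x = cImp (cAll (val e v) (cImp (val e p) p')) (cImp p0 (cAll (val e v) (val e p))))"
  unfolding CInd_def by (simp add: sat_inst; blast)

lemma holds_SubNum [simp]:
  "holds e (SubNum v x p u) \<longleftrightarrow> subNum (val e v) (val e x) (val e p) (val e u)"
  unfolding SubNum_def subNum_def by (simp add: sat_inst)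

lemma holds_truth [simp]:
  "holds e (TrEq s t) \<longleftrightarrow> tr (cEq (val e s) (val e t))"
  "holds e (TrNeg p) \<longleftrightarrow> tr (cNeg (val e p))"
  "holds e (TrOr p q) \<longleftrightarrow> tr (cOr (val e p) (val e q))"
  "holds e (TrEx v p) \<longleftrightarrow> tr (cEx (val e v) (val e p))"
  "holds e (TrSub v r p) \<longleftrightarrow> (\<exists>u. sub (val e v) (val e r) (val e p) u \<and> tr u)"
  "holds e (TrSubNum v x p) \<longleftrightarrow> (\<exists>u. subNum (val e v) (val e x) (val e p) u \<and> tr u)"
  "holds e (TrNegSubNum v x p) \<longleftrightarrow> (\<exists>u. subNum (val e v) (val e x) (val e p) u \<and> tr (cNeg u))"
  unfolding TrEq_def TrNeg_def TrOr_def TrEx_def TrSub_def TrSubNum_def TrNegSubNum_def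
  by (simp_all add: sat_inst)

definition isTot :: "'a::pa_model \<Rightarrow> bool" where
  "isTot p \<longleftrightarrow> (\<exists>v. isFm1 v p \<and> (\<forall>x. tr (numInst v x p) \<or> tr (cNeg (numInst v x p))))"

lemma ex_subNum_iff: "isFm p \<Longrightarrow> (\<exists>u. subNum v x p u \<and> Q u) \<longleftrightarrow> Q (numInst v x p)"
  by (simp add: subNum_iff)

lemma holds_tot [simp]: "holds e (tot p) \<longleftrightarrow> isTot (val e p)"
  unfolding tot_def isTot_def isFm1_def
  by (simp add: sat_inst isFm1_def ex_subNum_iff cong: conj_cong) blast

section \<open>Truth below a decided depth\<close>

text \<open>The extension of the initial segment \<open>D\<close>. As its definition mentions \<open>tr\<close>, induction in the
  model does not apply to it, and closure under successor does not make it the whole model.\<close>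

definition decided :: "'a::pa_model \<Rightarrow> bool" where
  "decided y \<longleftrightarrow> (\<forall>p. sentence p \<longrightarrow> depthLe p y \<longrightarrow> (tr p \<longleftrightarrow> \<not> tr (cNeg p)))"

lemma sentence_simps [simp]:
  "sentence (cNeg p) \<longleftrightarrow> sentence p"
  "sentence (cOr p q) \<longleftrightarrow> sentence p \<and> sentence q"
  "sentence (cEq s t) \<longleftrightarrow> closedTerm s \<and> closedTerm t"
  "sentence (cEx v p) \<longleftrightarrow> isFm1 v p"
  by (auto simp: sentence_def closedTerm_def isFm1_def)

lemma isFm1_sentence: "sentence p \<Longrightarrow> isVar v \<Longrightarrow> isFm1 v p"
  by (simp add: sentence_def isFm1_def)

lemma isFm1_isFm: "isFm1 v p \<Longrightarrow> isFm p"
  by (simp add: isFm1_def)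

lemma sentence_isFm: "sentence p \<Longrightarrow> isFm p"
  by (simp add: sentence_def)

lemma depthLe_mono: "depthLe p x \<Longrightarrow> x \<le> y \<Longrightarrow> depthLe p y"
  unfolding depthLe_def using order_trans by blast

lemma depthLe_self: "isFm p \<Longrightarrow> depthLe p p"
  unfolding depthLe_def by (rule ex_depth_le)

lemma depthLe_cNeg: "depthLe (cNeg p) (y + 1) \<longleftrightarrow> depthLe p y"
  and depthLe_cEx: "depthLe (cEx v p) (y + 1) \<longleftrightarrow> depthLe p y"
  unfolding depthLe_def by auto

lemma depthLe_cOr: "depthLe (cOr p q) (y + 1) \<longleftrightarrow> depthLe p y \<and> depthLe q y"
proof
  assume "depthLe p y \<and> depthLe q y"
  then obtain m n where "depth p m" "m \<le> y" "depth q n" "n \<le> y"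
    unfolding depthLe_def by blast
  then show "depthLe (cOr p q) (y + 1)"
    unfolding depthLe_def by (intro exI[of _ "max m n + 1"]) auto
qed (auto simp: depthLe_def)

lemma depthLe_numInst: "isFm p \<Longrightarrow> depthLe p y \<Longrightarrow> depthLe (numInst v x p) y"
  unfolding depthLe_def using depth_numInst by blast

lemma depthLe_sub: "sub v r p p' \<Longrightarrow> depthLe p y \<Longrightarrow> depthLe p' y"
  unfolding depthLe_def using sub_depth by blast

lemma decided_mono: "decided y \<Longrightarrow> x \<le> y \<Longrightarrow> decided x"
  unfolding decided_def using depthLe_mono by blast

definition compositional :: "'a::pa_model \<Rightarrow> bool" where
  "compositional x \<longleftrightarrow>
    (\<forall>s t. closedTerm s \<and> closedTerm t \<longrightarrow> x = cEq s t \<longrightarrow> (tr x \<longleftrightarrow> eqVal s t)) \<and>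
    (\<forall>p q. sentence p \<and> sentence q \<longrightarrow> x = cOr p q \<longrightarrow> (tr x \<longleftrightarrow> tr p \<or> tr q)) \<and>
    (\<forall>p. sentence p \<longrightarrow> x = cNeg p \<longrightarrow> (tr x \<longleftrightarrow> \<not> tr p)) \<and>
    (\<forall>v p. isFm1 v p \<longrightarrow> x = cEx v p \<longrightarrow> (tr x \<longleftrightarrow> (\<exists>z u. subNum v z p u \<and> tr u))) \<and>
    (\<forall>v. isFm1 v x \<longrightarrow> (\<forall>s t. closedTerm s \<and> closedTerm t \<longrightarrow> eqVal s t \<longrightarrow>
       ((\<exists>u. sub v s x u \<and> tr u) \<longleftrightarrow> (\<exists>u. sub v t x u \<and> tr u))))"

lemma holds_CC [simp]: "holds e (CC x) \<longleftrightarrow> compositional (val e x)"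
  unfolding CC_def compositional_def sat_inst sat_Conj sat_Forall sat_Imp
    iff_conv_conj_imp[symmetric]
  by (simp add: eval_nat_numeral)

context
  assumes WPT: "(self_interp :: 'a::pa_model interp) \<Turnstile> WPT"
begin

lemma holds_WPT: "\<phi> \<in> WPT \<Longrightarrow> holds (e :: nat \<Rightarrow> 'a) \<phi>"
  using WPT unfolding models_def by blast

lemma tr_Eq:
  fixes s t :: 'a
  assumes "closedTerm s" "closedTerm t"
  shows "tr (cEq s t) \<longleftrightarrow> eqVal s t"
proof -
  have "holds (\<lambda>_. 0 :: 'a) WPT_1a" by (rule holds_WPT) (simp add: WPT_def)
  then have "\<forall>s t :: 'a. closedTerm s \<and> closedTerm t \<longrightarrow> (tr (cEq s t) \<longleftrightarrow> eqVal s t)"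
    unfolding WPT_1a_def sat_Forall sat_Imp sat_Iff by simp
  then show ?thesis using assms by blast
qed

lemma tr_Neg_Eq:
  fixes s t :: 'a
  assumes "closedTerm s" "closedTerm t"
  shows "tr (cNeg (cEq s t)) \<longleftrightarrow> \<not> eqVal s t"
proof -
  have "holds (\<lambda>_. 0 :: 'a) WPT_1b" by (rule holds_WPT) (simp add: WPT_def)
  then have "\<forall>s t :: 'a. closedTerm s \<and> closedTerm t \<longrightarrow> (tr (cNeg (cEq s t)) \<longleftrightarrow> \<not> eqVal s t)"
    unfolding WPT_1b_def sat_Forall sat_Imp sat_Iff by simp
  then show ?thesis using assms by blast
qed

lemma tr_Or:
  fixes p q :: 'a
  assumes "sentence p" "sentence q"
  shows "tr (cOr p q) \<longleftrightarrow> isTot p \<and> isTot q \<and> (tr p \<or> tr q)"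
proof -
  have "holds (\<lambda>_. 0 :: 'a) WPT_2a" by (rule holds_WPT) (simp add: WPT_def)
  then have "\<forall>p q :: 'a. sentence p \<and> sentence q \<longrightarrow> (tr (cOr p q) \<longleftrightarrow> isTot p \<and> isTot q \<and> (tr p \<or> tr q))"
    unfolding WPT_2a_def sat_Forall sat_Imp sat_Iff by (simp add: conj_ac)
  then show ?thesis using assms by blast
qed

lemma tr_Neg_Or:
  fixes p q :: 'a
  assumes "sentence p" "sentence q"
  shows "tr (cNeg (cOr p q)) \<longleftrightarrow> tr (cNeg p) \<and> tr (cNeg q)"
proof -
  have "holds (\<lambda>_. 0 :: 'a) WPT_2b" by (rule holds_WPT) (simp add: WPT_def)
  then have "\<forall>p q :: 'a. sentence p \<and> sentence q \<longrightarrow> (tr (cNeg (cOr p q)) \<longleftrightarrow> tr (cNeg p) \<and> tr (cNeg q))"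
    unfolding WPT_2b_def sat_Forall sat_Imp sat_Iff by simp
  then show ?thesis using assms by blast
qed

lemma tr_Ex:
  fixes v p :: 'a
  assumes "isFm1 v p"
  shows "tr (cEx v p) \<longleftrightarrow> isTot p \<and> (\<exists>x. tr (numInst v x p))"
proof -
  have "holds (\<lambda>_. 0 :: 'a) WPT_3a" by (rule holds_WPT) (simp add: WPT_def)
  then have "\<forall>v p :: 'a. isFm1 v p \<longrightarrow> (tr (cEx v p) \<longleftrightarrow> isTot p \<and> (\<exists>x. \<exists>u. subNum v x p u \<and> tr u))"
    unfolding WPT_3a_def sat_Forall sat_Imp sat_Iff by simp
  then show ?thesis using assms by (simp add: ex_subNum_iff isFm1_isFm)
qed

lemma tr_Neg_Ex:
  fixes v p :: 'a
  assumes "isFm1 v p"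
  shows "tr (cNeg (cEx v p)) \<longleftrightarrow> (\<forall>x. tr (cNeg (numInst v x p)))"
proof -
  have "holds (\<lambda>_. 0 :: 'a) WPT_3b" by (rule holds_WPT) (simp add: WPT_def)
  then have "\<forall>v p :: 'a. isFm1 v p \<longrightarrow> (tr (cNeg (cEx v p)) \<longleftrightarrow> (\<forall>x. \<exists>u. subNum v x p u \<and> tr (cNeg u)))"
    unfolding WPT_3b_def sat_Forall sat_Imp sat_Iff by simp
  then show ?thesis using assms by (simp add: ex_subNum_iff isFm1_isFm)
qed

lemma tr_Neg_Neg:
  fixes p :: 'a
  assumes "sentence p"
  shows "tr (cNeg (cNeg p)) \<longleftrightarrow> tr p"
proof -
  have "holds (\<lambda>_. 0 :: 'a) WPT_4" by (rule holds_WPT) (simp add: WPT_def)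
  then have "\<forall>p :: 'a. sentence p \<longrightarrow> (tr (cNeg (cNeg p)) \<longleftrightarrow> tr p)"
    unfolding WPT_4_def sat_Forall sat_Imp sat_Iff by simp
  then show ?thesis using assms by blast
qed

lemma tr_sub_cong:
  fixes v p s t :: 'a
  assumes "isFm1 v p" "closedTerm s" "closedTerm t" "eqVal s t"
  shows "(\<exists>u. sub v s p u \<and> tr u) \<longleftrightarrow> (\<exists>u. sub v t p u \<and> tr u)"
proof -
  have "holds (\<lambda>_. 0 :: 'a) WPT_5" by (rule holds_WPT) (simp add: WPT_def)
  then have "\<forall>v p s t :: 'a. isFm1 v p \<and> closedTerm s \<and> closedTerm t \<and> eqVal s t \<longrightarrow> ((\<exists>u. sub v s p u \<and> tr u) \<longleftrightarrow> (\<exists>u. sub v t p u \<and> tr u))"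
    unfolding WPT_5_def sat_Forall sat_Imp sat_Iff by (simp add: eval_nat_numeral)
  then show ?thesis using assms by blast
qed

subsection \<open>Classical compositionality\<close>

text \<open>Instances of a formula have the depth of that formula, so below a decided depth the typing
  conditions are met and disappear from the axioms.\<close>

lemma decided_isTot:
  assumes "decided y" "isFm1 v (p :: 'a)" "depthLe p y"
  shows "isTot p"
  using assms sentence_numInst depthLe_numInst[OF isFm1_isFm] unfolding isTot_def decided_def by blast

lemma decided_sentence_isTot: "decided y \<Longrightarrow> sentence (p :: 'a) \<Longrightarrow> depthLe p y \<Longrightarrow> isTot p"
  using decided_isTot[of y "pair 0 0" p] isFm1_sentence[of p "pair 0 0"] by simp

lemma decided_tr_Neg: "decided y \<Longrightarrow> sentence (p :: 'a) \<Longrightarrow> depthLe p y \<Longrightarrow> tr (cNeg p) \<longleftrightarrow> \<not> tr p"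
  unfolding decided_def by blast

lemma decided_tr_Or:
  "decided y \<Longrightarrow> sentence (p :: 'a) \<Longrightarrow> sentence q \<Longrightarrow> depthLe p y \<Longrightarrow> depthLe q y \<Longrightarrow>
   tr (cOr p q) \<longleftrightarrow> tr p \<or> tr q"
  using tr_Or decided_sentence_isTot by blast

lemma decided_tr_Ex:
  "decided y \<Longrightarrow> isFm1 v (p :: 'a) \<Longrightarrow> depthLe p y \<Longrightarrow> tr (cEx v p) \<longleftrightarrow> (\<exists>x. tr (numInst v x p))"
  using tr_Ex decided_isTot by blast

lemma decided_0: "decided (0 :: 'a)"
  unfolding decided_def
proof (intro allI impI)
  fix p :: 'a assume p: "sentence p" "depthLe p 0"
  from p(2) have "depth p 0" unfolding depthLe_def by simp
  from sentence_isFm[OF p(1)] this obtain s t where "p = cEq s t"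
    by (cases rule: isFm_cases) (auto simp: pa_add_1_neq_0[THEN not_sym])
  with p(1) show "tr p \<longleftrightarrow> \<not> tr (cNeg p)"
    using tr_Eq tr_Neg_Eq by simp
qed

text \<open>For a sentence of depth at most \<open>y + 1\<close>, the negative axioms dualize the positive ones: both sides
  are expressed by truth of immediate subsentences or of instances and their negations, and these
  are decided because their depth is at most \<open>y\<close>.\<close>

lemma decided_add_1:
  assumes y: "decided (y :: 'a)"
  shows "decided (y + 1)"
  unfolding decided_def
proof (intro allI impI)
  fix p :: 'a assume p: "sentence p" "depthLe p (y + 1)"
  from sentence_isFm[OF p(1)] show "tr p \<longleftrightarrow> \<not> tr (cNeg p)"
  proof (cases rule: isFm_cases)
    case (Eq s t)
    with p(1) show ?thesis using tr_Eq tr_Neg_Eq by simp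
  next
    case (Neg q)
    with p y show ?thesis using tr_Neg_Neg decided_tr_Neg by (simp add: depthLe_cNeg)
  next
    case (Or q q')
    with p y show ?thesis
      using tr_Neg_Or decided_tr_Or decided_tr_Neg by (simp add: depthLe_cOr)
  next
    case (Ex v q)
    with p have q: "isFm1 v q" "depthLe q y" by (simp_all add: depthLe_cEx)
    then have "tr (cNeg (numInst v x q)) \<longleftrightarrow> \<not> tr (numInst v x q)" for x
      using decided_tr_Neg[OF y] sentence_numInst depthLe_numInst isFm1_isFm by blast
    then show ?thesis
      unfolding Ex using tr_Neg_Ex decided_tr_Ex[OF y] q by simp
  qed
qed

lemma decided_compositional:
  assumes y: "decided (y :: 'a)" and p: "depthLe x y"
  shows "compositional x"
proof -
  have p1: "depthLe p y" "depthLe q y" if "x = cOr p q" for p q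
    using p that depthLe_mono[of x y "y + 1"] unfolding that by (simp_all add: depthLe_cOr)
  have p2: "depthLe p y" if "x = cNeg p" for p
    using p that depthLe_mono[of x y "y + 1"] unfolding that by (simp add: depthLe_cNeg)
  have p3: "depthLe p y" if "x = cEx v p" for v p
    using p that depthLe_mono[of x y "y + 1"] unfolding that by (simp add: depthLe_cEx)
  have 1: "tr x \<longleftrightarrow> eqVal s t" if "closedTerm s" "closedTerm t" "x = cEq s t" for s t
    using tr_Eq that by simp
  have 2: "tr x \<longleftrightarrow> tr p \<or> tr q" if "sentence p" "sentence q" "x = cOr p q" for p q
    using decided_tr_Or[OF y] p1 that by simp
  have 3: "tr x \<longleftrightarrow> \<not> tr p" if "sentence p" "x = cNeg p" for p
    using decided_tr_Neg[OF y] p2 that by simp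
  have 4: "tr x \<longleftrightarrow> (\<exists>z. \<exists>u. subNum v z p u \<and> tr u)" if "isFm1 v p" "x = cEx v p" for v p
    using decided_tr_Ex[OF y] p3 that by (simp add: ex_subNum_iff isFm1_isFm)
  have 5: "(\<exists>u. sub v s x u \<and> tr u) \<longleftrightarrow> (\<exists>u. sub v t x u \<and> tr u)"
    if "isFm1 v x" "closedTerm s" "closedTerm t" "eqVal s t" for v s t
    using tr_sub_cong that by blast
  show ?thesis
    unfolding compositional_def by (intro conjI allI impI) (use 1 2 3 4 5 in blast)+
qed

subsection \<open>Truth of induction\<close>

text \<open>The axioms for negated existential quantifiers and for double negation carry no typing condition,
  so truth commutes with \<open>\<forall>\<close> at every depth.\<close>

lemma tr_All: "isFm1 v (p :: 'a) \<Longrightarrow> tr (cAll v p) \<longleftrightarrow> (\<forall>x. tr (numInst v x p))"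
proof -
  assume p: "isFm1 v p"
  then have "isFm1 v (cNeg p)" by (simp add: isFm1_def)
  then show ?thesis
    using p by (simp add: tr_Neg_Ex numInst_cNeg isFm1_isFm tr_Neg_Neg[OF sentence_numInst])
qed

lemma decided_tr_Imp:
  "decided (y :: 'a) \<Longrightarrow> sentence p \<Longrightarrow> sentence q \<Longrightarrow> depthLe p y \<Longrightarrow> depthLe q y \<Longrightarrow>
   tr (cImp p q) \<longleftrightarrow> (tr p \<longrightarrow> tr q)"
  using decided_tr_Or[OF decided_add_1, of y "cNeg p" q] decided_tr_Neg[of y p]
    depthLe_mono[of q y "y + 1"] by (simp add: depthLe_cNeg)

lemma depthLe_cImp: "depthLe p y \<Longrightarrow> depthLe q y \<Longrightarrow> depthLe (cImp p q) (y + 1 + 1)"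
  using depthLe_mono[of q y "y + 1"] by (simp add: depthLe_cNeg depthLe_cOr)

lemma depthLe_cAll: "depthLe p y \<Longrightarrow> depthLe (cAll v p) (y + 1 + 1 + 1)"
  by (simp add: depthLe_cNeg depthLe_cEx)

text \<open>With \<open>p'\<close> for \<open>\<phi>(S v)\<close> and \<open>p0\<close> for \<open>\<phi>(0)\<close>, truth of \<open>ind(\<phi>)\<close> unfolds by classical
  compositionality to the hypothesis \<open>INT\<close>, because \<open>(\<phi>(S v))(x)\<close> and \<open>\<phi>(x + 1)\<close> are the same
  sentence.\<close>

lemma induction_true_if_decided:
  fixes v p :: 'a
  assumes INT: "\<And>v p :: 'a. isFm1 v p \<Longrightarrow> (\<forall>x. tr (numInst v x p) \<longrightarrow> tr (numInst v (x + 1) p)) \<Longrightarrow>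
      tr (numInst v 0 p) \<Longrightarrow> \<forall>x. tr (numInst v x p)"
    and p: "isFm1 v p" and y: "decided p"
  shows "\<exists>p' p0. sub v (cSucc v) p p' \<and> sub v cZero p p0 \<and>
    tr (cImp (cAll v (cImp p p')) (cImp p0 (cAll v p)))"
proof -
  have fm: "isFm p" "isVar v" using p by (simp_all add: isFm1_def)
  have "isTerm (cSucc v)" using fm(2) by (auto simp: isVar_def)
  then obtain p' where p': "sub v (cSucc v) p p'" "isFm p'" using isFm_sub[OF fm(1)] by blast
  have "w = v" if "freeIn w p'" for w
    using sub_freeIn[OF p'(1) that] p fm(2) by (auto simp: isFm1_def isVar_def)
  then have fm1: "isFm1 v p'" using p' fm by (simp add: isFm1_def)
  let ?imp = "cImp p p'" and ?p0 = "numInst v 0 p"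
  have imp: "isFm1 v ?imp" using p fm1 by (auto simp: isFm1_def)
  \<comment> \<open>An implication adds at most two to the depth and a universal quantifier three. So antecedent
    and consequent of \<open>ind(\<phi>)\<close> have depth at most \<open>p + 5\<close>, as \<open>\<phi>\<close> has depth at most \<open>p\<close>.\<close>
  let ?d = "\<lambda>y. y + 1 + 1"
  let ?y = "?d (?d p) + 1"
  have le: "p \<le> ?y" "?d p \<le> ?y" "p + 1 + 1 + 1 \<le> ?y"
    by (simp_all add: add.assoc)
  have y': "decided p" "decided ?y" by (intro decided_add_1 y)+
  have d: "depthLe p p" using depthLe_self[OF fm(1)] .
  then have d': "depthLe p' p" "depthLe ?p0 p"
    using depthLe_sub[OF p'(1)] depthLe_numInst[OF fm(1)] by simp_all
  have dA: "depthLe (cAll v ?imp) ?y"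
    using depthLe_cAll[OF depthLe_cImp[OF d d'(1)]] by simp
  have dC: "depthLe (cAll v p) (p + 1 + 1 + 1)"
    using depthLe_cAll[OF d] .
  then have dBC: "depthLe (cImp ?p0 (cAll v p)) ?y"
    using depthLe_cImp[of ?p0 "p + 1 + 1 + 1" "cAll v p"] depthLe_mono[OF d'(2)] by (simp add: add.assoc)
  have s: "sentence ?p0" "sentence (cAll v p)" "sentence (cAll v ?imp)"
    using sentence_numInst[OF p] p imp by (simp_all add: isFm1_def)
  have tr_BC: "tr (cImp ?p0 (cAll v p)) \<longleftrightarrow> (tr ?p0 \<longrightarrow> tr (cAll v p))"
    by (rule decided_tr_Imp[OF y'(2) s(1,2) depthLe_mono[OF d'(2) le(1)] depthLe_mono[OF dC le(3)]])
  have "tr (cImp (cAll v ?imp) (cImp ?p0 (cAll v p))) \<longleftrightarrow>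
      (tr (cAll v ?imp) \<longrightarrow> tr (cImp ?p0 (cAll v p)))"
    by (rule decided_tr_Imp[OF y'(2) s(3) _ dA dBC]) (use s in simp)
  moreover have "tr (cAll v ?imp) \<longleftrightarrow> (\<forall>x. tr (numInst v x p) \<longrightarrow> tr (numInst v (x + 1) p))"
  proof -
    have "tr (numInst v x ?imp) \<longleftrightarrow> (tr (numInst v x p) \<longrightarrow> tr (numInst v (x + 1) p))" for x
      using decided_tr_Imp[OF y'(1) sentence_numInst[OF p] sentence_numInst[OF fm1]
          depthLe_numInst[OF fm(1) d] depthLe_numInst[OF p'(2) d'(1)]] numInst_sub_cSucc[OF fm(2,1) p']
      by (simp add: numInst_cOr numInst_cNeg fm p')
    then show ?thesis unfolding tr_All[OF imp] by simp
  qed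
  ultimately have "tr (cImp (cAll v ?imp) (cImp ?p0 (cAll v p)))"
    using INT[OF p] tr_All[OF p] tr_BC by blast
  then show ?thesis using p'(1) numInst_0[OF fm(1)] by blast
qed

end

section \<open>The formula \<open>D\<close>\<close>

text \<open>All variables but \<open>\<^bold>v0\<close> are replaced by \<open>0\<close>, which does not change the meaning and makes it
  evident that no other variable is free.\<close>

definition Decided :: fm where
  "Decided = subst
     (\<^bold>\<forall>1. Sentence \<^bold>v1 \<^bold>\<longrightarrow> DepthLe \<^bold>v1 \<^bold>v0 \<^bold>\<longrightarrow> (Tr \<^bold>v1 \<^bold>\<longleftrightarrow> \<^bold>\<not> TrNeg \<^bold>v1))
     (\<lambda>i. if i = 0 then \<^bold>v0 else Zero)"

lemma fv_Decided: "fv Decided \<subseteq> {0}"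
  unfolding Decided_def by (rule order_trans[OF fv_subst_subset]) (auto split: if_splits simp del: fv.simps)

lemma holds_Decided: "holds e (inst Decided [t]) \<longleftrightarrow> decided (val e t)"
  unfolding Decided_def decided_def sat_inst sat_subst sat_Forall sat_Imp
  by simp blast

text \<open>Collecting the claims about each theory in a set allows a single structure to be a
  counterexample to any of them.\<close>

definition segment_claims :: "fm set" where
  "segment_claims =
     {\<^bold>\<forall>0. inst Decided [\<^bold>v0] \<^bold>\<longrightarrow> (\<^bold>\<forall>1. Le \<^bold>v1 \<^bold>v0 \<^bold>\<longrightarrow> inst Decided [\<^bold>v1]),
      inst Decided [Zero] \<^bold>\<and> (\<^bold>\<forall>0. inst Decided [\<^bold>v0] \<^bold>\<longrightarrow> inst Decided [Succ \<^bold>v0])}"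

definition WPT_claims :: "fm set" where
  "WPT_claims = segment_claims \<union>
     {\<^bold>\<forall>0. inst Decided [\<^bold>v0] \<^bold>\<longrightarrow> (\<^bold>\<forall>1. IsFm \<^bold>v1 \<^bold>\<longrightarrow> DepthLe \<^bold>v1 \<^bold>v0 \<^bold>\<longrightarrow> CC \<^bold>v1)}"

definition WPT_INT_claims :: "fm set" where
  "WPT_INT_claims = segment_claims \<union>
     {\<^bold>\<forall>0. \<^bold>\<forall>1. IsFm1 \<^bold>v0 \<^bold>v1 \<^bold>\<longrightarrow> inst Decided [\<^bold>v1] \<^bold>\<longrightarrow> (\<^bold>\<exists>2. CInd \<^bold>v0 \<^bold>v1 \<^bold>v2 \<^bold>\<and> Tr \<^bold>v2)}"

lemma models_segment_claims:
  assumes "(self_interp :: 'a::pa_model interp) \<Turnstile> WPT"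
  shows "(self_interp :: 'a interp) \<Turnstile> segment_claims"
  using decided_0[OF assms] decided_add_1[OF assms]
  unfolding models_def segment_claims_def
  by (auto simp: holds_Decided intro: decided_mono)

lemma models_WPT_claims:
  assumes "(self_interp :: 'a::pa_model interp) \<Turnstile> WPT"
  shows "(self_interp :: 'a interp) \<Turnstile> WPT_claims"
  using models_segment_claims[OF assms] decided_compositional[OF assms]
  unfolding models_def WPT_claims_def by (auto simp: holds_Decided)

lemma models_WPT_INT_claims:
  assumes "(self_interp :: 'a::pa_model interp) \<Turnstile> WPT \<union> {INT_ax}"
  shows "(self_interp :: 'a interp) \<Turnstile> WPT_INT_claims"
proof -
  have WPT: "(self_interp :: 'a interp) \<Turnstile> WPT" and INT: "holds (\<lambda>_. 0 :: 'a) INT_ax"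
    using assms by (simp_all add: models_def)
  have "holds (\<lambda>_. 0 :: 'a) INT_ax \<longleftrightarrow> (\<forall>v p :: 'a. isFm1 v p \<longrightarrow>
      (\<forall>x. (\<exists>u. subNum v x p u \<and> tr u) \<longrightarrow> (\<exists>u. subNum v (x + 1) p u \<and> tr u)) \<longrightarrow>
      (\<exists>u. subNum v 0 p u \<and> tr u) \<longrightarrow> (\<forall>x. \<exists>u. subNum v x p u \<and> tr u))"
    unfolding INT_ax_def sat_Forall sat_Imp by (simp cong del: imp_cong)
  note INT' = INT[unfolded this]
  have "\<forall>x. tr (numInst v x p)" if "isFm1 v p" "\<forall>x. tr (numInst v x p) \<longrightarrow> tr (numInst v (x + 1) p)" "tr (numInst v 0 p)"
    for v p :: 'a
    using INT'[rule_format, of v p] that unfolding ex_subNum_iff[OF isFm1_isFm[OF that(1)]] by blast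
  from induction_true_if_decided[OF WPT this]
  have ind: "\<exists>p' p0. sub v (cSucc v) p p' \<and> sub v cZero p p0 \<and>
      tr (cImp (cAll v (cImp p p')) (cImp p0 (cAll v p)))" if "isFm1 v p" "decided p" for v p :: 'a
    using that by blast
  show ?thesis
    using models_segment_claims[OF WPT] ind
    unfolding models_def WPT_INT_claims_def by (auto simp: holds_Decided) blast
qed

section \<open>From models on the natural numbers to the type class\<close>

text \<open>The completeness theorem speaks of structures on the natural numbers that are bound variables,
  whereas a type carries fixed operations. The gap is bridged by a single type, which carries a
  structure that refutes one of the claims if there is any, and the standard model otherwise. It is
  a model of \<open>PA\<close> in any case. Since the claims hold in all types of class \<open>pa_model\<close>, this structure
  refutes none of them, and hence no structure does.\<close>

definition standard_interp :: "nat interp" where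
  "standard_interp = Interp 0 Suc (+) (*) (\<lambda>_. True)"

lemma sat_universal_closureI: "(\<And>e. sat I e \<phi>) \<Longrightarrow> sat I e (universal_closure \<phi>)"
proof -
  assume \<phi>: "\<And>e. sat I e \<phi>"
  have "sat I e (foldr Forall xs \<phi>)" for xs e
    by (induction xs arbitrary: e) (simp_all add: \<phi>)
  then show ?thesis unfolding universal_closure_def .
qed

lemma standard_interp_PA: "standard_interp \<Turnstile> PA"
proof -
  have "sat standard_interp e (ind \<phi> x)" for e \<phi> x
    unfolding ind_def
  proof (rule sat_universal_closureI)
    fix e
    have "(\<forall>n. sat standard_interp (e(x := n)) \<phi> \<longrightarrow> sat standard_interp (e(x := Suc n)) \<phi>) \<Longrightarrow>
        sat standard_interp (e(x := 0)) \<phi> \<Longrightarrow> sat standard_interp (e(x := n)) \<phi>" for n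
      by (induction n) auto
    moreover have "(e(x := n))(x := tval standard_interp (e(x := n)) (Succ (Var x))) = e(x := Suc n)"
      "e(x := tval standard_interp e Zero) = e(x := 0)" for n
      by (simp_all add: standard_interp_def)
    ultimately show "sat standard_interp e ((\<^bold>\<forall>x. \<phi> \<^bold>\<longrightarrow> subst1 \<phi> x (Succ (Var x))) \<^bold>\<longrightarrow>
        subst1 \<phi> x Zero \<^bold>\<longrightarrow> (\<^bold>\<forall>x. \<phi>))"
      unfolding sat_Imp sat_Forall sat_subst1 by metis
  qed
  then show ?thesis
    unfolding models_def PA_def by (auto simp: standard_interp_def)
qed

definition refuting :: "nat interp \<Rightarrow> bool" where
  "refuting I \<longleftrightarrow> (I \<Turnstile> WPT \<and> \<not> I \<Turnstile> WPT_claims) \<or>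
     (I \<Turnstile> WPT \<union> {INT_ax} \<and> \<not> I \<Turnstile> WPT_INT_claims)"

lemma refuting_PA: "refuting I \<Longrightarrow> I \<Turnstile> PA"
  by (auto simp: refuting_def models_def WPT_def)

definition critical_interp :: "nat interp" where
  "critical_interp = (if \<exists>I. refuting I then SOME I. refuting I else standard_interp)"

lemma critical_interp_refuting: "refuting I \<Longrightarrow> refuting critical_interp"
  unfolding critical_interp_def by (metis someI_ex)

lemma critical_interp_PA: "critical_interp \<Turnstile> PA"
  unfolding critical_interp_def using refuting_PA standard_interp_PA by (metis someI_ex)

typedef critical = "UNIV :: nat set" ..

lemma sat_isomorphic:
  assumes h: "surj h" "inj h"
    and "h (zeroI J) = zeroI I" "\<And>x. h (sucI J x) = sucI I (h x)"
    and "\<And>x y. h (addI J x y) = addI I (h x) (h y)" "\<And>x y. h (mulI J x y) = mulI I (h x) (h y)"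
    and "\<And>x. trI J x \<longleftrightarrow> trI I (h x)"
  shows "sat J e \<phi> \<longleftrightarrow> sat I (\<lambda>x. h (e x)) \<phi>"
proof -
  have tval: "h (tval J e t) = tval I (\<lambda>x. h (e x)) t" for e t
    by (induction t) (simp_all add: assms)
  show ?thesis
  proof (induction \<phi> arbitrary: e)
    case (Eq t u)
    then show ?case using h(2) by (simp flip: tval add: inj_eq)
  next
    case (Tr t)
    then show ?case by (simp flip: tval add: assms)
  next
    case (Exists x \<phi>)
    have "(\<lambda>y. h ((e(x := a)) y)) = (\<lambda>y. h (e y))(x := h a)" for a by auto
    with Exists show ?case using h(1) by (simp del: fun_upd_apply) (metis surjD)
  qed simp_all
qed

instantiation critical :: pa_model
begin

definition "0 = Abs_critical (zeroI critical_interp)"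
definition "1 = Abs_critical (sucI critical_interp (zeroI critical_interp))"
definition "x + y = Abs_critical (addI critical_interp (Rep_critical x) (Rep_critical y))"
definition "x * y = Abs_critical (mulI critical_interp (Rep_critical x) (Rep_critical y))"
definition "x \<le> y \<longleftrightarrow> (\<exists>z :: critical. y = x + z)"
definition "x < y \<longleftrightarrow> x \<le> y \<and> x \<noteq> (y :: critical)"
definition "x - y = (if y \<le> x then THE z :: critical. x = y + z else 0)"
definition "tr x \<longleftrightarrow> trI critical_interp (Rep_critical x)"

lemma sat_critical:
  "sat (Interp 0 (\<lambda>x. x + 1) (+) (*) tr) e \<phi> \<longleftrightarrow> sat critical_interp (\<lambda>x. Rep_critical (e x)) \<phi>"
proof (rule sat_isomorphic)
  show "surj Rep_critical" by (metis Abs_critical_inverse UNIV_I surjI)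
  show "inj Rep_critical" by (meson Rep_critical_inject injI)
  have ax: "sat critical_interp e \<phi>" if "\<phi> \<in> PA" for e \<phi>
    using critical_interp_PA that unfolding models_def by blast
  have 1: "addI critical_interp x (zeroI critical_interp) = x" for x
    using ax[of "\<^bold>\<forall>0. Add \<^bold>v0 Zero \<^bold>= \<^bold>v0"] by (simp add: PA_def)
  have 2: "addI critical_interp x (sucI critical_interp y) = sucI critical_interp (addI critical_interp x y)"
    for x y
    using ax[of "\<^bold>\<forall>0. \<^bold>\<forall>1. Add \<^bold>v0 (Succ \<^bold>v1) \<^bold>= Succ (Add \<^bold>v0 \<^bold>v1)"] by (simp add: PA_def)
  show "Rep_critical (sucI (Interp 0 (\<lambda>x. x + 1) (+) (*) tr) x) = sucI critical_interp (Rep_critical x)" for x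
    by (simp add: plus_critical_def one_critical_def Abs_critical_inverse 1 2)
qed (simp_all add: zero_critical_def plus_critical_def times_critical_def tr_critical_def Abs_critical_inverse)

instance
proof
  show "Interp 0 (\<lambda>x. x + 1) (+) (*) (tr :: critical \<Rightarrow> bool) \<Turnstile> PA"
    using critical_interp_PA unfolding models_def sat_critical by blast
qed (simp_all add: less_eq_critical_def less_critical_def minus_critical_def)

end

lemma models_critical: "(self_interp :: critical interp) \<Turnstile> Th \<longleftrightarrow> critical_interp \<Turnstile> Th"
proof -
  have "(\<exists>e :: nat \<Rightarrow> critical. \<not> sat critical_interp (\<lambda>x. Rep_critical (e x)) \<phi>) \<longleftrightarrow>
      (\<exists>e. \<not> sat critical_interp e \<phi>)" for \<phi>
  proof
    assume "\<exists>e. \<not> sat critical_interp e \<phi>"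
    then obtain e where "\<not> sat critical_interp e \<phi>" ..
    then have "\<not> sat critical_interp (\<lambda>x. Rep_critical (Abs_critical (e x))) \<phi>"
      by (simp add: Abs_critical_inverse)
    then show "\<exists>e :: nat \<Rightarrow> critical. \<not> sat critical_interp (\<lambda>x. Rep_critical (e x)) \<phi>"
      by (rule exI[of _ "\<lambda>x. Abs_critical (e x)"])
  qed blast
  then show ?thesis unfolding models_def sat_critical by blast
qed

lemma not_refuting: "\<not> refuting I"
proof
  assume "refuting I"
  then have "refuting critical_interp" by (rule critical_interp_refuting)
  then show False
    unfolding refuting_def models_critical[symmetric]
    using models_WPT_claims[where 'a = critical] models_WPT_INT_claims[where 'a = critical] by blast
qed

lemma WPT_proves_claims: "\<phi> \<in> WPT_claims \<Longrightarrow> WPT \<turnstile> \<phi>"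
proof (rule completeness)
  show "PA \<subseteq> WPT" by (auto simp: WPT_def)
  show "I \<Turnstile> {\<phi>}" if "\<phi> \<in> WPT_claims" "I \<Turnstile> WPT" for I :: "nat interp"
    using that not_refuting[of I] unfolding refuting_def models_def by blast
qed

lemma WPT_INT_proves_claims: "\<phi> \<in> WPT_INT_claims \<Longrightarrow> WPT \<union> {INT_ax} \<turnstile> \<phi>"
proof (rule completeness)
  show "PA \<subseteq> WPT \<union> {INT_ax}" by (auto simp: WPT_def)
  show "I \<Turnstile> {\<phi>}" if "\<phi> \<in> WPT_INT_claims" "I \<Turnstile> WPT \<union> {INT_ax}" for I :: "nat interp"
    using that not_refuting[of I] unfolding refuting_def models_def by blast
qed

theorem proposition33:
  shows "partially_classically_compositional WPT \<and> proves_truth_of_induction (WPT \<union> {INT_ax})"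
proof
  show "partially_classically_compositional WPT"
    unfolding partially_classically_compositional_def defines_initial_segment_def
    by (intro exI[of _ Decided] conjI fv_Decided WPT_proves_claims)
      (simp_all add: WPT_claims_def segment_claims_def)
  show "proves_truth_of_induction (WPT \<union> {INT_ax})"
    unfolding proves_truth_of_induction_def defines_initial_segment_def
    by (intro exI[of _ Decided] conjI fv_Decided WPT_INT_proves_claims)
      (simp_all add: WPT_INT_claims_def segment_claims_def)
qed

end
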